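(* Let $X=\bigcup_{v\in V}X_v$ be a graph-directed Bedford–McMullen $(\times m,\times n)$-carpet generated by $(V,E,\{\psi_e\})$, and assume $G=(V,E)$ is irreducible. Then $$\dim_A X=\frac{h_{\mathrm{top}}(\pi\mathcal I)}{\log m}+\sup_{y\in\pi\mathcal I}\frac{h_{\mathrm{top}}(\pi^{-1}(y))}{\log n}.$$ Moreover, the following are equivalent: (i) $\dim_B X=\dim_A X$; (ii) $\dim_H X=\dim_B X$; (iii) $h_{\mathrm{top}}(\mathcal I)=h_{\mathrm{top}}(\pi\mathcal I)+\sup_{y\in\pi\mathcal I}h_{\mathrm{top}}(\pi^{-1}(y))$.
   Context: Let $G=(V,E)$ be a finite directed graph (loops and multiple edges allowed), with initial/terminal vertex maps $i,t$, where every vertex has an outgoing edge. $G$ is irreducible if its adjacency matrix $A$ ($A(v,v')$ = number of edges from $v$ to $v'$) has $\sum_{j\ge1}A^j$ positive. Fix positive integers $n>m$ and for each $e\in E$ a pair $(x_e,y_e)\in\{0,\dots,n-1\}\times\{0,\dots,m-1\}$. Let $\psi_e(\xi_1,\xi_2)=((\xi_1+x_e)/n,(\xi_2+y_e)/m)$. Then $\{X_v\}$ is the unique family of nonempty compact subsets of $[0,1]^2$ with $X_v=\bigcup_{e:\,i(e)=v}\psi_e(X_{t(e)})$. No separation condition is assumed. Let $E^k$ be the admissible words $w=w_1\cdots w_k$ ($w_j\in E$, $t(w_j)=i(w_{j+1})$) and $E^\infty$ the infinite admissible words. Write $x_w=x_{w_1}\cdots x_{w_k}$ and $y_w=y_{w_1}\cdots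 y_{w_k}$. Define - $\mathcal I=\{(x_{\omega_1},y_{\omega_1})(x_{\omega_2},y_{\omega_2})\cdots:\omega\in E^\infty\}$, - $\pi\mathcal I=\{y_{\omega_1}y_{\omega_2}\cdots:\omega\in E^\infty\}$, - $\pi((x_1,y_1)(x_2,y_2)\cdots)=y_1y_2\cdots$. Topological entropies: - $h_{\mathrm{top}}(\mathcal I)=\lim_k\frac1k\log\#\{(x_{w_1},y_{w_1})\cdots(x_{w_k},y_{w_k}):w\in E^k\}$; - $h_{\mathrm{top}}(\pi\mathcal I)=\lim_k\frac1k\log\#\{y_w:w\in E^k\}$; - for $y\in\pi\mathcal I$, $h_{\mathrm{top}}(\pi^{-1}(y))=\limsup_k\frac1k\log\#\{x_w:w\in E^k,\ y_w=y|_k\}$, with $y|_k$ the length-$k$ prefix of $y$. $\dim_H,\dim_B,\dim_A$ denote Hausdorff, box and Assouad dimensions. *)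

theory Defs
  imports "HOL-Analysis.Analysis" "HOL-Library.Liminf_Limsup"
begin

definition diam_pow :: "real \<Rightarrow> 'a::metric_space set \<Rightarrow> ennreal" where
  "diam_pow s U = (if U = {} then 0 else ennreal (diameter U powr s))"

definition hausdorff_content :: "real \<Rightarrow> real \<Rightarrow> 'a::metric_space set \<Rightarrow> ennreal" where
  "hausdorff_content s \<delta> F =
     (INF U \<in> {U :: nat \<Rightarrow> 'a set. F \<subseteq> (\<Union>j. U j) \<and>
                  (\<forall>j. bounded (U j) \<and> diameter (U j) \<le> \<delta>)}. (\<Sum>j. diam_pow s (U j)))"

text \<open>s-dimensional Hausdorff measure: limit as delta tends to 0 (a monotone limit, i.e. a supremum).\<close>
definition hausdorff_measure :: "real \<Rightarrow> 'a::metric_space set \<Rightarrow> ennreal" where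
  "hausdorff_measure s F = (SUP \<delta> \<in> {0<..}. hausdorff_content s \<delta> F)"

definition hausdorff_dim :: "'a::metric_space set \<Rightarrow> real" where
  "hausdorff_dim F = Inf {s. 0 < s \<and> hausdorff_measure s F = 0}"

definition cover_number :: "real \<Rightarrow> 'a::metric_space set \<Rightarrow> nat" where
  "cover_number \<delta> F = Inf {card C | C. finite C \<and> F \<subseteq> \<Union>C \<and>
                                   (\<forall>U\<in>C. bounded U \<and> diameter U \<le> \<delta>)}"

definition box_dim :: "'a::metric_space set \<Rightarrow> real" where
  "box_dim F = Lim (at_right 0) (\<lambda>\<delta>. ln (real (cover_number \<delta> F)) / (- ln \<delta>))"

definition assouad_dim :: "'a::metric_space set \<Rightarrow> real" where
  "assouad_dim F = Inf {s. 0 \<le> s \<and> (\<exists>C>0. \<forall>r R x. 0 < r \<longrightarrow> r < R \<longrightarrow> x \<in> F \<longrightarrow>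
        real (cover_number r (cball x R \<inter> F)) \<le> C * (R / r) powr s)}"

definition adj_matrix :: "'e set \<Rightarrow> ('e \<Rightarrow> 'v) \<Rightarrow> ('e \<Rightarrow> 'v) \<Rightarrow> 'v \<Rightarrow> 'v \<Rightarrow> nat" where
  "adj_matrix E i t v v' = card {e \<in> E. i e = v \<and> t e = v'}"

primrec mat_pow :: "'v set \<Rightarrow> ('v \<Rightarrow> 'v \<Rightarrow> nat) \<Rightarrow> nat \<Rightarrow> 'v \<Rightarrow> 'v \<Rightarrow> nat" where
  "mat_pow V A 0 = (\<lambda>v v'. if v = v' then 1 else 0)"
| "mat_pow V A (Suc k) = (\<lambda>v v'. \<Sum>u\<in>V. mat_pow V A k v u * A u v')"

definition irreducible_graph :: "'v set \<Rightarrow> 'e set \<Rightarrow> ('e \<Rightarrow> 'v) \<Rightarrow> ('e \<Rightarrow> 'v) \<Rightarrow> bool" where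
  "irreducible_graph V E i t \<longleftrightarrow>
     (\<forall>v\<in>V. \<forall>v'\<in>V. \<exists>j\<ge>1. mat_pow V (adj_matrix E i t) j v v' > 0)"

definition adm_words :: "'e set \<Rightarrow> ('e \<Rightarrow> 'v) \<Rightarrow> ('e \<Rightarrow> 'v) \<Rightarrow> nat \<Rightarrow> 'e list set" where
  "adm_words E i t k = {w. length w = k \<and> set w \<subseteq> E \<and>
                          (\<forall>j. Suc j < k \<longrightarrow> t (w ! j) = i (w ! Suc j))}"

definition adm_inf :: "'e set \<Rightarrow> ('e \<Rightarrow> 'v) \<Rightarrow> ('e \<Rightarrow> 'v) \<Rightarrow> (nat \<Rightarrow> 'e) set" where
  "adm_inf E i t = {\<omega>. (\<forall>j. \<omega> j \<in> E) \<and> (\<forall>j. t (\<omega> j) = i (\<omega> (Suc j)))}"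

definition piI :: "'e set \<Rightarrow> ('e \<Rightarrow> 'v) \<Rightarrow> ('e \<Rightarrow> 'v) \<Rightarrow> ('e \<Rightarrow> nat) \<Rightarrow> (nat \<Rightarrow> nat) set" where
  "piI E i t yd = {(\<lambda>j. yd (\<omega> j)) | \<omega>. \<omega> \<in> adm_inf E i t}"

definition htop_I :: "'e set \<Rightarrow> ('e \<Rightarrow> 'v) \<Rightarrow> ('e \<Rightarrow> 'v) \<Rightarrow> ('e \<Rightarrow> nat) \<Rightarrow> ('e \<Rightarrow> nat) \<Rightarrow> real" where
  "htop_I E i t xd yd = lim (\<lambda>k. ln (real (card
      ((\<lambda>w. map (\<lambda>e. (xd e, yd e)) w) ` adm_words E i t k))) / real k)"

definition htop_piI :: "'e set \<Rightarrow> ('e \<Rightarrow> 'v) \<Rightarrow> ('e \<Rightarrow> 'v) \<Rightarrow> ('e \<Rightarrow> nat) \<Rightarrow> real" where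
  "htop_piI E i t yd = lim (\<lambda>k. ln (real (card (map yd ` adm_words E i t k))) / real k)"

definition htop_fibre :: "'e set \<Rightarrow> ('e \<Rightarrow> 'v) \<Rightarrow> ('e \<Rightarrow> 'v) \<Rightarrow> ('e \<Rightarrow> nat) \<Rightarrow> ('e \<Rightarrow> nat)
                          \<Rightarrow> (nat \<Rightarrow> nat) \<Rightarrow> real" where
  "htop_fibre E i t xd yd y = real_of_ereal (limsup (\<lambda>k. ereal (ln (real (card
      (map xd ` {w \<in> adm_words E i t k. map yd w = map y [0..<k]}))) / real k)))"

definition psi :: "nat \<Rightarrow> nat \<Rightarrow> nat \<Rightarrow> nat \<Rightarrow> real \<times> real \<Rightarrow> real \<times> real" where
  "psi n m a b = (\<lambda>(\<xi>1, \<xi>2). ((\<xi>1 + real a) / real n, (\<xi>2 + real b) / real m))"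

end

theory Submission
  imports Defs
begin

text \<open>
  Write \<open>hI\<close>, \<open>hy\<close>, \<open>hF\<close> for the growth rates of the number of digit words, of the number of
  \<open>y\<close>-words, and of the largest number \<open>f u\<close> of \<open>x\<close>-words above one \<open>y\<close>-word \<open>u\<close>, and put
  \<open>\<alpha> = ln m / ln n\<close>. By irreducibility each of these three numbers is multiplicative in the word length up to
  a bounded factor, hence equal to \<open>exp (k h)\<close> up to a constant; repeating one good loop shows that
  \<open>hF\<close> is the supremum of the fibre entropies. Counting approximate squares (\<open>\<lfloor>\<alpha> k\<rfloor>\<close> digits in the
  direction \<open>x\<close>, \<open>k\<close> in the direction \<open>y\<close>) gives \<open>dim\<^sub>B = (\<alpha> hI + (1 - \<alpha>) hy) / ln m\<close>, and counting those inside
  a larger one gives \<open>dim\<^sub>A = (hy + \<alpha> hF) / ln m\<close>. These agree exactly when \<open>hI = hy + hF\<close>.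

  For every \<open>L\<close>, McMullen's cover yields \<open>dim\<^sub>H \<le> ln Z / (L ln m)\<close> with \<open>Z = (\<Sum>u. f u ^ \<alpha>)\<close>, the sum over
  \<open>y\<close>-words of length \<open>L\<close>, and Hoelder's inequality bounds this by \<open>dim\<^sub>B\<close>. If \<open>hI < hy + hF\<close>, some word \<open>u0\<close> is far more
  frequent when \<open>y\<close>-words are weighted by \<open>f\<close> than when they are counted; asking block after block
  whether \<open>u0\<close> occurs makes Hoelder's inequality lose a fixed factor per block, so \<open>dim\<^sub>H < dim\<^sub>B\<close>.
  If \<open>hI = hy + hF\<close>, a fixed proportion of the \<open>y\<close>-words has almost maximal \<open>f\<close>, and \<open>X\<close> contains
  self-affine sets with uniform fibres whose dimension is arbitrarily close to \<open>dim\<^sub>B\<close>.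
\<close>

section \<open>Growth rates and counting\<close>

text \<open>No separation is assumed, so edge words, digit words and points of \<open>X\<close>
  correspond only in a many-to-one way. All counts are therefore counts of distinct digit words, and
  geometry enters only through closed grid cells: a set not larger than a cell contains marked
  points of boundedly many cells. This bounded overlap replaces disjointness.

  Irreducibility does not give aperiodicity, so two words can be joined only by a connecting word of
  bounded, not prescribed, length, and every count loses a constant. Such constants vanish in growth
  rates, but they obstruct the strict inequality between Hausdorff and box dimension: a fixed loss
  in a single use of Hoelder's inequality would be swallowed by the constant. The loss has to recur
  in every block, uniformly over all prefixes, until the product beats the constant; hence the
  counts with prescribed prefix.

  No formula for the Hausdorff dimension is derived. Only its comparison with the box dimension
  matters, and for this McMullen's bound at finite word lengths and, in the case of equality, free
  concatenations of loops at one vertex suffice.\<close>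

lemma quasi_additive_growth:
  fixes b :: "nat \<Rightarrow> real"
  assumes qa: "\<And>k l. \<bar>b (k + l) - b k - b l\<bar> \<le> c"
  obtains h where "(\<lambda>k. b k / real k) \<longlonglongrightarrow> h" and "\<And>k. \<bar>b k - real k * h\<bar> \<le> c"
proof -
  have mult: "\<bar>b (j * k) - real j * b k\<bar> \<le> real j * c + c" for j k
  proof (induction j)
    case 0
    show ?case using qa[of 0 0] by simp
  next
    case (Suc j)
    have "\<bar>b (k + j * k) - b k - b (j * k)\<bar> \<le> c" by (rule qa)
    with Suc show ?case by (simp add: algebra_simps)
  qed
  have c0: "0 \<le> c" using qa[of 0 0] by linarith
  \<comment> \<open>Both \<open>real j * b k\<close> and \<open>real k * b j\<close> approximate
    \<open>b (j * k)\<close>, so \<open>mult\<close> with the two roles exchanged bounds their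
    difference.\<close>
  have step: "\<bar>b j / real j - b k / real k\<bar> \<le> (2 * c) / real k + (2 * c) / real j"
    if "0 < j" "0 < k" for j k
  proof -
    have "\<bar>real j * b k - real k * b j\<bar> \<le> (real j + real k) * c + 2 * c"
      using mult[of j k] mult[of k j] by (simp add: mult.commute algebra_simps)
    also have "\<dots> \<le> (real j + real k) * (2 * c)"
    proof -
      have "1 \<le> real j" "1 \<le> real k" using that by auto
      then have "2 * c \<le> (real j + real k) * c" using c0 by (intro mult_right_mono) auto
      then show ?thesis by (simp add: algebra_simps)
    qed
    finally have "\<bar>real j * b k - real k * b j\<bar> / (real j * real k)
        \<le> (real j + real k) * (2 * c) / (real j * real k)"
      by (intro divide_right_mono) auto
    moreover have "b j / real j - b k / real k = - ((real j * b k - real k * b j) / (real j * real k))"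
      using that by (simp add: field_simps)
    moreover have "(real j + real k) * (2 * c) / (real j * real k) = (2 * c) / real k + (2 * c) / real j"
      using that by (simp add: field_simps)
    ultimately show ?thesis by (simp add: abs_mult)
  qed
  have "Cauchy (\<lambda>k. b k / real k)"
  proof (rule metric_CauchyI)
    fix e :: real assume "0 < e"
    obtain M where M: "4 * c / e < real M" using reals_Archimedean2 by blast
    show "\<exists>M. \<forall>m\<ge>M. \<forall>n\<ge>M. dist (b m / real m) (b n / real n) < e"
    proof (intro exI[of _ "Suc M"] allI impI)
      fix m n assume mn: "Suc M \<le> m" "Suc M \<le> n"
      have small: "(2 * c) / real k < e / 2" if "Suc M \<le> k" for k
      proof -
        have "4 * c / e < real k" using M that by linarith
        then show ?thesis using \<open>0 < e\<close> that by (simp add: field_simps)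
      qed
      show "dist (b m / real m) (b n / real n) < e"
        using step[of m n] small[OF mn(1)] small[OF mn(2)] mn by (simp add: dist_real_def)
    qed
  qed
  then obtain h where h: "(\<lambda>k. b k / real k) \<longlonglongrightarrow> h"
    using Cauchy_convergent_iff convergent_def by blast
  have "\<bar>b k - real k * h\<bar> \<le> c" for k
  proof (cases "k = 0")
    case True
    then show ?thesis using qa[of 0 0] by simp
  next
    case False
    \<comment> \<open>The limit is taken along multiples of \<open>k\<close>: there
      \<open>mult\<close> compares \<open>b (j * k) / j\<close> with \<open>b k\<close> itself, and
      the surplus \<open>c / j\<close> disappears.\<close>
    have "(\<lambda>j. b (j * k) / real (j * k)) \<longlonglongrightarrow> h"
    proof -
      have "filterlim (\<lambda>j. j * k) at_top sequentially"
        using False by (simp add: mult_nat_right_at_top)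
      from filterlim_compose[OF h this] show ?thesis .
    qed
    then have L1: "(\<lambda>j. \<bar>b (j * k) / real (j * k) * real k - b k\<bar>) \<longlonglongrightarrow> \<bar>h * real k - b k\<bar>"
      by (intro tendsto_intros)
    have L2: "(\<lambda>j. c + c / real j) \<longlonglongrightarrow> c + 0"
      by (intro tendsto_intros lim_const_over_n)
    have "\<bar>h * real k - b k\<bar> \<le> c + 0"
    proof (rule LIMSEQ_le[OF L1 L2], intro exI[of _ 1] allI impI)
      fix j :: nat assume "1 \<le> j"
      have "b (j * k) / real (j * k) * real k - b k = (b (j * k) - real j * b k) / real j"
        using \<open>1 \<le> j\<close> False by (simp add: field_simps)
      then have "\<bar>b (j * k) / real (j * k) * real k - b k\<bar> = \<bar>b (j * k) - real j * b k\<bar> / real j"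
        by (simp add: abs_divide)
      also have "\<dots> \<le> (real j * c + c) / real j"
        by (intro divide_right_mono mult) auto
      also have "\<dots> = c + c / real j" using \<open>1 \<le> j\<close> by (simp add: field_simps)
      finally show "\<bar>b (j * k) / real (j * k) * real k - b k\<bar> \<le> c + c / real j" .
    qed
    then show ?thesis by (simp add: abs_minus_commute mult.commute)
  qed
  with h that show thesis by blast
qed

lemma quasi_multiplicative_growth:
  fixes a :: "nat \<Rightarrow> real"
  assumes ge1: "\<And>k. 1 \<le> a k"
    and upper: "\<And>k l. a (k + l) \<le> a k * a l"
    and lower: "\<And>k l. a k * a l \<le> C * a (k + l)"
    and C: "1 \<le> C"
  obtains h where "(\<lambda>k. ln (a k) / real k) \<longlonglongrightarrow> h" and "0 \<le> h"
    and "\<And>k. exp (real k * h) \<le> C * a k" and "\<And>k. a k \<le> C * exp (real k * h)"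
proof -
  have pos: "0 < a k" for k using ge1[of k] by linarith
  have "\<bar>ln (a (k + l)) - ln (a k) - ln (a l)\<bar> \<le> ln C" for k l
  proof -
    have "ln (a (k + l)) \<le> ln (a k * a l)" using upper pos by simp
    moreover have "ln (a k * a l) \<le> ln (C * a (k + l))" using lower pos C by (simp del: ln_mult)
    moreover have "0 \<le> ln C" using C by simp
    ultimately show ?thesis using pos[of k] pos[of l] pos[of "k + l"] C by (simp add: ln_mult)
  qed
  from quasi_additive_growth[of "\<lambda>k. ln (a k)", OF this] obtain h
    where h: "(\<lambda>k. ln (a k) / real k) \<longlonglongrightarrow> h"
      and b: "\<And>k. \<bar>ln (a k) - real k * h\<bar> \<le> ln C" by metis
  have "0 \<le> h"
    using h by (rule LIMSEQ_le_const) (use ge1 in \<open>auto intro!: divide_nonneg_nonneg\<close>)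
  moreover have "exp (real k * h) \<le> C * a k" for k
  proof -
    have "exp (real k * h) \<le> exp (ln C + ln (a k))" using b[of k] by simp
    then show ?thesis using pos[of k] C by (simp add: exp_add)
  qed
  moreover have "a k \<le> C * exp (real k * h)" for k
  proof -
    have "exp (ln (a k)) \<le> exp (ln C + real k * h)" using b[of k] by simp
    then show ?thesis using pos[of k] C by (simp add: exp_add)
  qed
  ultimately show thesis using h that by blast
qed

lemma card_UN_pigeonhole:
  assumes "finite A" "A \<noteq> {}"
  obtains a where "a \<in> A" "card (\<Union>x\<in>A. S x) \<le> card A * card (S a)"
proof -
  have "Max ((\<lambda>x. card (S x)) ` A) \<in> (\<lambda>x. card (S x)) ` A"
    using assms by (intro Max_in) auto
  then obtain a where a: "a \<in> A" "Max ((\<lambda>x. card (S x)) ` A) = card (S a)" by blast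
  then have le: "card (S x) \<le> card (S a)" if "x \<in> A" for x
    using assms(1) that by (metis (no_types, lifting) Max_ge finite_imageI image_eqI)
  have "card (\<Union>x\<in>A. S x) \<le> (\<Sum>x\<in>A. card (S x))" by (rule card_UN_le[OF assms(1)])
  also have "\<dots> \<le> card A * card (S a)"
    using sum_bounded_above[of A "\<lambda>x. card (S x)" "card (S a)"] le by simp
  finally show thesis using a that by blast
qed

text \<open>On \<open>A\<close> the map \<open>f\<close> factors through \<open>g\<close>.
  Comparisons between codes of different shape are reduced to this.\<close>

lemma card_image_le_determined:
  assumes "finite A" and "\<And>x y. x \<in> A \<Longrightarrow> y \<in> A \<Longrightarrow> g x = g y \<Longrightarrow> f x = f y"
  shows "card (f ` A) \<le> card (g ` A)"
proof -
  define s where "s z = f (SOME x. x \<in> A \<and> g x = z)" for z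
  have "f x = s (g x)" if "x \<in> A" for x
  proof -
    have "\<exists>x'. x' \<in> A \<and> g x' = g x" using that by blast
    then have "(SOME x'. x' \<in> A \<and> g x' = g x) \<in> A \<and> g (SOME x'. x' \<in> A \<and> g x' = g x) = g x"
      by (rule someI_ex)
    then show ?thesis unfolding s_def using assms(2) that by metis
  qed
  then have "f ` A = s ` (g ` A)" by (auto simp: image_image)
  then show ?thesis using card_image_le[of "g ` A" s] assms(1) by simp
qed

lemma card_append_product:
  assumes "\<And>x. x \<in> A \<Longrightarrow> length x = k"
  shows "card ((\<lambda>(x, y). x @ y) ` (A \<times> B)) = card A * card B"
proof -
  have "inj_on (\<lambda>(x, y). x @ y) (A \<times> B)"
    using assms by (auto simp: inj_on_def)
  then show ?thesis by (simp add: card_image card_cartesian_product)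
qed

section \<open>Hoelder's inequality and a quantitative improvement\<close>

lemma powr_Young:
  fixes a b \<alpha> :: real
  assumes "0 < \<alpha>" "\<alpha> < 1" "0 \<le> a" "0 \<le> b"
  shows "a powr \<alpha> * b powr (1 - \<alpha>) \<le> \<alpha> * a + (1 - \<alpha>) * b"
proof (cases "a = 0 \<or> b = 0")
  case True
  then show ?thesis using assms by auto
next
  case False
  then show ?thesis using Youngs_inequality_0[of \<alpha> "1 - \<alpha>" a b] assms by auto
qed

lemma powr_Hoelder_sum:
  fixes a b :: "'a \<Rightarrow> real" and \<alpha> :: real
  assumes \<alpha>: "0 < \<alpha>" "\<alpha> < 1" and "finite S"
    and nn: "\<And>x. x \<in> S \<Longrightarrow> 0 \<le> a x" "\<And>x. x \<in> S \<Longrightarrow> 0 \<le> b x"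
  shows "(\<Sum>x\<in>S. a x powr \<alpha> * b x powr (1 - \<alpha>)) \<le> (\<Sum>x\<in>S. a x) powr \<alpha> * (\<Sum>x\<in>S. b x) powr (1 - \<alpha>)"
proof -
  define A B where "A = (\<Sum>x\<in>S. a x)" and "B = (\<Sum>x\<in>S. b x)"
  have A0: "0 \<le> A" and B0: "0 \<le> B" unfolding A_def B_def using nn by (auto intro: sum_nonneg)
  show ?thesis
  proof (cases "A = 0 \<or> B = 0")
    case True
    then have "\<forall>x\<in>S. a x powr \<alpha> * b x powr (1 - \<alpha>) = 0"
      unfolding A_def B_def using nn assms(3) by (auto simp: sum_nonneg_eq_0_iff)
    then have "(\<Sum>x\<in>S. a x powr \<alpha> * b x powr (1 - \<alpha>)) = 0" by (intro sum.neutral)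
    then show ?thesis by simp
  next
    case False
    then have AB: "0 < A" "0 < B" using A0 B0 by auto
    have "(\<Sum>x\<in>S. a x powr \<alpha> * b x powr (1 - \<alpha>))
        = A powr \<alpha> * B powr (1 - \<alpha>) * (\<Sum>x\<in>S. (a x / A) powr \<alpha> * (b x / B) powr (1 - \<alpha>))"
      unfolding sum_distrib_left
      by (intro sum.cong refl) (use AB nn in \<open>simp add: powr_divide\<close>)
    also have "\<dots> \<le> A powr \<alpha> * B powr (1 - \<alpha>) * (\<Sum>x\<in>S. \<alpha> * (a x / A) + (1 - \<alpha>) * (b x / B))"
      by (intro mult_left_mono sum_mono powr_Young \<alpha>) (use AB nn in auto)
    also have "(\<Sum>x\<in>S. \<alpha> * (a x / A) + (1 - \<alpha>) * (b x / B)) = \<alpha> * (A / A) + (1 - \<alpha>) * (B / B)"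
      unfolding A_def B_def
      by (simp only: sum.distrib sum_distrib_left[symmetric] sum_divide_distrib[symmetric])
    also have "\<dots> = 1" using AB by simp
    finally show ?thesis unfolding A_def B_def by simp
  qed
qed

text \<open>Hoelder's inequality is applied on \<open>B\<close> and on its complement separately.
  With \<open>p'\<close> and \<open>q'\<close> the shares of \<open>B\<close> under the two weights,
  \<open>q' \<le> t * p'\<close> makes the part of \<open>B\<close> at most
  \<open>p' * \<alpha> / 2\<close>, while Young's inequality bounds the rest by
  \<open>1 - \<alpha> * p'\<close>. A set that is relatively much lighter under \<open>b\<close>
  than under \<open>a\<close> thus forces a loss proportional to its \<open>a\<close>-share.\<close>

lemma powr_Hoelder_gap:
  fixes a b :: "'a \<Rightarrow> real" and \<alpha> t p0 :: real
  assumes \<alpha>: "0 < \<alpha>" "\<alpha> < 1" and S: "finite S" "B \<subseteq> S"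
    and nn: "\<And>x. x \<in> S \<Longrightarrow> 0 \<le> a x" "\<And>x. x \<in> S \<Longrightarrow> 0 \<le> b x"
    and pos: "0 < sum a S" "0 < sum b S" "0 \<le> t"
    and p: "p0 * sum a S \<le> sum a B" and q: "sum b B * sum a S \<le> t * sum a B * sum b S"
    and t: "t powr (1 - \<alpha>) \<le> \<alpha> / 2"
  shows "(\<Sum>x\<in>S. a x powr \<alpha> * b x powr (1 - \<alpha>)) \<le> (1 - p0 * \<alpha> / 2) * (sum a S powr \<alpha> * sum b S powr (1 - \<alpha>))"
proof -
  define A b' where "A = sum a S" and "b' = sum b S"
  define p' q' where "p' = sum a B / A" and "q' = sum b B / b'"
  have AB: "0 < A" "0 < b'" using pos unfolding A_def b'_def by auto
  have finB: "finite B" using S finite_subset by blast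
  have sB: "0 \<le> sum a B" "0 \<le> sum b B" using nn S(2) by (auto intro!: sum_nonneg)
  have sC: "sum a (S - B) = A - sum a B" "sum b (S - B) = b' - sum b B"
    unfolding A_def b'_def using S by (simp_all add: sum_diff)
  have sCn: "0 \<le> sum a (S - B)" "0 \<le> sum b (S - B)" using nn by (auto intro!: sum_nonneg)
  have pq: "0 \<le> p'" "p' \<le> 1" "0 \<le> q'" "q' \<le> 1" "p0 \<le> p'"
  proof -
    show "0 \<le> p'" "0 \<le> q'" unfolding p'_def q'_def using AB sB by simp_all
    show "p' \<le> 1" "q' \<le> 1" unfolding p'_def q'_def using AB sC sCn by simp_all
    show "p0 \<le> p'" unfolding p'_def using AB p by (simp add: pos_le_divide_eq A_def)
  qed
  have "sum b B * A / (A * b') \<le> t * sum a B * b' / (A * b')"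
    using q AB unfolding A_def b'_def by (intro divide_right_mono) auto
  then have qt: "q' \<le> t * p'" unfolding p'_def q'_def using AB by simp
  let ?f = "\<lambda>x. a x powr \<alpha> * b x powr (1 - \<alpha>)"
  have "sum ?f S = sum ?f B + sum ?f (S - B)"
    using sum.subset_diff[OF S(2,1), of ?f] by simp
  also have "\<dots> \<le> sum a B powr \<alpha> * sum b B powr (1 - \<alpha>) + sum a (S - B) powr \<alpha> * sum b (S - B) powr (1 - \<alpha>)"
    using S(2) by (intro add_mono powr_Hoelder_sum \<alpha> finB nn finite_Diff S(1)) auto
  also have "\<dots> = (p' powr \<alpha> * q' powr (1 - \<alpha>) + (1 - p') powr \<alpha> * (1 - q') powr (1 - \<alpha>)) * (A powr \<alpha> * b' powr (1 - \<alpha>))"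
  proof -
    have eqs: "sum a B = p' * A" "sum b B = q' * b'" "sum a (S - B) = (1 - p') * A" "sum b (S - B) = (1 - q') * b'"
      unfolding sC unfolding p'_def q'_def using AB by (simp_all add: field_simps)
    show ?thesis unfolding eqs using pq AB by (simp add: powr_mult distrib_right distrib_left ac_simps)
  qed
  also have "\<dots> \<le> (p' * \<alpha> / 2 + (1 - \<alpha> * p')) * (A powr \<alpha> * b' powr (1 - \<alpha>))"
  proof (intro mult_right_mono add_mono)
    have "p' powr \<alpha> * q' powr (1 - \<alpha>) \<le> p' powr \<alpha> * (t * p') powr (1 - \<alpha>)"
      using qt pq \<alpha> by (intro mult_left_mono powr_mono2) auto
    also have "\<dots> = p' * t powr (1 - \<alpha>)"
    proof (cases "p' = 0")
      case False
      then have "p' powr \<alpha> * p' powr (1 - \<alpha>) = p'" using pq by (simp flip: powr_add)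
      then show ?thesis using pq pos(3) by (simp add: powr_mult algebra_simps)
    qed simp
    also have "\<dots> \<le> p' * (\<alpha> / 2)" by (intro mult_left_mono t pq)
    finally show "p' powr \<alpha> * q' powr (1 - \<alpha>) \<le> p' * \<alpha> / 2" by simp
    have "(1 - p') powr \<alpha> * (1 - q') powr (1 - \<alpha>) \<le> \<alpha> * (1 - p') + (1 - \<alpha>) * (1 - q')"
      using pq by (intro powr_Young \<alpha>) auto
    also have "\<dots> \<le> \<alpha> * (1 - p') + (1 - \<alpha>) * 1" using pq \<alpha> by (intro add_left_mono mult_left_mono) auto
    finally show "(1 - p') powr \<alpha> * (1 - q') powr (1 - \<alpha>) \<le> 1 - \<alpha> * p'" by (simp add: algebra_simps)
  qed simp
  also have "\<dots> \<le> (1 - p0 * \<alpha> / 2) * (A powr \<alpha> * b' powr (1 - \<alpha>))"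
  proof (rule mult_right_mono)
    have "p0 * \<alpha> \<le> p' * \<alpha>" using pq \<alpha> by (intro mult_right_mono) auto
    then show "p' * \<alpha> / 2 + (1 - \<alpha> * p') \<le> 1 - p0 * \<alpha> / 2" by (simp add: algebra_simps)
  qed simp
  finally show ?thesis unfolding A_def b'_def .
qed

lemma length_concat_const:
  "(\<And>j. j < k \<Longrightarrow> length (f j) = c) \<Longrightarrow> length (concat (map f [0..<k])) = k * c"
  by (induction k) auto

lemma block_of_concat:
  "(\<And>j. j < N \<Longrightarrow> length (f j) = L) \<Longrightarrow> j < N \<Longrightarrow> take L (drop (j * L) (concat (map f [0..<N]))) = f j"
proof (induction N)
  case (Suc N)
  have len: "length (concat (map f [0..<N])) = N * L" by (rule length_concat_const) (use Suc.prems in auto)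
  have N: "concat (map f [0..<Suc N]) = concat (map f [0..<N]) @ f N" by simp
  show ?case
  proof (cases "j = N")
    case True
    then show ?thesis unfolding N using len Suc.prems(1)[of N] by simp
  next
    case False
    then have "j < N" using Suc.prems(2) by simp
    then have "Suc j * L \<le> N * L" by (intro mult_right_mono) auto
    then have "take L (drop (j * L) (concat (map f [0..<N]) @ f N)) = take L (drop (j * L) (concat (map f [0..<N])))"
      using len by simp
    then show ?thesis unfolding N using Suc.IH[OF Suc.prems(1) \<open>j < N\<close>] by simp
  qed
qed simp

section \<open>Digit expansions and grid cells\<close>

definition radix :: "nat \<Rightarrow> nat list \<Rightarrow> nat" where
  "radix b ds = foldl (\<lambda>a d. a * b + d) 0 ds"

lemma radix_Nil [simp]: "radix b [] = 0"
  by (simp add: radix_def)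

lemma radix_snoc [simp]: "radix b (ds @ [d]) = radix b ds * b + d"
  by (simp add: radix_def)

lemma radix_append: "radix b (us @ vs) = radix b us * b ^ length vs + radix b vs"
proof (induction vs rule: rev_induct)
  case (snoc v vs)
  have "radix b (us @ vs @ [v]) = radix b (us @ vs) * b + v"
    using radix_snoc[of b "us @ vs" v] by simp
  with snoc show ?case by (simp add: algebra_simps)
qed simp

lemma radix_less: "\<forall>d\<in>set ds. d < b \<Longrightarrow> radix b ds < b ^ length ds"
proof (induction ds rule: rev_induct)
  case (snoc d ds)
  then have "radix b ds + 1 \<le> b ^ length ds" and "d < b" by auto
  then have "(radix b ds + 1) * b \<le> b ^ length ds * b" by (intro mult_right_mono) auto
  with \<open>d < b\<close> show ?case by (simp add: algebra_simps)
qed simp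

lemma radix_inject:
  assumes "length us = length vs" "\<forall>d\<in>set us. d < b" "\<forall>d\<in>set vs. d < b" "radix b us = radix b vs"
  shows "us = vs"
  using assms
proof (induction us arbitrary: vs rule: rev_induct)
  case (snoc u us)
  then obtain ws w where vs: "vs = ws @ [w]" by (metis length_0_conv rev_exhaust snoc_eq_iff_butlast)
  have eq: "radix b us * b + u = radix b ws * b + w" using snoc.prems vs by simp
  have ub: "u < b" "w < b" using snoc.prems vs by auto
  then have "u = w" using arg_cong[OF eq, of "\<lambda>z. z mod b"] by simp
  moreover have "radix b us = radix b ws" using eq ub \<open>u = w\<close> by simp
  then have "us = ws" by (intro snoc.IH) (use snoc.prems vs in auto)
  ultimately show ?case using vs by simp
qed simp

text \<open>The number \<open>c\<close> lies in the closed \<open>b\<close>-adic interval of the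
  numbers with an expansion starting with \<open>ds\<close>. Being closed, the interval shares its
  endpoints with its neighbours, as points with two expansions require.\<close>

definition in_cell :: "nat \<Rightarrow> real \<Rightarrow> nat list \<Rightarrow> bool" where
  "in_cell b c ds \<longleftrightarrow> real (radix b ds) \<le> c * real b ^ length ds
     \<and> c * real b ^ length ds \<le> real (radix b ds) + 1"

text \<open>Nested intervals: the digits \<open>vs\<close> contribute at most
  \<open>b ^ length vs - 1\<close>, so the closed interval of the longer word stays inside that of
  the shorter one.\<close>

lemma in_cell_append:
  assumes "in_cell b c (us @ vs)" "\<forall>d\<in>set vs. d < b" "0 < b"
  shows "in_cell b c us"
proof -
  define B where "B = real b ^ length vs"
  have B: "0 < B" using assms(3) by (simp add: B_def)
  have r: "real (radix b (us @ vs)) = real (radix b us) * B + real (radix b vs)"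
    by (simp add: radix_append B_def)
  have "radix b vs + 1 \<le> b ^ length vs" using radix_less[OF assms(2)] by simp
  then have v: "real (radix b vs) + 1 \<le> B"
    unfolding B_def by (metis of_nat_1 of_nat_add of_nat_le_iff of_nat_power)
  have c: "c * real b ^ length (us @ vs) = (c * real b ^ length us) * B"
    by (simp add: B_def power_add)
  have "real (radix b us) * B \<le> (c * real b ^ length us) * B"
    using assms(1) unfolding in_cell_def c r by linarith
  moreover have "(c * real b ^ length us) * B \<le> (real (radix b us) + 1) * B"
    using assms(1) v unfolding in_cell_def c r by (simp add: algebra_simps)
  ultimately show ?thesis using B unfolding in_cell_def by simp
qed

lemma in_cell_take:
  assumes "in_cell b c ds" "\<forall>d\<in>set ds. d < b" "0 < b"
  shows "in_cell b c (take l ds)"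
  using in_cell_append[of b c "take l ds" "drop l ds"] assms by (auto dest: in_set_dropD)

lemma in_cell_radix_diff:
  assumes "in_cell b c us" "in_cell b c' vs" "length us = k" "length vs = k"
    and "\<bar>c - c'\<bar> * real b ^ k \<le> real J"
  shows "radix b us \<le> radix b vs + J + 1"
proof -
  have "c * real b ^ k - c' * real b ^ k \<le> real J"
    using assms(5) by (smt (verit) left_diff_distrib mult_right_mono zero_le_power of_nat_0_le_iff)
  then have "real (radix b us) \<le> real (radix b vs) + real J + 1"
    using assms(1-4) unfolding in_cell_def by auto
  then show ?thesis by linarith
qed

lemma card_le_of_spread:
  fixes A :: "nat set"
  assumes "finite A" "\<And>x y. x \<in> A \<Longrightarrow> y \<in> A \<Longrightarrow> x \<le> y + J"
  shows "card A \<le> J + 1"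
proof (cases "A = {}")
  case False
  then have "Min A \<in> A" using assms(1) by (rule Min_in[rotated])
  then have "A \<subseteq> {Min A..Min A + J}" using assms by (auto intro: Min_le)
  then have "card A \<le> card {Min A..Min A + J}" by (intro card_mono) auto
  then show ?thesis by simp
qed simp

text \<open>Neighbouring closed cells overlap, so radix values of points at most \<open>J\<close> cells apart may
  differ by \<open>J + 1\<close>.\<close>

lemma grid_count:
  fixes p :: "'t \<Rightarrow> real \<times> real"
  assumes fin: "finite T"
    and xs: "\<And>\<tau>. \<tau> \<in> T \<Longrightarrow> in_cell n (fst (p \<tau>)) (xs \<tau>) \<and> length (xs \<tau>) = l \<and> (\<forall>d\<in>set (xs \<tau>). d < n)"
    and ys: "\<And>\<tau>. \<tau> \<in> T \<Longrightarrow> in_cell m (snd (p \<tau>)) (ys \<tau>) \<and> length (ys \<tau>) = k \<and> (\<forall>d\<in>set (ys \<tau>). d < m)"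
    and dist: "\<And>\<sigma> \<tau>. \<sigma> \<in> T \<Longrightarrow> \<tau> \<in> T \<Longrightarrow> dist (p \<sigma>) (p \<tau>) \<le> r"
    and r: "r * real n ^ l \<le> real J" "r * real m ^ k \<le> real J"
  shows "card ((\<lambda>\<tau>. (xs \<tau>, ys \<tau>)) ` T) \<le> (J + 2)\<^sup>2"
proof -
  \<comment> \<open>Words of fixed length with valid digits are determined by their radix values, so
    integers in two short ranges are counted instead.\<close>
  have "card ((\<lambda>\<tau>. (xs \<tau>, ys \<tau>)) ` T) \<le> card ((\<lambda>\<tau>. (radix n (xs \<tau>), radix m (ys \<tau>))) ` T)"
  proof (rule card_image_le_determined[OF fin])
    fix \<sigma> \<tau> assume st: "\<sigma> \<in> T" "\<tau> \<in> T"
      "(radix n (xs \<sigma>), radix m (ys \<sigma>)) = (radix n (xs \<tau>), radix m (ys \<tau>))"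
    have "xs \<sigma> = xs \<tau>" by (rule radix_inject[of _ _ n]) (use st xs in auto)
    moreover have "ys \<sigma> = ys \<tau>" by (rule radix_inject[of _ _ m]) (use st ys in auto)
    ultimately show "(xs \<sigma>, ys \<sigma>) = (xs \<tau>, ys \<tau>)" by simp
  qed
  also have "\<dots> \<le> card (((\<lambda>\<tau>. radix n (xs \<tau>)) ` T) \<times> ((\<lambda>\<tau>. radix m (ys \<tau>)) ` T))"
    by (intro card_mono) (use fin in auto)
  also have "\<dots> = card ((\<lambda>\<tau>. radix n (xs \<tau>)) ` T) * card ((\<lambda>\<tau>. radix m (ys \<tau>)) ` T)"
    by (rule card_cartesian_product)
  also have "\<dots> \<le> (J + 2) * (J + 2)"
  proof (rule mult_mono)
    show "card ((\<lambda>\<tau>. radix n (xs \<tau>)) ` T) \<le> J + 2"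
    proof (rule order_trans[OF card_le_of_spread[of _ "J + 1"]])
      fix x y assume "x \<in> (\<lambda>\<tau>. radix n (xs \<tau>)) ` T" "y \<in> (\<lambda>\<tau>. radix n (xs \<tau>)) ` T"
      then obtain \<sigma> \<tau> where st: "\<sigma> \<in> T" "\<tau> \<in> T" "x = radix n (xs \<sigma>)" "y = radix n (xs \<tau>)" by auto
      have "\<bar>fst (p \<sigma>) - fst (p \<tau>)\<bar> \<le> r"
        using dist[OF st(1,2)] dist_fst_le[of "p \<sigma>" "p \<tau>"] by (simp add: dist_real_def)
      then have "\<bar>fst (p \<sigma>) - fst (p \<tau>)\<bar> * real n ^ l \<le> r * real n ^ l"
        by (intro mult_right_mono) auto
      then have "\<bar>fst (p \<sigma>) - fst (p \<tau>)\<bar> * real n ^ l \<le> real J" using r by linarith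
      then show "x \<le> y + (J + 1)"
        using in_cell_radix_diff[of n "fst (p \<sigma>)" "xs \<sigma>" "fst (p \<tau>)" "xs \<tau>" l J] xs st by auto
    qed (use fin in auto)
    show "card ((\<lambda>\<tau>. radix m (ys \<tau>)) ` T) \<le> J + 2"
    proof (rule order_trans[OF card_le_of_spread[of _ "J + 1"]])
      fix x y assume "x \<in> (\<lambda>\<tau>. radix m (ys \<tau>)) ` T" "y \<in> (\<lambda>\<tau>. radix m (ys \<tau>)) ` T"
      then obtain \<sigma> \<tau> where st: "\<sigma> \<in> T" "\<tau> \<in> T" "x = radix m (ys \<sigma>)" "y = radix m (ys \<tau>)" by auto
      have "\<bar>snd (p \<sigma>) - snd (p \<tau>)\<bar> \<le> r"
        using dist[OF st(1,2)] dist_snd_le[of "p \<sigma>" "p \<tau>"] by (simp add: dist_real_def)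
      then have "\<bar>snd (p \<sigma>) - snd (p \<tau>)\<bar> * real m ^ k \<le> r * real m ^ k"
        by (intro mult_right_mono) auto
      then have "\<bar>snd (p \<sigma>) - snd (p \<tau>)\<bar> * real m ^ k \<le> real J" using r by linarith
      then show "x \<le> y + (J + 1)"
        using in_cell_radix_diff[of m "snd (p \<sigma>)" "ys \<sigma>" "snd (p \<tau>)" "ys \<tau>" k J] ys st by auto
    qed (use fin in auto)
  qed auto
  finally show ?thesis by (simp add: power2_eq_square)
qed

definition cell :: "nat \<Rightarrow> nat \<Rightarrow> nat list \<Rightarrow> nat list \<Rightarrow> (real \<times> real) set" where
  "cell n m xs ys = {p. in_cell n (fst p) xs \<and> in_cell m (snd p) ys}"

lemma in_cell_dist:
  assumes "in_cell b c ds" "in_cell b c' ds" "0 < b"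
  shows "\<bar>c - c'\<bar> \<le> 1 / real b ^ length ds"
proof -
  have "\<bar>c * real b ^ length ds - c' * real b ^ length ds\<bar> \<le> 1"
    using assms unfolding in_cell_def by linarith
  then have "\<bar>c - c'\<bar> * real b ^ length ds \<le> 1"
    by (simp add: left_diff_distrib[symmetric] abs_mult)
  then show ?thesis using assms(3) by (simp add: field_simps)
qed

lemma dist_pair_le:
  fixes p q :: "real \<times> real"
  shows "dist p q \<le> \<bar>fst p - fst q\<bar> + \<bar>snd p - snd q\<bar>"
  using sqrt_sum_squares_le_sum_abs[of "fst p - fst q" "snd p - snd q"]
  by (simp add: dist_prod_def dist_real_def)

lemma cell_dist:
  assumes "p \<in> cell n m xs ys" "q \<in> cell n m xs ys" "0 < n" "0 < m"
  shows "dist p q \<le> 1 / real n ^ length xs + 1 / real m ^ length ys"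
  using dist_pair_le[of p q] in_cell_dist[of n "fst p" xs "fst q"] in_cell_dist[of m "snd p" ys "snd q"]
    assms unfolding cell_def by auto

lemma cell_bounded_diameter:
  assumes "0 < n" "0 < m"
  shows "bounded (cell n m xs ys)"
    and "diameter (cell n m xs ys) \<le> 1 / real n ^ length xs + 1 / real m ^ length ys"
proof -
  show "bounded (cell n m xs ys)"
  proof (cases "cell n m xs ys = {}")
    case False
    then obtain p where "p \<in> cell n m xs ys" by blast
    then show ?thesis unfolding bounded_def using cell_dist[OF _ _ assms] by blast
  qed simp
  show "diameter (cell n m xs ys) \<le> 1 / real n ^ length xs + 1 / real m ^ length ys"
    by (rule diameter_le) (use cell_dist[OF _ _ assms] in \<open>auto simp: dist_norm\<close>)
qed

section \<open>Covering numbers and Hausdorff measure\<close>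

lemma cover_number_le:
  assumes "finite C" "F \<subseteq> \<Union>C" "\<And>U. U \<in> C \<Longrightarrow> bounded U \<and> diameter U \<le> \<delta>"
  shows "cover_number \<delta> F \<le> card C"
  unfolding cover_number_def by (rule cInf_lower) (use assms in auto)

text \<open>A set of naturals contains its infimum as soon as it is nonempty; the finite cover in
  the hypotheses guarantees this.\<close>

lemma cover_number_attained:
  assumes "finite C" "F \<subseteq> \<Union>C" "\<And>U. U \<in> C \<Longrightarrow> bounded U \<and> diameter U \<le> \<delta>"
  obtains C' where "finite C'" "F \<subseteq> \<Union>C'" "\<And>U. U \<in> C' \<Longrightarrow> bounded U \<and> diameter U \<le> \<delta>"
    "card C' = cover_number \<delta> F"
proof -
  let ?S = "{card C | C. finite C \<and> F \<subseteq> \<Union>C \<and> (\<forall>U\<in>C. bounded U \<and> diameter U \<le> \<delta>)}"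
  have "?S \<noteq> {}" using assms by blast
  then have "cover_number \<delta> F \<in> ?S" unfolding cover_number_def by (rule Inf_nat_def1)
  then show thesis using that by auto
qed

lemma tendsto_power_law_exponent:
  fixes N :: "real \<Rightarrow> real"
  assumes "0 < c" "\<And>\<delta>. 0 < \<delta> \<Longrightarrow> \<delta> \<le> 1 \<Longrightarrow> c * (1 / \<delta>) powr d \<le> N \<delta> \<and> N \<delta> \<le> C * (1 / \<delta>) powr d"
  shows "((\<lambda>\<delta>. ln (N \<delta>) / (- ln \<delta>)) \<longlongrightarrow> d) (at_right 0)"
proof -
  have inv: "((\<lambda>\<delta>. b / (- ln \<delta>)) \<longlongrightarrow> 0) (at_right 0)" for b :: real
    by (rule real_tendsto_divide_at_top[OF tendsto_const])
      (simp add: filterlim_uminus_at_top ln_at_0)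
  have "c \<le> C" using assms(2)[of 1] by simp
  then have "0 < C" using assms(1) by simp
  have ev: "eventually (\<lambda>\<delta>. 0 < \<delta> \<and> \<delta> < 1) (at_right (0::real))"
    unfolding eventually_at_right_field by (intro exI[of _ 1]) auto
  have *: "d + ln c / (- ln \<delta>) \<le> ln (N \<delta>) / (- ln \<delta>) \<and> ln (N \<delta>) / (- ln \<delta>) \<le> d + ln C / (- ln \<delta>)"
    if \<delta>: "0 < \<delta>" "\<delta> < 1" for \<delta>
  proof -
    have l: "0 < - ln \<delta>" using \<delta> by simp
    have pos: "0 < c * (1 / \<delta>) powr d" using \<delta> assms(1) by simp
    then have "0 < N \<delta>" using assms(2)[of \<delta>] \<delta> by linarith
    have "ln (c * (1 / \<delta>) powr d) \<le> ln (N \<delta>)" "ln (N \<delta>) \<le> ln (C * (1 / \<delta>) powr d)"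
      using assms(2)[of \<delta>] \<delta> pos \<open>0 < N \<delta>\<close> by auto
    then have "ln c + d * (- ln \<delta>) \<le> ln (N \<delta>)" "ln (N \<delta>) \<le> ln C + d * (- ln \<delta>)"
      using \<delta> assms(1) \<open>0 < C\<close> by (simp_all add: ln_mult ln_powr ln_div)
    then have "(ln c + d * (- ln \<delta>)) / (- ln \<delta>) \<le> ln (N \<delta>) / (- ln \<delta>)"
      "ln (N \<delta>) / (- ln \<delta>) \<le> (ln C + d * (- ln \<delta>)) / (- ln \<delta>)"
      using l by (intro divide_right_mono; linarith)+
    moreover have "(b + d * (- ln \<delta>)) / (- ln \<delta>) = d + b / (- ln \<delta>)" for b
      using l by (simp add: field_simps)
    ultimately show ?thesis by (simp only:)
  qed
  show ?thesis
  proof (rule tendsto_sandwich)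
    show "eventually (\<lambda>\<delta>. d + ln c / (- ln \<delta>) \<le> ln (N \<delta>) / (- ln \<delta>)) (at_right 0)"
      "eventually (\<lambda>\<delta>. ln (N \<delta>) / (- ln \<delta>) \<le> d + ln C / (- ln \<delta>)) (at_right 0)"
      using ev by (auto elim!: eventually_mono dest: *)
    show "((\<lambda>\<delta>. d + ln c / (- ln \<delta>)) \<longlongrightarrow> d) (at_right 0)" "((\<lambda>\<delta>. d + ln C / (- ln \<delta>)) \<longlongrightarrow> d) (at_right 0)"
      using tendsto_add[OF tendsto_const inv] by simp_all
  qed
qed

lemma hausdorff_content_le_finite:
  assumes "finite I" "F \<subseteq> (\<Union>i\<in>I. U i)" "0 \<le> \<delta>"
    and "\<And>i. i \<in> I \<Longrightarrow> bounded (U i) \<and> diameter (U i) \<le> \<delta>"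
  shows "hausdorff_content s \<delta> F \<le> (\<Sum>i\<in>I. diam_pow s (U i))"
proof -
  obtain f where f: "bij_betw f {..<card I} I"
    using ex_bij_betw_nat_finite[OF assms(1)] unfolding atLeast0LessThan by blast
  \<comment> \<open>Padding with empty sets turns the finite cover into a sequence;
    \<open>diam_pow\<close> gives them the value \<open>0\<close> by definition.\<close>
  define W where "W j = (if j < card I then U (f j) else {})" for j
  have fI: "f j \<in> I" if "j < card I" for j using f that by (auto simp: bij_betw_def)
  have "F \<subseteq> (\<Union>j. W j)"
  proof
    fix x assume "x \<in> F"
    then obtain a where a: "a \<in> I" "x \<in> U a" using assms(2) by blast
    then have "a \<in> f ` {..<card I}" using f by (simp add: bij_betw_def)
    then obtain j where "j < card I" "f j = a" by blast
    with a show "x \<in> (\<Union>j. W j)" unfolding W_def by auto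
  qed
  moreover have "\<forall>j. bounded (W j) \<and> diameter (W j) \<le> \<delta>" using assms(3,4) fI unfolding W_def by auto
  ultimately have "hausdorff_content s \<delta> F \<le> (\<Sum>j. diam_pow s (W j))"
    unfolding hausdorff_content_def by (intro INF_lower) auto
  also have "\<dots> = (\<Sum>j<card I. diam_pow s (W j))"
    by (rule suminf_finite) (auto simp: W_def diam_pow_def)
  also have "\<dots> = (\<Sum>j<card I. diam_pow s (U (f j)))" by (intro sum.cong) (auto simp: W_def)
  also have "\<dots> = (\<Sum>i\<in>I. diam_pow s (U i))" by (rule sum.reindex_bij_betw[OF f])
  finally show ?thesis .
qed

text \<open>Right continuity of the power function, at \<open>d = 0\<close> thanks to
  \<open>0 < s\<close>. It prices the enlargement of a covering set of diameter \<open>d\<close> to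
  an open neighbourhood; \<open>d \<le> 1 / 2\<close> leaves room for the enlarged diameter below
  \<open>1\<close>.\<close>

lemma powr_right_approx:
  fixes d s \<eta> :: real
  assumes "0 \<le> d" "d \<le> 1 / 2" "0 < s" "0 < \<eta>"
  obtains e where "0 < e" "d + 2 * e \<le> 1" "(d + 2 * e) powr s \<le> d powr s + \<eta>"
proof -
  have t: "((\<lambda>e. d + 2 * e) \<longlongrightarrow> d + 2 * 0) (at_right 0)" by (intro tendsto_intros)
  have "((\<lambda>e. (d + 2 * e) powr s) \<longlongrightarrow> d powr s) (at_right 0)"
  proof (rule tendsto_powr')
    show "((\<lambda>e. d + 2 * e) \<longlongrightarrow> d) (at_right 0)" using t by simp
    have "eventually (\<lambda>e. 0 < e) (at_right (0::real))" by (simp add: eventually_at_right_less)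
    then show "d \<noteq> 0 \<or> 0 < s \<and> eventually (\<lambda>e. 0 \<le> d + 2 * e) (at_right 0)"
      using assms by (auto elim!: eventually_mono)
  qed simp
  then have "eventually (\<lambda>e. (d + 2 * e) powr s < d powr s + \<eta>) (at_right 0)"
    using assms(4) by (intro order_tendstoD(2)) auto
  moreover have "eventually (\<lambda>e. d + 2 * e < 1) (at_right 0)"
    using assms(2) by (intro order_tendstoD(2)[OF t]) auto
  ultimately have "eventually (\<lambda>e. (d + 2 * e) powr s < d powr s + \<eta> \<and> d + 2 * e < 1 \<and> 0 < e) (at_right 0)"
    by (intro eventually_conj) (simp_all add: eventually_at_right_less)
  then obtain e where "(d + 2 * e) powr s < d powr s + \<eta> \<and> d + 2 * e < 1 \<and> 0 < e"
    using eventually_happens'[OF trivial_limit_at_right_real] by blast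
  then show thesis using that[of e] by simp
qed

text \<open>A finitary mass distribution principle: by compactness a cover may be taken finite and
  its members of positive diameter, so that counting measures on finite sets of points suffice.\<close>

lemma mass_distribution:
  fixes X :: "'a::metric_space set"
  assumes X: "compact X" and s: "0 < s" "hausdorff_measure s X = 0" and C: "0 < C"
    and mass: "\<And>r0. 0 < r0 \<Longrightarrow> \<exists>(T :: 't set) p. finite T \<and> T \<noteq> {} \<and> p ` T \<subseteq> X \<and>
      (\<forall>r U. r0 \<le> r \<longrightarrow> r \<le> 1 \<longrightarrow> bounded U \<longrightarrow> diameter U \<le> r \<longrightarrow>
        real (card {\<tau> \<in> T. p \<tau> \<in> U}) \<le> C * r powr d * real (card T))"
  shows "d \<le> s"
proof (rule ccontr)
  assume "\<not> d \<le> s"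
  then have sd: "s < d" by simp
  \<comment> \<open>The original diameters and their enlargements will each contribute at most
    \<open>\<eta>\<close>, so that \<open>C * (\<eta> + \<eta>)\<close> is one half and falls short
    of the full mass.\<close>
  define \<eta> where "\<eta> = 1 / (4 * C)"
  have \<eta>: "0 < \<eta>" unfolding \<eta>_def using C by simp
  have "hausdorff_content s (1 / 2) X \<le> hausdorff_measure s X"
    unfolding hausdorff_measure_def by (rule SUP_upper) simp
  then have "hausdorff_content s (1 / 2) X < ennreal \<eta>" using s(2) \<eta> by simp
  then obtain U where U: "X \<subseteq> (\<Union>j. U j)" "\<And>j. bounded (U j) \<and> diameter (U j) \<le> 1 / 2"
    "(\<Sum>j. diam_pow s (U j)) < ennreal \<eta>"
    unfolding hausdorff_content_def INF_less_iff by blast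
  define D where "D j = diameter (U j)" for j :: nat
  have D: "0 \<le> D j" "D j \<le> 1 / 2" for j unfolding D_def using U(2) diameter_ge_0 by auto
  have "\<exists>e. 0 < e \<and> D j + 2 * e \<le> 1 \<and> (D j + 2 * e) powr s \<le> D j powr s + \<eta> * (1 / 2) ^ Suc j" for j
  proof -
    have "0 < \<eta> * (1 / 2) ^ Suc j" using \<eta> by simp
    from powr_right_approx[OF D[of j] s(1) this] show ?thesis by blast
  qed
  then obtain e where e: "\<And>j. 0 < e j" "\<And>j. D j + 2 * e j \<le> 1"
    "\<And>j. (D j + 2 * e j) powr s \<le> D j powr s + \<eta> * (1 / 2) ^ Suc j" by metis
  define \<rho> where "\<rho> j = D j + 2 * e j" for j
  have \<rho>: "0 < \<rho> j" "\<rho> j \<le> 1" for j unfolding \<rho>_def using e D[of j] by (auto intro: add_nonneg_pos)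
  \<comment> \<open>Enlarging by \<open>e j\<close> makes the cover open and the diameter bound
    \<open>\<rho> j\<close> positive; the total cost is a geometric series with sum
    \<open>\<eta>\<close>.\<close>
  define W where "W j = (\<Union>x\<in>U j. ball x (e j))" for j
  have W_dist: "dist x y \<le> \<rho> j" if "x \<in> W j" "y \<in> W j" for x y j
  proof -
    obtain a b where ab: "a \<in> U j" "b \<in> U j" "dist a x < e j" "dist b y < e j"
      using \<open>x \<in> W j\<close> \<open>y \<in> W j\<close> unfolding W_def by auto
    have "dist a b \<le> D j" unfolding D_def using ab U(2) by (intro diameter_bounded_bound) auto
    moreover have "dist x y \<le> dist a x + dist a b + dist b y"
      using dist_triangle[of x y a] dist_triangle[of a y b] by (simp add: dist_commute)
    ultimately show ?thesis unfolding \<rho>_def using ab by linarith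
  qed
  have W_bounded: "bounded (W j)" for j
  proof (cases "W j = {}")
    case False
    then obtain x where "x \<in> W j" by blast
    then show ?thesis unfolding bounded_def using W_dist by blast
  qed simp
  have W_diam: "diameter (W j) \<le> \<rho> j" for j
  proof (cases "W j = {}")
    case True
    then show ?thesis using \<rho>(1)[of j] by simp
  next
    case False
    then show ?thesis unfolding diameter_def using W_dist by (auto intro!: cSUP_least)
  qed
  have UW: "U j \<subseteq> W j" for j unfolding W_def using e(1)[of j] by auto
  have "X \<subseteq> (\<Union>j. W j)" by (rule order_trans[OF U(1) UN_mono[OF order_refl UW]])
  moreover have "open (W j)" for j unfolding W_def by auto
  ultimately obtain J where J: "finite J" "X \<subseteq> (\<Union>j\<in>J. W j)"
    using compactE_image[OF X, of UNIV W] by auto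
  \<comment> \<open>A smallest radius exists only after compactness has selected finitely many sets;
    the finite set of points is then chosen for this scale.\<close>
  define r0 where "r0 = Min (insert 1 (\<rho> ` J))"
  have r0: "0 < r0" "\<And>j. j \<in> J \<Longrightarrow> r0 \<le> \<rho> j"
    unfolding r0_def using J(1) \<rho>(1) by auto
  from mass[OF r0(1)] obtain T :: "'t set" and p where T: "finite T" "T \<noteq> {}" "p ` T \<subseteq> X"
    and count: "\<forall>r U. r0 \<le> r \<longrightarrow> r \<le> 1 \<longrightarrow> bounded U \<longrightarrow> diameter U \<le> r \<longrightarrow>
        real (card {\<tau> \<in> T. p \<tau> \<in> U}) \<le> C * r powr d * real (card T)"
    by (elim exE conjE)
  have cT: "0 < real (card T)" using T(1,2) by (simp add: card_gt_0_iff)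
  have "T = (\<Union>j\<in>J. {\<tau> \<in> T. p \<tau> \<in> W j})" using T(3) J(2) by blast
  then have "card T \<le> (\<Sum>j\<in>J. card {\<tau> \<in> T. p \<tau> \<in> W j})"
    using card_UN_le[OF J(1), of "\<lambda>j. {\<tau> \<in> T. p \<tau> \<in> W j}"] by simp
  then have "real (card T) \<le> (\<Sum>j\<in>J. real (card {\<tau> \<in> T. p \<tau> \<in> W j}))" by (simp only: of_nat_sum[symmetric] of_nat_le_iff)
  also have "\<dots> \<le> (\<Sum>j\<in>J. C * real (card T) * (D j powr s + \<eta> * (1 / 2) ^ Suc j))"
  proof (rule sum_mono)
    fix j assume j: "j \<in> J"
    have "real (card {\<tau> \<in> T. p \<tau> \<in> W j}) \<le> C * \<rho> j powr d * real (card T)"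
      using count r0(2)[OF j] \<rho>(2)[of j] W_bounded[of j] W_diam[of j] by simp
    also have "\<dots> \<le> C * \<rho> j powr s * real (card T)"
      using C \<rho>[of j] sd by (intro mult_right_mono mult_left_mono powr_mono') auto
    also have "\<dots> \<le> C * (D j powr s + \<eta> * (1 / 2) ^ Suc j) * real (card T)"
      using C e(3)[of j] unfolding \<rho>_def by (intro mult_right_mono mult_left_mono) auto
    finally show "real (card {\<tau> \<in> T. p \<tau> \<in> W j}) \<le> C * real (card T) * (D j powr s + \<eta> * (1 / 2) ^ Suc j)"
      by (simp add: ac_simps)
  qed
  also have "\<dots> = C * real (card T) * ((\<Sum>j\<in>J. D j powr s) + (\<Sum>j\<in>J. \<eta> * (1 / 2) ^ Suc j))"
    unfolding sum_distrib_left[symmetric] sum.distrib ..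
  also have "\<dots> \<le> C * real (card T) * (\<eta> + \<eta>)"
  proof (intro mult_left_mono add_mono)
    have eq: "diam_pow s (U j) = ennreal (D j powr s)" for j
      unfolding diam_pow_def D_def using s(1) by auto
    have "ennreal (\<Sum>j\<in>J. D j powr s) = (\<Sum>j\<in>J. diam_pow s (U j))" unfolding eq by (simp add: sum_ennreal)
    also have "\<dots> \<le> (\<Sum>j. diam_pow s (U j))" by (intro sum_le_suminf J(1)) auto
    also note U(3)
    finally have "ennreal (\<Sum>j\<in>J. D j powr s) \<le> ennreal \<eta>" by simp
    then show "(\<Sum>j\<in>J. D j powr s) \<le> \<eta>" using \<eta> by (simp add: ennreal_le_iff)
    have "(\<Sum>j\<in>J. \<eta> * (1 / 2) ^ Suc j) \<le> (\<Sum>j. \<eta> * (1 / 2) ^ Suc j)"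
      using \<eta> sums_summable[OF power_half_series] by (intro sum_le_suminf J(1) summable_mult) auto
    also have "\<dots> = \<eta>" using sums_unique[OF sums_mult[OF power_half_series, of \<eta>]] by simp
    finally show "(\<Sum>j\<in>J. \<eta> * (1 / 2) ^ Suc j) \<le> \<eta>" .
  qed (use C in simp)
  also have "\<dots> = real (card T) / 2" unfolding \<eta>_def using C by (simp add: field_simps)
  finally show False using cT by simp
qed

section \<open>Words of an irreducible graph\<close>

locale carpet_graph =
  fixes V :: "'v set" and E :: "'e set" and i t :: "'e \<Rightarrow> 'v"
    and n m :: nat and xd yd :: "'e \<Rightarrow> nat"
  assumes finite_V: "finite V" and V_nonempty: "V \<noteq> {}" and finite_E: "finite E"
    and edge: "\<And>e. e \<in> E \<Longrightarrow> i e \<in> V \<and> t e \<in> V"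
    and out_edge: "\<And>v. v \<in> V \<Longrightarrow> \<exists>e\<in>E. i e = v"
    and m_ge_2: "2 \<le> m" and m_less_n: "m < n"
    and digits: "\<And>e. e \<in> E \<Longrightarrow> xd e < n \<and> yd e < m"
    and irreducible: "irreducible_graph V E i t"
begin

abbreviation adm :: "nat \<Rightarrow> 'e list set" where
  "adm k \<equiv> adm_words E i t k"

abbreviation pair :: "'e \<Rightarrow> nat \<times> nat" where
  "pair \<equiv> (\<lambda>e. (xd e, yd e))"

text \<open>Admissible words do not mention vertices, but pigeonholing and gluing need both ends of
  a word, also of the empty one; \<open>walk\<close> carries them.\<close>

primrec walk :: "'v \<Rightarrow> 'e list \<Rightarrow> 'v \<Rightarrow> bool" where
  "walk v [] v' \<longleftrightarrow> v = v'"
| "walk v (e # w) v' \<longleftrightarrow> e \<in> E \<and> i e = v \<and> walk (t e) w v'"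

lemma walk_append: "walk v (w @ w') v'' \<longleftrightarrow> (\<exists>v'. walk v w v' \<and> walk v' w' v'')"
  by (induction w arbitrary: v) auto

lemma walk_in_V: "walk v w v' \<Longrightarrow> v \<in> V \<Longrightarrow> v' \<in> V"
  by (induction w arbitrary: v) (auto dest: edge)

lemma walk_set: "walk v w v' \<Longrightarrow> set w \<subseteq> E"
  by (induction w arbitrary: v) auto

lemma adm_Cons: "e # w \<in> adm (Suc k) \<longleftrightarrow> e \<in> E \<and> w \<in> adm k \<and> (w \<noteq> [] \<longrightarrow> t e = i (hd w))"
proof -
  have "(\<forall>j. Suc j < Suc (length w) \<longrightarrow> t ((e # w) ! j) = i ((e # w) ! Suc j)) \<longleftrightarrow>
      (\<forall>j. Suc j < length w \<longrightarrow> t (w ! j) = i (w ! Suc j)) \<and> (w \<noteq> [] \<longrightarrow> t e = i (hd w))"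
    by (auto simp: nth_Cons hd_conv_nth split: nat.splits)
  then show ?thesis unfolding adm_words_def by auto
qed

lemma adm_iff: "w \<in> adm k \<longleftrightarrow> length w = k \<and> (\<exists>v\<in>V. \<exists>v'\<in>V. walk v w v')"
proof (induction w arbitrary: k)
  case Nil
  show ?case using V_nonempty by (auto simp: adm_words_def)
next
  case (Cons e w)
  have start: "walk v w v' \<Longrightarrow> w \<noteq> [] \<Longrightarrow> v = i (hd w)" for v v' by (cases w) auto
  show ?case
  proof (cases k)
    case 0
    then show ?thesis by (simp add: adm_words_def)
  next
    case (Suc k')
    have "e # w \<in> adm k \<longleftrightarrow> e \<in> E \<and> (length w = k' \<and> (\<exists>v\<in>V. \<exists>v'\<in>V. walk v w v')) \<and> (w \<noteq> [] \<longrightarrow> t e = i (hd w))"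
      unfolding Suc adm_Cons using Cons.IH by simp
    also have "\<dots> \<longleftrightarrow> length (e # w) = k \<and> (\<exists>v\<in>V. \<exists>v'\<in>V. walk v (e # w) v')"
    proof (cases "w = []")
      case True
      then show ?thesis using V_nonempty edge Suc by auto
    next
      case False
      then show ?thesis using start edge Suc by (fastforce dest: start)
    qed
    finally show ?thesis .
  qed
qed

lemma admI: "walk v w v' \<Longrightarrow> v \<in> V \<Longrightarrow> length w = k \<Longrightarrow> w \<in> adm k"
  using walk_in_V[of v w v'] unfolding adm_iff by blast

lemma adm_length: "w \<in> adm k \<Longrightarrow> length w = k"
  by (simp add: adm_words_def)

lemma adm_set: "w \<in> adm k \<Longrightarrow> set w \<subseteq> E"
  by (simp add: adm_words_def)

lemma finite_adm [simp]: "finite (adm k)"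
  by (rule finite_subset[OF _ finite_lists_length_eq[OF finite_E, of k]]) (auto simp: adm_words_def)

lemma adm_take_drop:
  assumes "w \<in> adm (k + l)"
  shows "take k w \<in> adm k" "drop k w \<in> adm l"
proof -
  obtain v v' where v: "v \<in> V" "v' \<in> V" "walk v (take k w @ drop k w) v'" "length w = k + l"
    using assms by (auto simp: adm_iff)
  then obtain u where "walk v (take k w) u" "walk u (drop k w) v'" by (auto simp only: walk_append)
  then show "take k w \<in> adm k" "drop k w \<in> adm l"
    using v by (auto intro: admI dest: walk_in_V)
qed

lemma walk_of_mat_pow:
  "0 < mat_pow V (adj_matrix E i t) j v v' \<Longrightarrow> \<exists>w. walk v w v' \<and> length w = j"
proof (induction j arbitrary: v')
  case 0
  then show ?case by (auto split: if_splits)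
next
  case (Suc j)
  then have "\<exists>u\<in>V. mat_pow V (adj_matrix E i t) j v u * adj_matrix E i t u v' \<noteq> 0"
    by (metis (no_types, lifting) mat_pow.simps(2) less_irrefl sum.neutral)
  then obtain u where u: "0 < mat_pow V (adj_matrix E i t) j v u" "adj_matrix E i t u v' \<noteq> 0" by auto
  obtain w where w: "walk v w u" "length w = j" using Suc.IH[OF u(1)] by blast
  obtain e where e: "e \<in> E" "i e = u" "t e = v'"
    using u(2) unfolding adj_matrix_def
    by (metis (mono_tags, lifting) Collect_empty_eq card.empty)
  then have "walk v (w @ [e]) v'" using w by (auto simp: walk_append)
  with w show ?case by (intro exI[of _ "w @ [e]"]) simp
qed

lemma walk_exists_pos:
  assumes "v \<in> V" "v' \<in> V"
  obtains w where "walk v w v'" "w \<noteq> []"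
  using assms irreducible walk_of_mat_pow[of _ v v'] unfolding irreducible_graph_def
  by (metis One_nat_def list.size(3) not_one_le_zero)

text \<open>One length bound for connecting walks between all pairs of vertices. Exact lengths
  cannot be prescribed, since an irreducible graph may be periodic.\<close>

definition gap :: nat where
  "gap = (SOME D. \<forall>v\<in>V. \<forall>v'\<in>V. \<exists>w. walk v w v' \<and> length w \<le> D)"

lemma connector:
  assumes "v \<in> V" "v' \<in> V"
  obtains w where "walk v w v'" "length w \<le> gap"
proof -
  have "\<forall>v\<in>V. \<forall>v'\<in>V. \<exists>w. walk v w v'" using walk_exists_pos by metis
  then obtain f where f: "\<And>v v'. v \<in> V \<Longrightarrow> v' \<in> V \<Longrightarrow> walk v (f v v') v'" by metis
  have fin: "finite ((\<lambda>(v, v'). length (f v v')) ` (V \<times> V))" using finite_V by simp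
  have "\<forall>v\<in>V. \<forall>v'\<in>V. \<exists>w. walk v w v' \<and> length w \<le> Max ((\<lambda>(v, v'). length (f v v')) ` (V \<times> V))"
  proof (intro ballI exI conjI)
    fix v v' assume "v \<in> V" "v' \<in> V"
    then show "walk v (f v v') v'" by (rule f)
    show "length (f v v') \<le> Max ((\<lambda>(v, v'). length (f v v')) ` (V \<times> V))"
      using \<open>v \<in> V\<close> \<open>v' \<in> V\<close> by (intro Max_ge[OF fin]) auto
  qed
  then have "\<forall>v\<in>V. \<forall>v'\<in>V. \<exists>w. walk v w v' \<and> length w \<le> gap" unfolding gap_def by (rule someI)
  then show thesis using assms that by blast
qed

lemma walk_forward:
  assumes "v \<in> V"
  obtains w v' where "walk v w v'" "length w = k" "v' \<in> V"
proof -
  have "\<exists>w v'. walk v w v' \<and> length w = k \<and> v' \<in> V" using assms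
  proof (induction k arbitrary: v)
    case 0
    then show ?case by (intro exI[of _ "[]"]) auto
  next
    case (Suc k)
    obtain e where e: "e \<in> E" "i e = v" using out_edge[OF Suc.prems] by blast
    obtain w v' where "walk (t e) w v'" "length w = k" "v' \<in> V"
      using Suc.IH[of "t e"] edge e by blast
    with e show ?case by (intro exI[of _ "e # w"] exI[of _ v']) auto
  qed
  then show thesis using that by blast
qed

text \<open>Incoming edges come from irreducibility: a nonempty closed walk at \<open>v\<close> ends
  with an edge into \<open>v\<close>.\<close>

lemma walk_backward:
  assumes "v \<in> V"
  obtains w v' where "walk v' w v" "length w = k" "v' \<in> V"
proof -
  have "\<exists>w v'. walk v' w v \<and> length w = k \<and> v' \<in> V" using assms
  proof (induction k arbitrary: v)
    case 0
    then show ?case by (intro exI[of _ "[]"]) auto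
  next
    case (Suc k)
    obtain w0 where "walk v w0 v" "w0 \<noteq> []" using walk_exists_pos[OF Suc.prems Suc.prems] .
    then obtain w1 e where "walk v (w1 @ [e]) v" by (metis rev_exhaust)
    then have e: "e \<in> E" "t e = v" by (auto simp: walk_append)
    obtain w v' where "walk v' w (i e)" "length w = k" "v' \<in> V"
      using Suc.IH[of "i e"] edge e by blast
    with e show ?case by (intro exI[of _ "w @ [e]"] exI[of _ v']) (auto simp: walk_append)
  qed
  then show thesis using that by blast
qed

lemma adm_nonempty: "adm k \<noteq> {}"
proof -
  obtain v where "v \<in> V" using V_nonempty by blast
  then obtain w v' where "walk v w v'" "length w = k" "v' \<in> V" using walk_forward by blast
  with \<open>v \<in> V\<close> have "w \<in> adm k" by (auto intro: admI)
  then show ?thesis by blast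
qed

lemma card_E_pos: "1 \<le> card E"
proof -
  have "E \<noteq> {}" using V_nonempty out_edge by blast
  then show ?thesis using finite_E by (simp add: Suc_leI card_gt_0_iff)
qed

lemma card_V_pos: "1 \<le> card V"
  using V_nonempty finite_V by (simp add: Suc_leI card_gt_0_iff)

section \<open>Counting digit words up to bounded factors\<close>

definition cnt :: "('e \<Rightarrow> 'c) \<Rightarrow> nat \<Rightarrow> nat" where
  "cnt g k = card (map g ` adm k)"

text \<open>One constant dominating all the losses caused by connecting words.\<close>

definition CC :: nat where
  "CC = (card V)\<^sup>2 * card V * card E ^ gap * card E ^ gap"

lemma CC_ge:
  "card V * card E ^ gap \<le> CC" "(card V)\<^sup>2 * card E ^ gap \<le> CC" "1 \<le> CC"
  "(card V)\<^sup>2 * card V * card E ^ gap \<le> CC" "(card V)\<^sup>2 \<le> CC"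
proof -
  define x y where "x = card V" and "y = card E ^ gap"
  have xy: "1 \<le> x" "1 \<le> y" using card_E_pos card_V_pos by (auto simp: x_def y_def)
  have mono: "z \<le> z * z'" if "1 \<le> z'" for z z' :: nat using that by simp
  have "1 \<le> x * x * y" "1 \<le> x * y" "1 \<le> x * x * x * y * y" "1 \<le> x * y * y" "1 \<le> y" using xy by auto
  note m = this[THEN mono]
  show "card V * card E ^ gap \<le> CC" "(card V)\<^sup>2 * card E ^ gap \<le> CC" "1 \<le> CC"
    "(card V)\<^sup>2 * card V * card E ^ gap \<le> CC" "(card V)\<^sup>2 \<le> CC"
    using m(1)[of "x * y"] m(2)[of "x * x * y"] m(3)[of 1] m(5)[of "x * x * x * y"] m(4)[of "x * x"]
    unfolding CC_def x_def[symmetric] y_def[symmetric] by (simp_all add: power2_eq_square ac_simps)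
qed

lemma cnt_ge_1: "1 \<le> cnt g k"
  unfolding cnt_def using adm_nonempty[of k] by (simp add: Suc_leI card_gt_0_iff)

lemma cnt_le_power: "cnt g k \<le> card E ^ k"
proof -
  have "cnt g k \<le> card (adm k)" unfolding cnt_def by (rule card_image_le) simp
  also have "\<dots> \<le> card {w. set w \<subseteq> E \<and> length w = k}"
    by (intro card_mono finite_lists_length_eq finite_E) (auto simp: adm_words_def)
  also have "\<dots> = card E ^ k" by (rule card_lists_length_eq[OF finite_E])
  finally show ?thesis .
qed

lemma cnt_le_power_gap: "d \<le> gap \<Longrightarrow> cnt g d \<le> card E ^ gap"
  using cnt_le_power[of g d] power_increasing[OF _ card_E_pos, of d gap] by linarith

lemma cnt_submult: "cnt g (k + l) \<le> cnt g k * cnt g l"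
proof -
  have "map g ` adm (k + l) \<subseteq> (\<lambda>(x, y). x @ y) ` (map g ` adm k \<times> map g ` adm l)"
  proof
    fix s assume "s \<in> map g ` adm (k + l)"
    then obtain w where w: "w \<in> adm (k + l)" "s = map g (take k w) @ map g (drop k w)"
      by (metis (no_types, lifting) append_take_drop_id image_iff map_append)
    then show "s \<in> (\<lambda>(x, y). x @ y) ` (map g ` adm k \<times> map g ` adm l)"
      using adm_take_drop[OF w(1)] by (intro image_eqI[of _ _ "(map g (take k w), map g (drop k w))"]) auto
  qed
  then have "cnt g (k + l) \<le> card ((\<lambda>(x, y). x @ y) ` (map g ` adm k \<times> map g ` adm l))"
    unfolding cnt_def by (intro card_mono) auto
  also have "\<dots> = cnt g k * cnt g l"
    unfolding cnt_def by (rule card_append_product[where k = k]) (auto dest: adm_length)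
  finally show ?thesis .
qed

text \<open>Pigeonhole on the end vertices of the first family and on the start vertices of the second
  one; a short path then joins the two chosen vertices.\<close>

lemma gluing:
  assumes "P1 \<subseteq> adm k" "P2 \<subseteq> adm l"
  obtains c Q where "length c \<le> gap" "Q \<subseteq> adm (k + length c + l)"
    "\<And>w. w \<in> Q \<Longrightarrow> \<exists>w1\<in>P1. \<exists>w2\<in>P2. w = w1 @ c @ w2"
    "card (map g ` P1) * card (map g ` P2) \<le> (card V)\<^sup>2 * card (map g ` Q)"
proof -
  define S1 where "S1 v = {w \<in> P1. \<exists>u\<in>V. walk u w v}" for v
  define S2 where "S2 v = {w \<in> P2. \<exists>u\<in>V. walk v w u}" for v
  have "\<exists>v\<in>V. w \<in> S1 v" if "w \<in> P1" for w
    using that subsetD[OF assms(1) that] adm_iff[of w k] unfolding S1_def by blast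
  then have P1: "P1 = (\<Union>v\<in>V. S1 v)" by (auto simp: S1_def)
  have "\<exists>v\<in>V. w \<in> S2 v" if "w \<in> P2" for w
    using that subsetD[OF assms(2) that] adm_iff[of w l] unfolding S2_def by blast
  then have P2: "P2 = (\<Union>v\<in>V. S2 v)" by (auto simp: S2_def)
  have len: "length w = k" if "w \<in> S1 v" for w v using that assms(1) adm_length unfolding S1_def by blast
  obtain v1 where v1: "v1 \<in> V" "card (\<Union>v\<in>V. map g ` S1 v) \<le> card V * card (map g ` S1 v1)"
    using card_UN_pigeonhole[OF finite_V V_nonempty, of "\<lambda>v. map g ` S1 v"] .
  obtain v2 where v2: "v2 \<in> V" "card (\<Union>v\<in>V. map g ` S2 v) \<le> card V * card (map g ` S2 v2)"
    using card_UN_pigeonhole[OF finite_V V_nonempty, of "\<lambda>v. map g ` S2 v"] .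
  obtain c where c: "walk v1 c v2" "length c \<le> gap" using connector[OF v1(1) v2(1)] .
  define Q where "Q = (\<lambda>(w1, w2). w1 @ c @ w2) ` (S1 v1 \<times> S2 v2)"
  have "Q \<subseteq> adm (k + length c + l)"
  proof
    fix w assume "w \<in> Q"
    then obtain w1 w2 where w: "w1 \<in> S1 v1" "w2 \<in> S2 v2" "w = w1 @ c @ w2" unfolding Q_def by auto
    then obtain u u' where "walk u w1 v1" "walk v2 w2 u'" "u \<in> V" "u' \<in> V"
      unfolding S1_def S2_def by auto
    then have "walk u w u'" using c w by (auto simp: walk_append)
    moreover have "length w = k + length c + l"
      using w len[OF w(1)] assms(2) adm_length unfolding S2_def by auto
    ultimately show "w \<in> adm (k + length c + l)" using \<open>u \<in> V\<close> \<open>u' \<in> V\<close> by (auto simp: adm_iff)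
  qed
  moreover have "\<exists>w1\<in>P1. \<exists>w2\<in>P2. w = w1 @ c @ w2" if "w \<in> Q" for w
    using that unfolding Q_def S1_def S2_def by auto
  moreover have "card (map g ` P1) * card (map g ` P2) \<le> (card V)\<^sup>2 * card (map g ` Q)"
  proof -
    have "map g ` Q = (\<lambda>(x, y). x @ y) ` (map g ` S1 v1 \<times> (\<lambda>s. map g c @ s) ` map g ` S2 v2)"
    proof -
      have "map g ` Q = (\<lambda>(w1, w2). map g w1 @ map g c @ map g w2) ` (S1 v1 \<times> S2 v2)"
        unfolding Q_def image_image by (intro image_cong) auto
      also have "\<dots> = (\<lambda>(x, y). x @ y) ` map_prod (map g) (\<lambda>w. map g c @ map g w) ` (S1 v1 \<times> S2 v2)"
        unfolding image_image by (intro image_cong) auto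
      also have "map_prod (map g) (\<lambda>w. map g c @ map g w) ` (S1 v1 \<times> S2 v2)
          = map g ` S1 v1 \<times> (\<lambda>s. map g c @ s) ` map g ` S2 v2"
        unfolding image_image by (rule map_prod_surj_on[OF refl refl])
      finally show ?thesis .
    qed
    moreover have "card ((\<lambda>(x, y). x @ y) ` (map g ` S1 v1 \<times> (\<lambda>s. map g c @ s) ` map g ` S2 v2))
        = card (map g ` S1 v1) * card ((\<lambda>s. map g c @ s) ` map g ` S2 v2)"
      by (rule card_append_product[where k = k]) (auto dest: len)
    ultimately have "card (map g ` Q) = card (map g ` S1 v1) * card ((\<lambda>s. map g c @ s) ` map g ` S2 v2)"
      by simp
    also have "card ((\<lambda>s. map g c @ s) ` map g ` S2 v2) = card (map g ` S2 v2)"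
      by (intro card_image) (auto simp: inj_on_def)
    finally have Q: "card (map g ` Q) = card (map g ` S1 v1) * card (map g ` S2 v2)" .
    have "card (map g ` P1) \<le> card V * card (map g ` S1 v1)"
      "card (map g ` P2) \<le> card V * card (map g ` S2 v2)"
      using v1(2) v2(2) P1 P2 by (simp_all only: image_UN[symmetric])
    from mult_le_mono[OF this] show ?thesis unfolding Q by (simp add: power2_eq_square algebra_simps)
  qed
  ultimately show thesis using c(2) that by blast
qed

text \<open>Gluing overshoots the length \<open>k + l\<close> by that of the connecting word;
  submultiplicativity removes the overshoot at the price \<open>card E ^ gap\<close>.\<close>

lemma cnt_supermult: "cnt g k * cnt g l \<le> CC * cnt g (k + l)"
proof -
  obtain c Q where Q: "length c \<le> gap" "Q \<subseteq> adm (k + length c + l)"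
    "\<And>w. w \<in> Q \<Longrightarrow> \<exists>w1\<in>adm k. \<exists>w2\<in>adm l. w = w1 @ c @ w2"
    "card (map g ` adm k) * card (map g ` adm l) \<le> (card V)\<^sup>2 * card (map g ` Q)"
    using gluing[OF order_refl[of "adm k"] order_refl[of "adm l"], where g = g] by blast
  have "card (map g ` Q) \<le> cnt g (k + l + length c)"
    unfolding cnt_def by (intro card_mono image_mono) (use Q(2) in \<open>auto simp: ac_simps\<close>)
  also have "\<dots> \<le> cnt g (k + l) * cnt g (length c)" by (rule cnt_submult)
  also have "\<dots> \<le> cnt g (k + l) * card E ^ gap" by (intro mult_left_mono cnt_le_power_gap Q(1)) simp
  finally have "cnt g k * cnt g l \<le> (card V)\<^sup>2 * (cnt g (k + l) * card E ^ gap)"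
    using Q(4) unfolding cnt_def[symmetric] by (meson le_trans mult_le_mono2)
  also have "\<dots> \<le> CC * cnt g (k + l)"
    using mult_right_mono[OF CC_ge(2), of "cnt g (k + l)"] by (simp add: ac_simps)
  finally show ?thesis .
qed

definition words_from :: "'v \<Rightarrow> nat \<Rightarrow> 'e list set" where
  "words_from v j = {w. length w = j \<and> (\<exists>v'\<in>V. walk v w v')}"

lemma words_from_adm: "v \<in> V \<Longrightarrow> words_from v j \<subseteq> adm j"
  unfolding words_from_def by (auto intro: admI)

lemma finite_words_from: "v \<in> V \<Longrightarrow> finite (words_from v j)"
  by (rule finite_subset[OF words_from_adm]) auto

text \<open>The start vertex \<open>u\<close> with the most words is reached from \<open>v\<close>
  by a connecting word \<open>c\<close>. A word from \<open>u\<close>, preceded by \<open>c\<close>,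
  is a walk from \<open>v\<close>: its first \<open>j\<close> letters lie in
  \<open>words_from v j\<close>, and the \<open>length c\<close> letters cut off at the end cost
  only a constant. So all start vertices have comparable counts.\<close>

lemma words_from_count:
  assumes "v \<in> V"
  shows "cnt g j \<le> card V * card E ^ gap * card (map g ` words_from v j)"
proof -
  have "adm j = (\<Union>v\<in>V. words_from v j)" by (rule set_eqI) (unfold adm_iff words_from_def, blast)
  then have "cnt g j = card (\<Union>v\<in>V. map g ` words_from v j)" unfolding cnt_def by (metis image_UN)
  then obtain u where u: "u \<in> V" "cnt g j \<le> card V * card (map g ` words_from u j)"
    using card_UN_pigeonhole[OF finite_V V_nonempty, of "\<lambda>v. map g ` words_from v j"] by metis
  obtain c where c: "walk v c u" "length c \<le> gap" using connector[OF assms u(1)] .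
  define d where "d = length c"
  have "card (map g ` words_from u j) = card ((\<lambda>s. map g c @ s) ` map g ` words_from u j)"
    by (intro card_image[symmetric]) (auto simp: inj_on_def)
  also have "\<dots> \<le> card ((\<lambda>(x, y). x @ y) ` (map g ` words_from v j \<times> map g ` adm d))"
  proof (rule card_mono)
    show "finite ((\<lambda>(x, y). x @ y) ` (map g ` words_from v j \<times> map g ` adm d))"
      using finite_words_from[OF assms] by simp
    show "(\<lambda>s. map g c @ s) ` map g ` words_from u j
        \<subseteq> (\<lambda>(x, y). x @ y) ` (map g ` words_from v j \<times> map g ` adm d)"
    proof
      fix s assume "s \<in> (\<lambda>s. map g c @ s) ` map g ` words_from u j"
      then obtain w v' where w: "s = map g (c @ w)" "length w = j" "walk u w v'" "v' \<in> V"
        unfolding words_from_def by auto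
      obtain x y where xy: "c @ w = x @ y" "length x = j" "length y = d"
        using w(2) that[OF append_take_drop_id[of j "c @ w", symmetric]] by (auto simp: d_def)
      have "walk v (x @ y) v'" using w c xy(1)[symmetric] by (auto simp: walk_append)
      then obtain z where z: "walk v x z" "walk z y v'" by (auto simp: walk_append)
      have "z \<in> V" using walk_in_V[OF z(1) assms] .
      have "x \<in> words_from v j" using z xy \<open>z \<in> V\<close> unfolding words_from_def by auto
      moreover have "y \<in> adm d" using z xy \<open>z \<in> V\<close> by (auto intro: admI)
      moreover have "s = map g x @ map g y" unfolding w(1) xy(1) by simp
      ultimately show "s \<in> (\<lambda>(x, y). x @ y) ` (map g ` words_from v j \<times> map g ` adm d)"
        by (intro image_eqI[of _ _ "(map g x, map g y)"]) auto
    qed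
  qed
  also have "\<dots> = card (map g ` words_from v j) * cnt g d"
    unfolding cnt_def by (rule card_append_product[where k = j]) (auto simp: words_from_def)
  also have "\<dots> \<le> card (map g ` words_from v j) * card E ^ gap"
    using c by (intro mult_left_mono cnt_le_power_gap) (auto simp: d_def)
  finally have "card V * card (map g ` words_from u j)
      \<le> card V * (card (map g ` words_from v j) * card E ^ gap)" by (rule mult_left_mono) simp
  from order_trans[OF u(2) this] show ?thesis by (simp only: ac_simps)
qed

text \<open>For each \<open>g\<close>-word of \<open>P\<close> one representative is fixed and
  extended by all words from its end vertex; different \<open>g\<close>-words give different pairs.
  Two digit maps are allowed because an approximate square records both digits in its first part and
  only \<open>yd\<close> in the second.\<close>

lemma extension_count:
  assumes "P \<subseteq> adm a"
  shows "card (map g ` P) * cnt h j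
    \<le> card V * card E ^ gap * card ((\<lambda>w. (map g (take a w), map h (drop a w))) ` {w \<in> adm (a + j). take a w \<in> P})"
    (is "_ \<le> _ * card ?I")
proof -
  have "\<forall>s\<in>map g ` P. \<exists>w v. w \<in> P \<and> map g w = s \<and> v \<in> V \<and> (\<exists>u\<in>V. walk u w v)"
  proof
    fix s assume "s \<in> map g ` P"
    then obtain w where w: "w \<in> P" "map g w = s" by blast
    then have "w \<in> adm a" using assms by blast
    with w show "\<exists>w v. w \<in> P \<and> map g w = s \<and> v \<in> V \<and> (\<exists>u\<in>V. walk u w v)"
      unfolding adm_iff by blast
  qed
  then obtain W e where W: "\<And>s. s \<in> map g ` P \<Longrightarrow> W s \<in> P \<and> map g (W s) = s \<and> e s \<in> V \<and> (\<exists>u\<in>V. walk u (W s) (e s))"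
    by metis
  have finP: "finite P" using finite_subset[OF assms finite_adm] .
  have "Sigma (map g ` P) (\<lambda>s. map h ` words_from (e s) j) \<subseteq> ?I"
  proof
    fix z assume "z \<in> Sigma (map g ` P) (\<lambda>s. map h ` words_from (e s) j)"
    then obtain s w where sw: "s \<in> map g ` P" "w \<in> words_from (e s) j" "z = (s, map h w)" by auto
    obtain u where u: "u \<in> V" "walk u (W s) (e s)" "W s \<in> P" "map g (W s) = s" using W[OF sw(1)] by blast
    obtain v' where v': "v' \<in> V" "walk (e s) w v'" "length w = j" using sw(2) by (auto simp: words_from_def)
    have "length (W s) = a" using u(3) assms by (auto dest: adm_length)
    moreover have "W s @ w \<in> adm (a + j)" using u v' \<open>length (W s) = a\<close> by (auto simp: adm_iff walk_append)
    ultimately show "z \<in> ?I" using u sw by (intro image_eqI[of _ _ "W s @ w"]) auto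
  qed
  then have "card (Sigma (map g ` P) (\<lambda>s. map h ` words_from (e s) j)) \<le> card ?I"
    by (intro card_mono) auto
  moreover have "card (Sigma (map g ` P) (\<lambda>s. map h ` words_from (e s) j))
      = (\<Sum>s\<in>map g ` P. card (map h ` words_from (e s) j))"
    using W finP finite_words_from by (intro card_SigmaI) auto
  ultimately have I: "(\<Sum>s\<in>map g ` P. card (map h ` words_from (e s) j)) \<le> card ?I" by simp
  have "card (map g ` P) * cnt h j = (\<Sum>s\<in>map g ` P. cnt h j)" by simp
  also have "\<dots> \<le> (\<Sum>s\<in>map g ` P. card V * card E ^ gap * card (map h ` words_from (e s) j))"
    by (intro sum_mono words_from_count) (use W in blast)
  also have "\<dots> = card V * card E ^ gap * (\<Sum>s\<in>map g ` P. card (map h ` words_from (e s) j))"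
    by (rule sum_distrib_left[symmetric])
  also have "\<dots> \<le> card V * card E ^ gap * card ?I" by (intro mult_left_mono I) simp
  finally show ?thesis .
qed

section \<open>Fibres over words in the second coordinate\<close>

definition fib :: "nat list \<Rightarrow> nat" where
  "fib u = card (map xd ` {w \<in> adm (length u). map yd w = u})"

lemma map_pair_eq_iff: "map pair w = map pair w' \<longleftrightarrow> map xd w = map xd w' \<and> map yd w = map yd w'"
proof
  assume eq: "map pair w = map pair w'"
  show "map xd w = map xd w' \<and> map yd w = map yd w'"
    using arg_cong[OF eq, of "map fst"] arg_cong[OF eq, of "map snd"] by (simp add: o_def)
next
  have z: "map pair w = zip (map xd w) (map yd w)" for w by (induction w) auto
  assume "map xd w = map xd w' \<and> map yd w = map yd w'"
  then show "map pair w = map pair w'" by (simp add: z)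
qed

text \<open>Above a fixed \<open>y\<close>-word, the \<open>x\<close>-word and the word of digit
  pairs determine each other.\<close>

lemma fib_pair: "fib u = card (map pair ` {w \<in> adm (length u). map yd w = u})"
  unfolding fib_def
  by (rule antisym; rule card_image_le_determined) (auto simp: map_pair_eq_iff)

lemma cnt_pair_eq_sum_fib: "cnt pair k = (\<Sum>u\<in>map yd ` adm k. fib u)"
proof -
  have "map pair ` adm k = (\<Union>u\<in>map yd ` adm k. map pair ` {w \<in> adm k. map yd w = u})" by auto
  then have "cnt pair k = card (\<Union>u\<in>map yd ` adm k. map pair ` {w \<in> adm k. map yd w = u})"
    unfolding cnt_def by simp
  also have "\<dots> = (\<Sum>u\<in>map yd ` adm k. card (map pair ` {w \<in> adm k. map yd w = u}))"
    by (rule card_UN_disjoint) (use map_pair_eq_iff in \<open>fastforce+\<close>)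
  also have "\<dots> = (\<Sum>u\<in>map yd ` adm k. fib u)"
    by (intro sum.cong refl) (auto simp: fib_pair adm_length)
  finally show ?thesis .
qed

lemma fib_append: "fib (u @ v) \<le> fib u * fib v"
proof -
  let ?F = "\<lambda>u. {w \<in> adm (length u). map yd w = u}"
  have "map xd ` ?F (u @ v) \<subseteq> (\<lambda>(x, y). x @ y) ` (map xd ` ?F u \<times> map xd ` ?F v)"
  proof
    fix s assume "s \<in> map xd ` ?F (u @ v)"
    then obtain w where w: "w \<in> adm (length u + length v)" "map yd w = u @ v" "s = map xd w" by auto
    have "take (length u) (map yd w) = u" "drop (length u) (map yd w) = v" unfolding w(2) by simp_all
    then have "map yd (take (length u) w) = u" "map yd (drop (length u) w) = v"
      by (simp_all add: take_map drop_map)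
    moreover have "s = map xd (take (length u) w) @ map xd (drop (length u) w)"
      unfolding w(3) by (metis append_take_drop_id map_append)
    ultimately show "s \<in> (\<lambda>(x, y). x @ y) ` (map xd ` ?F u \<times> map xd ` ?F v)"
      using adm_take_drop[OF w(1)]
      by (intro image_eqI[of _ _ "(map xd (take (length u) w), map xd (drop (length u) w))"]) auto
  qed
  then have "fib (u @ v) \<le> card ((\<lambda>(x, y). x @ y) ` (map xd ` ?F u \<times> map xd ` ?F v))"
    unfolding fib_def by (intro card_mono) auto
  also have "\<dots> = fib u * fib v"
    unfolding fib_def by (rule card_append_product[where k = "length u"]) (auto dest: adm_length)
  finally show ?thesis .
qed

definition max_fib :: "nat \<Rightarrow> nat" where
  "max_fib k = Max (fib ` map yd ` adm k)"

lemma fib_le_max_fib: "length u = k \<Longrightarrow> fib u \<le> max_fib k"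
proof (cases "u \<in> map yd ` adm k")
  case True
  then show ?thesis unfolding max_fib_def by (intro Max_ge) auto
next
  assume "length u = k"
  case False
  then have "fib u = 0" unfolding fib_def using \<open>length u = k\<close> by (auto simp: card_eq_0_iff)
  then show ?thesis by simp
qed

lemma max_fib_attained:
  obtains u where "u \<in> map yd ` adm k" "fib u = max_fib k" "length u = k"
proof -
  have "max_fib k \<in> fib ` map yd ` adm k"
    unfolding max_fib_def using adm_nonempty by (intro Max_in) auto
  then obtain w where "w \<in> adm k" "fib (map yd w) = max_fib k" by auto
  then show thesis using that[of "map yd w"] by (auto simp: adm_length)
qed

lemma fib_ge_1: "w \<in> adm k \<Longrightarrow> 1 \<le> fib (map yd w)"
  unfolding fib_def by (auto simp: Suc_le_eq card_gt_0_iff adm_length)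

lemma max_fib_ge_1: "1 \<le> max_fib k"
  using max_fib_attained[of k] fib_ge_1 by (metis imageE)

lemma max_fib_submult: "max_fib (k + l) \<le> max_fib k * max_fib l"
proof -
  obtain u where u: "fib u = max_fib (k + l)" "length u = k + l" using max_fib_attained[of "k + l"] by metis
  have "fib (take k u @ drop k u) \<le> fib (take k u) * fib (drop k u)" by (rule fib_append)
  also have "\<dots> \<le> max_fib k * max_fib l" using u by (intro mult_le_mono fib_le_max_fib) auto
  finally show ?thesis using u by simp
qed

lemma max_fib_le_cnt: "max_fib k \<le> cnt xd k"
proof -
  obtain u where u: "fib u = max_fib k" "length u = k" using max_fib_attained[of k] by metis
  have "fib u \<le> cnt xd k" unfolding fib_def cnt_def u(2) by (intro card_mono) auto
  with u show ?thesis by simp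
qed

text \<open>Gluing uses the same connecting word \<open>c\<close> for all pairs of words, so two
  optimal fibres are glued above the single \<open>y\<close>-word
  \<open>u1 @ map yd c @ u2\<close>.\<close>

lemma max_fib_supermult: "max_fib k * max_fib l \<le> CC * max_fib (k + l)"
proof -
  obtain u1 where u1: "fib u1 = max_fib k" "length u1 = k" using max_fib_attained[of k] by metis
  obtain u2 where u2: "fib u2 = max_fib l" "length u2 = l" using max_fib_attained[of l] by metis
  let ?F = "\<lambda>u. {w \<in> adm (length u). map yd w = u}"
  have sub: "?F u1 \<subseteq> adm k" "?F u2 \<subseteq> adm l" using u1 u2 by auto
  obtain c Q where Q: "length c \<le> gap" "Q \<subseteq> adm (k + length c + l)"
    "\<And>w. w \<in> Q \<Longrightarrow> \<exists>w1\<in>?F u1. \<exists>w2\<in>?F u2. w = w1 @ c @ w2"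
    "card (map xd ` ?F u1) * card (map xd ` ?F u2) \<le> (card V)\<^sup>2 * card (map xd ` Q)"
    using gluing[OF sub, where g = xd] by blast
  have "card (map xd ` Q) \<le> fib (u1 @ map yd c @ u2)"
    unfolding fib_def
  proof (intro card_mono image_mono subsetI)
    fix w assume w: "w \<in> Q"
    then show "w \<in> ?F (u1 @ map yd c @ u2)"
      using Q(2) Q(3)[OF w] u1(2) u2(2) by (auto simp: add.assoc)
  qed simp
  also have "\<dots> \<le> max_fib (k + l + length c)" using u1 u2 by (intro fib_le_max_fib) simp
  also have "\<dots> \<le> max_fib (k + l) * max_fib (length c)" by (rule max_fib_submult)
  also have "\<dots> \<le> max_fib (k + l) * card E ^ gap"
    using max_fib_le_cnt[of "length c"] cnt_le_power_gap[OF Q(1), of xd] by (intro mult_left_mono) auto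
  finally have "max_fib k * max_fib l \<le> (card V)\<^sup>2 * (max_fib (k + l) * card E ^ gap)"
    using Q(4) unfolding fib_def[symmetric] u1(1) u2(1) by (meson le_trans mult_le_mono2)
  also have "\<dots> \<le> CC * max_fib (k + l)"
    using mult_right_mono[OF CC_ge(2), of "max_fib (k + l)"] by (simp add: ac_simps)
  finally show ?thesis .
qed

lemma cnt_pair_le: "cnt pair k \<le> cnt yd k * max_fib k"
proof -
  have "cnt pair k \<le> (\<Sum>u\<in>map yd ` adm k. max_fib k)"
    unfolding cnt_pair_eq_sum_fib by (intro sum_mono fib_le_max_fib) (auto simp: adm_length)
  then show ?thesis by (simp add: cnt_def)
qed

section \<open>The three growth rates\<close>

definition hI :: real where "hI = htop_I E i t xd yd"
definition hy :: real where "hy = htop_piI E i t yd"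
definition hF :: real where "hF = lim (\<lambda>k. ln (real (max_fib k)) / real k)"

lemma cnt_growth:
  obtains h where "(\<lambda>k. ln (real (cnt g k)) / real k) \<longlonglongrightarrow> h" "0 \<le> h"
    "\<And>k. exp (real k * h) \<le> real CC * real (cnt g k)" "\<And>k. real (cnt g k) \<le> real CC * exp (real k * h)"
proof (rule quasi_multiplicative_growth[of "\<lambda>k. real (cnt g k)" "real CC"])
  show "1 \<le> real (cnt g k)" for k using cnt_ge_1[of g k] by linarith
  show "real (cnt g (k + l)) \<le> real (cnt g k) * real (cnt g l)" for k l
    using cnt_submult[of g k l] by (simp only: of_nat_mult[symmetric] of_nat_le_iff)
  show "real (cnt g k) * real (cnt g l) \<le> real CC * real (cnt g (k + l))" for k l
    using cnt_supermult[of g k l] by (simp only: of_nat_mult[symmetric] of_nat_le_iff)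
  show "1 \<le> real CC" using CC_ge(3) by linarith
qed (use that in blast)

lemma hI_growth: "0 \<le> hI" "exp (real k * hI) \<le> real CC * real (cnt pair k)"
    "real (cnt pair k) \<le> real CC * exp (real k * hI)"
proof -
  obtain h where h: "(\<lambda>k. ln (real (cnt pair k)) / real k) \<longlonglongrightarrow> h" "0 \<le> h"
    "\<And>k. exp (real k * h) \<le> real CC * real (cnt pair k)" "\<And>k. real (cnt pair k) \<le> real CC * exp (real k * h)"
    using cnt_growth[of pair] by blast
  have "hI = h" unfolding hI_def htop_I_def using h(1) unfolding cnt_def by (intro limI) simp
  with h show "0 \<le> hI" "exp (real k * hI) \<le> real CC * real (cnt pair k)"
    "real (cnt pair k) \<le> real CC * exp (real k * hI)" by simp_all
qed

lemma hy_growth: "0 \<le> hy" "exp (real k * hy) \<le> real CC * real (cnt yd k)"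
    "real (cnt yd k) \<le> real CC * exp (real k * hy)"
proof -
  obtain h where h: "(\<lambda>k. ln (real (cnt yd k)) / real k) \<longlonglongrightarrow> h" "0 \<le> h"
    "\<And>k. exp (real k * h) \<le> real CC * real (cnt yd k)" "\<And>k. real (cnt yd k) \<le> real CC * exp (real k * h)"
    using cnt_growth[of yd] by blast
  have "hy = h" unfolding hy_def htop_piI_def using h(1) unfolding cnt_def by (intro limI) simp
  with h show "0 \<le> hy" "exp (real k * hy) \<le> real CC * real (cnt yd k)"
    "real (cnt yd k) \<le> real CC * exp (real k * hy)" by simp_all
qed

lemma hF_growth: "0 \<le> hF" "exp (real k * hF) \<le> real CC * real (max_fib k)"
    "real (max_fib k) \<le> real CC * exp (real k * hF)"
    "(\<lambda>k. ln (real (max_fib k)) / real k) \<longlonglongrightarrow> hF"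
proof -
  obtain h where h: "(\<lambda>k. ln (real (max_fib k)) / real k) \<longlonglongrightarrow> h" "0 \<le> h"
    "\<And>k. exp (real k * h) \<le> real CC * real (max_fib k)" "\<And>k. real (max_fib k) \<le> real CC * exp (real k * h)"
  proof (rule quasi_multiplicative_growth[of "\<lambda>k. real (max_fib k)" "real CC"])
    show "1 \<le> real (max_fib k)" for k using max_fib_ge_1[of k] by linarith
    show "real (max_fib (k + l)) \<le> real (max_fib k) * real (max_fib l)" for k l
      using max_fib_submult[of k l] by (simp only: of_nat_mult[symmetric] of_nat_le_iff)
    show "real (max_fib k) * real (max_fib l) \<le> real CC * real (max_fib (k + l))" for k l
      using max_fib_supermult[of k l] by (simp only: of_nat_mult[symmetric] of_nat_le_iff)
    show "1 \<le> real CC" using CC_ge(3) by linarith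
  qed blast
  have "hF = h" unfolding hF_def using h(1) by (intro limI) simp
  with h show "0 \<le> hF" "exp (real k * hF) \<le> real CC * real (max_fib k)"
    "real (max_fib k) \<le> real CC * exp (real k * hF)"
    "(\<lambda>k. ln (real (max_fib k)) / real k) \<longlonglongrightarrow> hF" by simp_all
qed

section \<open>Fibre entropy\<close>

text \<open>Pigeonhole over pairs of vertices. A family with common ends is closed up to loops by
  one connecting word.\<close>

lemma two_ended:
  assumes "P \<subseteq> adm k"
  obtains v v' where "v \<in> V" "v' \<in> V"
    "card (map g ` P) \<le> (card V)\<^sup>2 * card (map g ` {w \<in> P. walk v w v'})"
proof -
  define S where "S z = {w \<in> P. walk (fst z) w (snd z)}" for z
  have "\<exists>z\<in>V \<times> V. w \<in> S z" if "w \<in> P" for w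
    using that subsetD[OF assms that] adm_iff[of w k] unfolding S_def by fastforce
  then have P: "P = (\<Union>z\<in>V \<times> V. S z)" by (auto simp: S_def)
  obtain z where z: "z \<in> V \<times> V" "card (\<Union>z\<in>V \<times> V. map g ` S z) \<le> card (V \<times> V) * card (map g ` S z)"
    using card_UN_pigeonhole[of "V \<times> V" "\<lambda>z. map g ` S z"] finite_V V_nonempty by blast
  have "card (map g ` P) \<le> (card V)\<^sup>2 * card (map g ` S z)"
    using z(2) P by (simp add: image_UN[symmetric] card_cartesian_product power2_eq_square)
  then show thesis using that[of "fst z" "snd z"] z(1) unfolding S_def by auto
qed

lemma fibre_limsup:
  "htop_fibre E i t xd yd y = real_of_ereal (limsup (\<lambda>k. ereal (ln (real (fib (map y [0..<k]))) / real k)))"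
  unfolding htop_fibre_def fib_def by simp

text \<open>\<open>htop_fibre\<close> converts a limsup of extended reals, so its finiteness has to
  be secured. The bounds hold for every \<open>y\<close>: when no word lies above a prefix, the
  count is \<open>0\<close> and \<open>ln 0 = 0\<close>.\<close>

lemma fibre_limsup_bounds:
  "0 \<le> limsup (\<lambda>k. ereal (ln (real (fib (map y [0..<k]))) / real k))"
  "limsup (\<lambda>k. ereal (ln (real (fib (map y [0..<k]))) / real k)) \<le> ereal hF"
proof -
  have ln_nonneg: "0 \<le> ln (real j)" for j :: nat by (cases j) auto
  show "0 \<le> limsup (\<lambda>k. ereal (ln (real (fib (map y [0..<k]))) / real k))"
    by (rule le_Limsup) (auto simp: ln_nonneg)
  have mono: "ln (real (fib (map y [0..<k]))) \<le> ln (real (max_fib k))" for k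
  proof (cases "fib (map y [0..<k]) = 0")
    case True
    then show ?thesis using ln_nonneg by simp
  next
    case False
    then show ?thesis using fib_le_max_fib[of "map y [0..<k]" k] max_fib_ge_1[of k] by simp
  qed
  have "limsup (\<lambda>k. ereal (ln (real (fib (map y [0..<k]))) / real k))
      \<le> limsup (\<lambda>k. ereal (ln (real (max_fib k)) / real k))"
    by (intro Limsup_mono always_eventually allI) (simp add: mono divide_right_mono)
  also have "\<dots> = ereal hF"
    using hF_growth(4) by (intro lim_imp_Limsup) auto
  finally show "limsup (\<lambda>k. ereal (ln (real (fib (map y [0..<k]))) / real k)) \<le> ereal hF" .
qed

lemma htop_fibre_le: "htop_fibre E i t xd yd y \<le> hF"
  using real_of_ereal_positive_mono[OF fibre_limsup_bounds[of y]] unfolding fibre_limsup by simp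

lemma piI_nonempty: "piI E i t yd \<noteq> {}"
proof -
  obtain v where v: "v \<in> V" using V_nonempty by blast
  have "\<exists>\<omega>. \<forall>j. \<omega> j \<in> E \<and> t (\<omega> j) = i (\<omega> (Suc j))"
  proof -
    obtain e where "e \<in> E" "i e = v" using out_edge[OF v] by blast
    then have "\<exists>f. \<forall>j. f j \<in> E \<and> t (f j) = i (f (Suc j))"
      using dependent_nat_choice[of "\<lambda>_ e. e \<in> E" "\<lambda>_ e e'. t e = i e'"] out_edge edge by metis
    then show ?thesis .
  qed
  then show ?thesis unfolding piI_def adm_inf_def by blast
qed

text \<open>The sequence \<open>y\<close> repeats \<open>u\<close> periodically. Loops at
  \<open>v\<close> above \<open>u\<close> can be concatenated freely, so the number of
  \<open>x\<close>-words above \<open>j\<close> periods is at least the \<open>j\<close>-th power of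
  the number of \<open>x\<close>-words of \<open>A\<close>.\<close>

lemma periodic_fibre:
  assumes "0 < L" and A: "A \<noteq> {}" "\<And>w. w \<in> A \<Longrightarrow> walk v w v \<and> length w = L \<and> map yd w = u" and "v \<in> V"
  obtains y where "y \<in> piI E i t yd" "ln (real (card (map xd ` A))) / real L \<le> htop_fibre E i t xd yd y"
proof -
  have A_adm: "A \<subseteq> adm L" using A(2) \<open>v \<in> V\<close> by (auto intro: admI)
  have finA: "finite A" by (rule finite_subset[OF A_adm finite_adm])
  have lu: "length u = L" using A by fastforce
  obtain w where w: "w \<in> A" using A(1) by blast
  note wA = A(2)[OF w]
  define y where "y j = u ! (j mod L)" for j
  define \<omega> where "\<omega> j = w ! (j mod L)" for j
  have nth_step: "t (w ! j) = i (w ! Suc j)" if "Suc j < L" for j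
    using subsetD[OF A_adm w] that by (simp add: adm_words_def)
  have nth_E: "w ! j \<in> E" if "j < L" for j
    using walk_set[of v w v] wA nth_mem[of j w] that by auto
  have last_first: "t (w ! (L - 1)) = i (w ! 0)"
  proof -
    have "w \<noteq> []" using wA \<open>0 < L\<close> by auto
    then obtain ws e where "w = ws @ [e]" by (metis rev_exhaust)
    then have "t (w ! (L - 1)) = v" using wA by (auto simp: walk_append nth_append)
    moreover have "i (w ! 0) = v" using wA \<open>w \<noteq> []\<close> by (cases w) auto
    ultimately show ?thesis by simp
  qed
  have "\<omega> \<in> adm_inf E i t"
    unfolding adm_inf_def
  proof (intro CollectI conjI allI)
    fix j
    show "\<omega> j \<in> E" unfolding \<omega>_def using nth_E \<open>0 < L\<close> by simp
    show "t (\<omega> j) = i (\<omega> (Suc j))"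
    proof (cases "Suc (j mod L) = L")
      case True
      then have "j mod L = L - 1" by simp
      then show ?thesis using last_first True unfolding \<omega>_def mod_Suc[of j L] by simp
    next
      case False
      then have "Suc (j mod L) < L" using mod_less_divisor[OF \<open>0 < L\<close>, of j] by linarith
      then show ?thesis using nth_step False unfolding \<omega>_def mod_Suc[of j L] by simp
    qed
  qed
  moreover have "y = (\<lambda>j. yd (\<omega> j))"
  proof
    fix j
    have "u ! (j mod L) = map yd w ! (j mod L)" using wA by simp
    also have "\<dots> = yd (w ! (j mod L))" using wA \<open>0 < L\<close> by (intro nth_map) simp
    finally show "y j = yd (\<omega> j)" unfolding y_def \<omega>_def .
  qed
  ultimately have "y \<in> piI E i t yd" unfolding piI_def by blast
  have y_period: "map y [0..<j * L] = concat (replicate j u)" for j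
  proof (induction j)
    case (Suc j)
    have "[0..<Suc j * L] = [0..<j * L] @ map (\<lambda>r. r + j * L) [0..<L]"
      using upt_add_eq_append[of 0 "j * L" L] map_add_upt[of "j * L" L] by (simp add: add.commute)
    moreover have "map (\<lambda>r. y (r + j * L)) [0..<L] = u"
      using lu by (auto intro!: nth_equalityI simp: y_def)
    ultimately have "map y [0..<Suc j * L] = concat (replicate j u) @ u"
      using Suc by (simp add: o_def)
    also have "\<dots> = concat (replicate (Suc j) u)"
      by (metis concat.simps(1,2) concat_append replicate_Suc replicate_append_same self_append_conv)
    finally show ?case .
  qed simp
  define B where "B j = {w. walk v w v \<and> length w = j * L \<and> map yd w = concat (replicate j u)}" for j
  have B_adm: "B j \<subseteq> {w \<in> adm (j * L). map yd w = concat (replicate j u)}" for j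
    unfolding B_def using \<open>v \<in> V\<close> by (auto intro: admI)
  then have finB: "finite (B j)" for j by (rule finite_subset) auto
  have cardB: "card (map xd ` A) ^ j \<le> card (map xd ` B j)" for j
  proof (induction j)
    case 0
    have "[] \<in> B 0" unfolding B_def by simp
    then have "map xd ` B 0 \<noteq> {}" by blast
    then show ?case using finB[of 0] by (simp add: Suc_le_eq card_gt_0_iff)
  next
    case (Suc j)
    have "(\<lambda>(x, y). x @ y) ` (map xd ` A \<times> map xd ` B j) \<subseteq> map xd ` B (Suc j)"
    proof
      fix s assume "s \<in> (\<lambda>(x, y). x @ y) ` (map xd ` A \<times> map xd ` B j)"
      then obtain w1 w2 where w12: "w1 \<in> A" "w2 \<in> B j" "s = map xd (w1 @ w2)" by auto
      have "w1 @ w2 \<in> B (Suc j)" using A(2)[OF w12(1)] w12(2) unfolding B_def by (auto simp: walk_append)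
      with w12 show "s \<in> map xd ` B (Suc j)" by blast
    qed
    then have "card ((\<lambda>(x, y). x @ y) ` (map xd ` A \<times> map xd ` B j)) \<le> card (map xd ` B (Suc j))"
      using finB by (intro card_mono) auto
    moreover have "card ((\<lambda>(x, y). x @ y) ` (map xd ` A \<times> map xd ` B j)) = card (map xd ` A) * card (map xd ` B j)"
      by (rule card_append_product[where k = L]) (use A(2) in auto)
    ultimately have "card (map xd ` A) * card (map xd ` B j) \<le> card (map xd ` B (Suc j))" by simp
    with mult_le_mono2[OF Suc.IH, of "card (map xd ` A)"] show ?case by (simp only: power_Suc)
  qed
  define X where "X k = ereal (ln (real (fib (map y [0..<k]))) / real k)" for k
  have a1: "1 \<le> card (map xd ` A)" using A(1) finA by (simp add: Suc_le_eq card_gt_0_iff)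
  have X: "ereal (ln (real (card (map xd ` A))) / real L) \<le> X (Suc j * L)" for j
  proof -
    have "card (map xd ` A) ^ Suc j \<le> card (map xd ` B (Suc j))" by (rule cardB)
    also have "\<dots> \<le> fib (concat (replicate (Suc j) u))"
    proof -
      have "length (concat (replicate (Suc j) u)) = Suc j * L"
        unfolding y_period[symmetric] by simp
      then show ?thesis unfolding fib_def using B_adm[of "Suc j"] by (intro card_mono image_mono) auto
    qed
    finally have le: "real (card (map xd ` A)) ^ Suc j \<le> real (fib (map y [0..<Suc j * L]))"
      unfolding y_period by (metis of_nat_le_iff of_nat_power)
    have "real (Suc j) * ln (real (card (map xd ` A))) = ln (real (card (map xd ` A)) ^ Suc j)"
      using a1 by (subst ln_realpow) auto
    also have "\<dots> \<le> ln (real (fib (map y [0..<Suc j * L])))"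
    proof -
      have "0 < real (card (map xd ` A)) ^ Suc j" using a1 by (intro zero_less_power) simp
      with le show ?thesis by (subst ln_le_cancel_iff) auto
    qed
    finally have "real (Suc j) * ln (real (card (map xd ` A))) / real (Suc j * L)
        \<le> ln (real (fib (map y [0..<Suc j * L]))) / real (Suc j * L)"
      by (intro divide_right_mono) auto
    moreover have "real (Suc j) * ln (real (card (map xd ` A))) / real (Suc j * L) = ln (real (card (map xd ` A))) / real L"
      unfolding of_nat_mult by (rule mult_divide_mult_cancel_left) simp
    ultimately show ?thesis unfolding X_def by simp
  qed
  \<comment> \<open>The limsup dominates the one along full periods; the index \<open>Suc j\<close>
    avoids length zero.\<close>
  have "ereal (ln (real (card (map xd ` A))) / real L) \<le> limsup (X \<circ> (\<lambda>j. Suc j * L))"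
    by (rule le_Limsup) (use X in auto)
  also have "\<dots> \<le> limsup X"
    by (rule limsup_subseq_mono) (use \<open>0 < L\<close> in \<open>auto simp: strict_mono_def\<close>)
  finally have "ereal (ln (real (card (map xd ` A))) / real L) \<le> limsup X" .
  moreover have "0 \<le> ln (real (card (map xd ` A))) / real L" using a1 by simp
  moreover have "limsup X \<noteq> \<infinity>" using fibre_limsup_bounds(2)[of y] unfolding X_def[abs_def] by auto
  ultimately have "real_of_ereal (ereal (ln (real (card (map xd ` A))) / real L)) \<le> real_of_ereal (limsup X)"
    by (intro real_of_ereal_positive_mono) auto
  then have "ln (real (card (map xd ` A))) / real L \<le> htop_fibre E i t xd yd y"
    unfolding fibre_limsup X_def[abs_def] by simp
  with \<open>y \<in> piI E i t yd\<close> that show thesis by blast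
qed

lemma SUP_htop_fibre: "(SUP y\<in>piI E i t yd. htop_fibre E i t xd yd y) = hF" (is "?S = _")
proof (rule antisym)
  show "?S \<le> hF" by (rule cSUP_least[OF piI_nonempty htop_fibre_le])
  have bdd: "bdd_above (htop_fibre E i t xd yd ` piI E i t yd)"
    by (rule bdd_aboveI2[of _ _ hF]) (rule htop_fibre_le)
  \<comment> \<open>Closing words of length \<open>k\<close> up to loops adds at most
    \<open>gap\<close> letters, which costs \<open>gap * hF\<close>; the two \<open>ln CC\<close>
    come from the growth bound and from fixing both end vertices.\<close>
  define c where "c = real gap * hF + 2 * ln (real CC)"
  have step: "hF - c / real k \<le> ?S" if "1 \<le> k" for k
  proof -
    obtain u where u: "u \<in> map yd ` adm k" "fib u = max_fib k" "length u = k" using max_fib_attained[of k] .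
    define P where "P = {w \<in> adm k. map yd w = u}"
    obtain v v' where v: "v \<in> V" "v' \<in> V"
      "card (map xd ` P) \<le> (card V)\<^sup>2 * card (map xd ` {w \<in> P. walk v w v'})"
      using two_ended[of P k xd] unfolding P_def by blast
    obtain c0 where c0: "walk v' c0 v" "length c0 \<le> gap" using connector[OF v(2,1)] .
    define A where "A = (\<lambda>w. w @ c0) ` {w \<in> P. walk v w v'}"
    define L where "L = k + length c0"
    have "card (map xd ` A) = card ((\<lambda>s. s @ map xd c0) ` map xd ` {w \<in> P. walk v w v'})"
      unfolding A_def image_image by simp
    also have "\<dots> = card (map xd ` {w \<in> P. walk v w v'})" by (intro card_image) (auto simp: inj_on_def)
    finally have cA: "max_fib k \<le> (card V)\<^sup>2 * card (map xd ` A)"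
      using v(3) u(2,3) unfolding fib_def P_def by simp
    have neA: "A \<noteq> {}"
    proof
      assume "A = {}"
      then show False using cA max_fib_ge_1[of k] by simp
    qed
    have loops: "walk v w v \<and> length w = L \<and> map yd w = u @ map yd c0" if "w \<in> A" for w
      using that c0(1) unfolding A_def P_def L_def by (auto simp: walk_append adm_length)
    have "0 < L" using that unfolding L_def by simp
    obtain y where y: "y \<in> piI E i t yd"
      "ln (real (card (map xd ` A))) / real L \<le> htop_fibre E i t xd yd y"
      using periodic_fibre[OF \<open>0 < L\<close> neA loops v(1)] .
    have a_pos: "0 < card (map xd ` A)" using cA max_fib_ge_1[of k] by (cases "card (map xd ` A)") auto
    have "exp (real k * hF) \<le> real CC * (real CC * real (card (map xd ` A)))"
    proof -
      have "max_fib k \<le> CC * card (map xd ` A)"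
        using cA mult_right_mono[OF CC_ge(5), of "card (map xd ` A)"] by linarith
      then have "real (max_fib k) \<le> real CC * real (card (map xd ` A))" by (simp only: of_nat_mult[symmetric] of_nat_le_iff)
      then have "real CC * real (max_fib k) \<le> real CC * (real CC * real (card (map xd ` A)))"
        by (intro mult_left_mono) auto
      then show ?thesis using hF_growth(2)[of k] by linarith
    qed
    then have "real k * hF \<le> ln (real CC * (real CC * real (card (map xd ` A))))"
      using a_pos CC_ge(3) by (subst ln_ge_iff) auto
    then have "real k * hF \<le> 2 * ln (real CC) + ln (real (card (map xd ` A)))"
      using a_pos CC_ge(3) by (simp add: ln_mult)
    moreover have "real L * hF \<le> real k * hF + real gap * hF"
    proof -
      have "real L \<le> real k + real gap" unfolding L_def using c0(2) by simp
      from mult_right_mono[OF this hF_growth(1)] show ?thesis by (simp add: algebra_simps)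
    qed
    ultimately have "real L * hF - c \<le> ln (real (card (map xd ` A)))" unfolding c_def by linarith
    then have "(real L * hF - c) / real L \<le> ln (real (card (map xd ` A))) / real L"
      by (intro divide_right_mono) auto
    moreover have "(real L * hF - c) / real L = hF - c / real L"
      using that unfolding L_def by (simp add: field_simps)
    moreover have "c / real L \<le> c / real k"
    proof -
      have "0 \<le> c" unfolding c_def using hF_growth(1) CC_ge(3) by simp
      then show ?thesis using that unfolding L_def by (intro divide_left_mono) auto
    qed
    ultimately have "hF - c / real k \<le> htop_fibre E i t xd yd y" using y(2) by linarith
    also have "\<dots> \<le> ?S" by (rule cSUP_upper[OF y(1) bdd])
    finally show ?thesis .
  qed
  have "(\<lambda>k. hF - c / real k) \<longlonglongrightarrow> hF - 0" by (intro tendsto_intros lim_const_over_n)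
  then show "hF \<le> ?S" using step by (intro LIMSEQ_le_const2[of _ hF ?S]) auto
qed

end

section \<open>Box dimension\<close>

text \<open>All that the dimension estimates know about the attractor: it is compact, every word has
  a point of it in its closed cell, and every point has a word of each length. The word need not be
  unique, and cells of different words may overlap.\<close>

locale carpet_set = carpet_graph V E i t n m xd yd
  for V :: "'v set" and E :: "'e set" and i t n m xd yd +
  fixes X :: "(real \<times> real) set"
  assumes compact_X: "compact X"
    and point: "\<And>w k. w \<in> adm_words E i t k \<Longrightarrow>
      \<exists>p\<in>X. in_cell n (fst p) (map xd w) \<and> in_cell m (snd p) (map yd w)"
    and word: "\<And>p k. p \<in> X \<Longrightarrow>
      \<exists>w\<in>adm_words E i t k. in_cell n (fst p) (map xd w) \<and> in_cell m (snd p) (map yd w)"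
begin

definition \<alpha> :: real where "\<alpha> = ln (real m) / ln (real n)"

lemma ln_m_pos: "0 < ln (real m)" and ln_n_pos: "0 < ln (real n)"
  using m_ge_2 m_less_n by auto

lemma \<alpha>_bounds: "0 < \<alpha>" "\<alpha> < 1"
  unfolding \<alpha>_def using ln_m_pos ln_n_pos m_ge_2 m_less_n by auto

lemma \<alpha>_ln_n: "\<alpha> * ln (real n) = ln (real m)"
  unfolding \<alpha>_def using ln_n_pos by simp

lemma m_pos: "0 < m" and n_pos: "0 < n"
  using m_ge_2 m_less_n by auto

definition lev :: "nat \<Rightarrow> nat" where "lev k = nat \<lfloor>\<alpha> * real k\<rfloor>"

lemma lev_bounds: "real (lev k) \<le> \<alpha> * real k" "\<alpha> * real k < real (lev k) + 1"
proof -
  have "0 \<le> \<alpha> * real k" using \<alpha>_bounds by simp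
  then have "real (lev k) = of_int \<lfloor>\<alpha> * real k\<rfloor>" unfolding lev_def by simp
  then show "real (lev k) \<le> \<alpha> * real k" "\<alpha> * real k < real (lev k) + 1" by linarith+
qed

lemma lev_le: "lev k \<le> k"
proof -
  have "\<alpha> * real k \<le> 1 * real k" using \<alpha>_bounds by (intro mult_right_mono) auto
  then show ?thesis using lev_bounds(1)[of k] by linarith
qed

lemma lev_mono: "k \<le> l \<Longrightarrow> lev k \<le> lev l"
  unfolding lev_def using \<alpha>_bounds by (intro nat_mono floor_mono mult_left_mono) auto

lemma power_eq_exp: "0 < b \<Longrightarrow> real b ^ k = exp (real k * ln (real b))"
  by (simp add: exp_of_nat_mult)

lemma n_power_lev: "real n ^ lev k \<le> real m ^ k" "real m ^ k \<le> real n * real n ^ lev k"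
proof -
  have eq: "real m ^ k = exp (\<alpha> * real k * ln (real n))"
    unfolding power_eq_exp[OF m_pos] \<alpha>_ln_n[symmetric] by (simp add: ac_simps)
  show "real n ^ lev k \<le> real m ^ k"
    unfolding eq power_eq_exp[OF n_pos] using lev_bounds(1)[of k] ln_n_pos by simp
  have "real m ^ k \<le> real n ^ Suc (lev k)"
    unfolding eq power_eq_exp[OF n_pos] using lev_bounds(2)[of k] ln_n_pos by simp
  then show "real m ^ k \<le> real n * real n ^ lev k" by simp
qed

definition pt :: "'e list \<Rightarrow> real \<times> real" where
  "pt w = (SOME p. p \<in> X \<and> in_cell n (fst p) (map xd w) \<and> in_cell m (snd p) (map yd w))"

lemma pt:
  assumes "w \<in> adm k"
  shows "pt w \<in> X" "in_cell n (fst (pt w)) (map xd w)" "in_cell m (snd (pt w)) (map yd w)"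
proof -
  have "\<exists>p. p \<in> X \<and> in_cell n (fst p) (map xd w) \<and> in_cell m (snd p) (map yd w)"
    using point[OF assms] by blast
  from someI_ex[OF this] show "pt w \<in> X" "in_cell n (fst (pt w)) (map xd w)" "in_cell m (snd (pt w)) (map yd w)"
    unfolding pt_def by auto
qed

lemma adm_digits:
  assumes "w \<in> adm k"
  shows "\<forall>d\<in>set (map xd w). d < n" "\<forall>d\<in>set (map yd w). d < m"
  using adm_set[OF assms] digits by auto

text \<open>The approximate square of level \<open>k\<close> of a word: width \<open>n\<^sup>-\<^sup>l\<close> with \<open>l = lev k\<close> and
  height \<open>m\<^sup>-\<^sup>k\<close> agree up to the factor \<open>n\<close>.\<close>

definition sq :: "nat \<Rightarrow> 'e list \<Rightarrow> nat list \<times> nat list" where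
  "sq k w = (take (lev k) (map xd w), map yd w)"

abbreviation sq_cell :: "nat list \<times> nat list \<Rightarrow> (real \<times> real) set" where
  "sq_cell s \<equiv> cell n m (fst s) (snd s)"

lemma in_sq_cell:
  assumes "w \<in> adm k" "in_cell n (fst p) (map xd w)" "in_cell m (snd p) (map yd w)"
  shows "p \<in> sq_cell (sq k w)"
  unfolding cell_def sq_def using assms in_cell_take[of n "fst p" "map xd w" "lev k"] adm_digits n_pos by auto

lemma side_sum_le: "1 / real n ^ lev k + 1 / real m ^ k \<le> (real n + 1) / real m ^ k"
proof -
  have "1 / real n ^ lev k \<le> real n / real m ^ k"
    using n_power_lev(2)[of k] n_pos m_pos by (simp add: field_simps)
  then show ?thesis by (simp add: add_divide_distrib)
qed

lemma sq_cell_small: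
  assumes "w \<in> adm k"
  shows "bounded (sq_cell (sq k w))" "diameter (sq_cell (sq k w)) \<le> (real n + 1) / real m ^ k"
proof -
  have "length (fst (sq k w)) = lev k" "length (snd (sq k w)) = k"
    using adm_length[OF assms] lev_le[of k] by (auto simp: sq_def)
  then have "diameter (sq_cell (sq k w)) \<le> 1 / real n ^ lev k + 1 / real m ^ k"
    using cell_bounded_diameter(2)[OF n_pos m_pos, of "fst (sq k w)" "snd (sq k w)"] by simp
  also note side_sum_le
  finally show "diameter (sq_cell (sq k w)) \<le> (real n + 1) / real m ^ k" .
qed (rule cell_bounded_diameter(1)[OF n_pos m_pos])

lemma sq_cover:
  assumes "F \<subseteq> X" "(real n + 1) / real m ^ k \<le> \<delta>"
    and T: "\<And>p w. p \<in> F \<Longrightarrow> w \<in> adm k \<Longrightarrow> in_cell n (fst p) (map xd w) \<Longrightarrow> in_cell m (snd p) (map yd w) \<Longrightarrow> w \<in> T"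
    and "T \<subseteq> adm k"
  shows "finite (sq_cell ` sq k ` T)" "F \<subseteq> \<Union>(sq_cell ` sq k ` T)"
    "\<And>U. U \<in> sq_cell ` sq k ` T \<Longrightarrow> bounded U \<and> diameter U \<le> \<delta>"
proof -
  show "finite (sq_cell ` sq k ` T)" using finite_subset[OF assms(4) finite_adm] by simp
  show "F \<subseteq> \<Union>(sq_cell ` sq k ` T)"
  proof
    fix p assume "p \<in> F"
    then obtain w where w: "w \<in> adm k" "in_cell n (fst p) (map xd w)" "in_cell m (snd p) (map yd w)"
      using word[of p k] assms(1) by blast
    from T[OF \<open>p \<in> F\<close> this] in_sq_cell[OF this] show "p \<in> \<Union>(sq_cell ` sq k ` T)" by blast
  qed
  fix U assume "U \<in> sq_cell ` sq k ` T"
  then obtain w where w: "w \<in> adm k" "U = sq_cell (sq k w)" using assms(4) by blast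
  show "bounded U \<and> diameter U \<le> \<delta>"
    using sq_cell_small[OF w(1)] assms(2) unfolding w(2) by linarith
qed

lemma cover_number_le_sq:
  assumes "F \<subseteq> X" "(real n + 1) / real m ^ k \<le> \<delta>"
    and "\<And>p w. p \<in> F \<Longrightarrow> w \<in> adm k \<Longrightarrow> in_cell n (fst p) (map xd w) \<Longrightarrow> in_cell m (snd p) (map yd w) \<Longrightarrow> w \<in> T"
    and "T \<subseteq> adm k"
  shows "cover_number \<delta> F \<le> card (sq k ` T)"
proof -
  have "cover_number \<delta> F \<le> card (sq_cell ` sq k ` T)"
    by (rule cover_number_le[OF sq_cover[OF assms]])
  also have "\<dots> \<le> card (sq k ` T)"
    using finite_subset[OF assms(4) finite_adm] by (intro card_image_le) auto
  finally show ?thesis .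
qed

lemma exists_small_level:
  assumes "0 < \<delta>"
  obtains k where "(real n + 1) / real m ^ k \<le> \<delta>"
proof -
  have "1 < real m" using m_ge_2 by simp
  from real_arch_pow[OF this, of "(real n + 1) / \<delta>"]
  obtain k where "(real n + 1) / \<delta> < real m ^ k" by blast
  then have "(real n + 1) / real m ^ k \<le> \<delta>" using assms m_pos by (simp add: field_simps)
  then show thesis by (rule that)
qed

text \<open>A covering set of diameter at most \<open>\<delta>\<close> contains the chosen points
  \<open>pt w\<close> of words from at most \<open>9\<close> approximate squares, by
  \<open>grid_count\<close> with \<open>J = 1\<close>. Every square of \<open>T\<close> has a chosen
  point in \<open>F\<close>, which must be covered.\<close>

lemma sq_packing:
  assumes "F \<subseteq> X" "0 < \<delta>" "\<delta> * real m ^ k \<le> 1" "T \<subseteq> adm k" "\<And>w. w \<in> T \<Longrightarrow> pt w \<in> F"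
  shows "card (sq k ` T) \<le> 9 * cover_number \<delta> F"
proof -
  \<comment> \<open>The fine level \<open>k'\<close> only provides some finite cover, so that a
    minimal one exists.\<close>
  obtain k' where "(real n + 1) / real m ^ k' \<le> \<delta>" using exists_small_level[OF assms(2)] .
  note cov = sq_cover[OF assms(1) this, of "adm k'"]
  obtain C where C: "finite C" "F \<subseteq> \<Union>C" "\<And>U. U \<in> C \<Longrightarrow> bounded U \<and> diameter U \<le> \<delta>"
    "card C = cover_number \<delta> F"
    using cover_number_attained[OF cov] by auto
  have finT: "finite T" by (rule finite_subset[OF assms(4) finite_adm])
  have "card (sq k ` T) \<le> card (\<Union>U\<in>C. sq k ` {w \<in> T. pt w \<in> U})"
  proof (rule card_mono)
    show "finite (\<Union>U\<in>C. sq k ` {w \<in> T. pt w \<in> U})" using C(1) finT by auto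
    show "sq k ` T \<subseteq> (\<Union>U\<in>C. sq k ` {w \<in> T. pt w \<in> U})"
    proof
      fix s assume "s \<in> sq k ` T"
      then obtain w where w: "w \<in> T" "s = sq k w" by blast
      then obtain U where "U \<in> C" "pt w \<in> U" using subsetD[OF C(2) assms(5)[OF w(1)]] by blast
      with w show "s \<in> (\<Union>U\<in>C. sq k ` {w \<in> T. pt w \<in> U})" by blast
    qed
  qed
  also have "\<dots> \<le> (\<Sum>U\<in>C. card (sq k ` {w \<in> T. pt w \<in> U}))" by (rule card_UN_le[OF C(1)])
  also have "\<dots> \<le> (\<Sum>U\<in>C. 9)"
  proof (rule sum_mono)
    fix U assume U: "U \<in> C"
    have "card ((\<lambda>w. (take (lev k) (map xd w), map yd w)) ` {w \<in> T. pt w \<in> U}) \<le> (1 + 2)\<^sup>2"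
    proof (rule grid_count[where p = pt and n = n and m = m and l = "lev k" and k = k and r = \<delta>])
      fix w assume w: "w \<in> {w \<in> T. pt w \<in> U}"
      then have wa: "w \<in> adm k" using assms(4) by auto
      have "lev k \<le> length w" using adm_length[OF wa] lev_le by simp
      moreover have "\<forall>d\<in>set (take (lev k) (map xd w)). d < n"
        using adm_digits(1)[OF wa] set_take_subset[of "lev k" "map xd w"] by blast
      ultimately show "in_cell n (fst (pt w)) (take (lev k) (map xd w)) \<and> length (take (lev k) (map xd w)) = lev k
          \<and> (\<forall>d\<in>set (take (lev k) (map xd w)). d < n)"
        using in_cell_take[OF pt(2)[OF wa] adm_digits(1)[OF wa] n_pos] by simp
      show "in_cell m (snd (pt w)) (map yd w) \<and> length (map yd w) = k \<and> (\<forall>d\<in>set (map yd w). d < m)"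
        using pt(3)[OF wa] adm_digits(2)[OF wa] adm_length[OF wa] by simp
    next
      fix w w' assume "w \<in> {w \<in> T. pt w \<in> U}" "w' \<in> {w \<in> T. pt w \<in> U}"
      then have "dist (pt w) (pt w') \<le> diameter U" using C(3)[OF U] by (auto intro: diameter_bounded_bound)
      then show "dist (pt w) (pt w') \<le> \<delta>" using C(3)[OF U] by linarith
    next
      have "\<delta> * real n ^ lev k \<le> \<delta> * real m ^ k" using n_power_lev(1) assms(2) by (intro mult_left_mono) auto
      then show "\<delta> * real n ^ lev k \<le> real 1" using assms(3) by simp
    qed (use finT assms(3) in auto)
    then show "card (sq k ` {w \<in> T. pt w \<in> U}) \<le> 9"
      unfolding sq_def[abs_def] by (simp add: power2_eq_square)
  qed
  also have "\<dots> = 9 * cover_number \<delta> F" using C(4) by simp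
  finally show ?thesis .
qed

lemma sq_determines:
  assumes "w \<in> adm (l + j)" "w' \<in> adm (l + j)" "l = lev (l + j)"
  shows "sq (l + j) w = sq (l + j) w' \<longleftrightarrow>
    (map pair (take l w), map yd (drop l w)) = (map pair (take l w'), map yd (drop l w'))"
proof -
  have "map yd w = map yd w' \<longleftrightarrow> map yd (take l w) = map yd (take l w') \<and> map yd (drop l w) = map yd (drop l w')"
    using adm_length[OF assms(1)] adm_length[OF assms(2)]
    by (metis append_take_drop_id map_append take_map drop_map)
  then show ?thesis
    unfolding sq_def assms(3)[symmetric] map_pair_eq_iff prod.inject take_map by auto
qed

definition dB :: real where "dB = (\<alpha> * hI + (1 - \<alpha>) * hy) / ln (real m)"

definition dA :: real where "dA = (hy + \<alpha> * hF) / ln (real m)"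

lemma m_power_powr: "(real m ^ k) powr d = exp (real k * (d * ln (real m)))"
  using m_pos by (simp add: powr_def ln_realpow ac_simps)

text \<open>A square of level \<open>k\<close> is a word of digit pairs of length
  \<open>lev k\<close> followed by a \<open>y\<close>-word of length \<open>k - lev k\<close>; by
  \<open>extension_count\<close> at least the proportion \<open>1 / CC\<close> of all combinations
  occurs. The factors \<open>exp hy\<close> and \<open>exp hI\<close> absorb the rounding in
  \<open>lev\<close>.\<close>

lemma sq_count:
  "real (card (sq k ` adm k)) \<le> (real CC)\<^sup>2 * exp hy * (real m ^ k) powr dB"
  "(real m ^ k) powr dB \<le> real CC ^ 3 * exp hI * real (card (sq k ` adm k))"
proof -
  define l j where "l = lev k" and "j = k - lev k"
  have k: "k = l + j" using lev_le[of k] by (simp add: l_def j_def)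
  have lk: "l = lev (l + j)" using k l_def by simp
  let ?g = "\<lambda>w. (map pair (take l w), map yd (drop l w))"
  have det: "card (sq k ` adm k) = card (?g ` adm k)"
    unfolding k by (rule antisym; rule card_image_le_determined[OF finite_adm]) (use sq_determines[OF _ _ lk] in blast)+
  have d: "dB * ln (real m) = \<alpha> * hI + (1 - \<alpha>) * hy" unfolding dB_def using ln_m_pos by simp
  have lj: "real l \<le> \<alpha> * real k" "\<alpha> * real k \<le> real l + 1"
    "real j \<le> (1 - \<alpha>) * real k + 1" "(1 - \<alpha>) * real k \<le> real j"
    using lev_bounds[of k] k unfolding l_def by (auto simp: algebra_simps)
  have "card (?g ` adm k) \<le> card ((map pair ` adm l) \<times> (map yd ` adm j))"
    by (rule card_mono) (use adm_take_drop[of _ l j] in \<open>auto simp: k\<close>)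
  then have "card (sq k ` adm k) \<le> cnt pair l * cnt yd j"
    unfolding det by (simp add: card_cartesian_product cnt_def)
  then have "real (card (sq k ` adm k)) \<le> real (cnt pair l) * real (cnt yd j)" by (simp only: of_nat_mult[symmetric] of_nat_le_iff)
  also have "\<dots> \<le> (real CC * exp (real l * hI)) * (real CC * exp (real j * hy))"
    by (intro mult_mono hI_growth(3) hy_growth(3)) auto
  also have "\<dots> = (real CC)\<^sup>2 * exp (real l * hI + real j * hy)"
    by (simp add: exp_add power2_eq_square)
  also have "\<dots> \<le> (real CC)\<^sup>2 * exp (hy + real k * (dB * ln (real m)))"
  proof -
    have "real l * hI \<le> \<alpha> * real k * hI" "real j * hy \<le> ((1 - \<alpha>) * real k + 1) * hy"
      using lj hI_growth(1) hy_growth(1) by (auto intro: mult_right_mono)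
    then have "real l * hI + real j * hy \<le> hy + real k * (dB * ln (real m))"
      unfolding d by (simp add: algebra_simps)
    then show ?thesis by (intro mult_left_mono) auto
  qed
  also have "\<dots> = (real CC)\<^sup>2 * exp hy * (real m ^ k) powr dB"
    unfolding m_power_powr by (simp add: exp_add)
  finally show "real (card (sq k ` adm k)) \<le> (real CC)\<^sup>2 * exp hy * (real m ^ k) powr dB" .
  have "cnt pair l * cnt yd j \<le> card V * card E ^ gap * card (?g ` {w \<in> adm (l + j). take l w \<in> adm l})"
    using extension_count[OF order_refl, of pair l yd j] unfolding cnt_def by simp
  also have "\<dots> \<le> CC * card (?g ` adm k)"
    by (intro mult_mono CC_ge card_mono) (auto simp: k)
  finally have "cnt pair l * cnt yd j \<le> CC * card (sq k ` adm k)" unfolding det .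
  then have lower: "real (cnt pair l) * real (cnt yd j) \<le> real CC * real (card (sq k ` adm k))"
    by (simp only: of_nat_mult[symmetric] of_nat_le_iff)
  have "(real m ^ k) powr dB \<le> exp hI * exp (real l * hI + real j * hy)"
  proof -
    have "\<alpha> * real k * hI \<le> (real l + 1) * hI" "(1 - \<alpha>) * real k * hy \<le> real j * hy"
      using lj hI_growth(1) hy_growth(1) by (auto intro: mult_right_mono)
    then have "real k * (dB * ln (real m)) \<le> hI + (real l * hI + real j * hy)"
      unfolding d by (simp add: algebra_simps)
    then show ?thesis unfolding m_power_powr exp_add[symmetric] by simp
  qed
  also have "\<dots> = exp hI * (exp (real l * hI) * exp (real j * hy))" by (simp add: exp_add)
  also have "\<dots> \<le> exp hI * ((real CC * real (cnt pair l)) * (real CC * real (cnt yd j)))"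
    by (intro mult_left_mono mult_mono hI_growth(2) hy_growth(2)) auto
  also have "\<dots> = exp hI * (real CC)\<^sup>2 * (real (cnt pair l) * real (cnt yd j))"
    by (simp add: power2_eq_square)
  also have "\<dots> \<le> exp hI * (real CC)\<^sup>2 * (real CC * real (card (sq k ` adm k)))"
    by (intro mult_left_mono lower) auto
  also have "\<dots> = real CC ^ 3 * exp hI * real (card (sq k ` adm k))"
    by (simp add: power2_eq_square power3_eq_cube)
  finally show "(real m ^ k) powr dB \<le> real CC ^ 3 * exp hI * real (card (sq k ` adm k))" .
qed

lemma level_of_scale:
  assumes "0 < \<delta>" "\<delta> \<le> 1"
  obtains k where "\<delta> * real m ^ k \<le> 1" "1 < \<delta> * real m ^ Suc k"
proof -
  have "\<exists>k. 1 < \<delta> * real m ^ k"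
  proof -
    obtain k where k: "(real n + 1) / real m ^ k \<le> \<delta>" using exists_small_level[OF assms(1)] .
    then have "real n + 1 \<le> \<delta> * real m ^ k" using m_pos by (simp add: field_simps)
    moreover have "0 < real n" using n_pos by simp
    ultimately have "1 < \<delta> * real m ^ k" by linarith
    then show ?thesis by blast
  qed
  define k where "k = (LEAST k. 1 < \<delta> * real m ^ k)"
  have k: "1 < \<delta> * real m ^ k" "\<And>j. j < k \<Longrightarrow> \<not> 1 < \<delta> * real m ^ j"
    unfolding k_def using LeastI_ex[OF \<open>\<exists>k. 1 < \<delta> * real m ^ k\<close>] not_less_Least by blast+
  then have "k \<noteq> 0" using assms by (intro notI) simp
  then obtain k' where "k = Suc k'" by (metis not0_implies_Suc)
  with k(1) k(2)[of k'] show thesis using that[of k'] by (simp add: not_less)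
qed

lemma CC_real: "1 \<le> real CC" "0 < real CC"
  using CC_ge(3) by auto

lemma dB_nonneg: "0 \<le> dB"
  unfolding dB_def using \<alpha>_bounds hI_growth(1) hy_growth(1) ln_m_pos by simp

lemma dA_nonneg: "0 \<le> dA"
  unfolding dA_def using \<alpha>_bounds hF_growth(1) hy_growth(1) ln_m_pos by simp

theorem box_dim_X: "box_dim X = dB"
proof -
  \<comment> \<open>Going \<open>Suc q\<close> levels beyond the level \<open>k\<close> of the scale
    \<open>\<delta>\<close> absorbs the factor \<open>n + 1\<close> in the diameter of a
    square.\<close>
  define q where "q = Suc n"
  have q: "real n + 1 \<le> real m ^ q"
  proof -
    have "Suc n \<le> 2 ^ Suc n" using less_exp[of "Suc n"] by (rule less_imp_le)
    also have "\<dots> \<le> m ^ Suc n" using m_ge_2 by (rule power_mono) simp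
    finally have "real (Suc n) \<le> real (m ^ Suc n)" by (simp only: of_nat_le_iff)
    then show ?thesis unfolding q_def by simp
  qed
  define c where "c = inverse (9 * real CC ^ 3 * exp hI * real m powr dB)"
  define C where "C = (real CC)\<^sup>2 * exp hy * (real m ^ Suc q) powr dB"
  have "0 < c" unfolding c_def using CC_real m_pos by simp
  moreover have "c * (1 / \<delta>) powr dB \<le> real (cover_number \<delta> X) \<and> real (cover_number \<delta> X) \<le> C * (1 / \<delta>) powr dB"
    if \<delta>: "0 < \<delta>" "\<delta> \<le> 1" for \<delta>
  proof
    obtain k where k: "\<delta> * real m ^ k \<le> 1" "1 < \<delta> * real m ^ Suc k" using level_of_scale[OF \<delta>] .
    have "card (sq k ` adm k) \<le> 9 * cover_number \<delta> X"
      by (rule sq_packing) (use \<delta> k pt(1) in auto)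
    then have pk: "real (card (sq k ` adm k)) \<le> 9 * real (cover_number \<delta> X)" by linarith
    have "(1 / \<delta>) powr dB \<le> (real m * real m ^ k) powr dB"
      using k \<delta> dB_nonneg by (intro powr_mono2) (auto simp: field_simps)
    also have "\<dots> = real m powr dB * (real m ^ k) powr dB" using m_pos by (simp add: powr_mult)
    also have "\<dots> \<le> real m powr dB * (real CC ^ 3 * exp hI * (9 * real (cover_number \<delta> X)))"
    proof (intro mult_left_mono)
      have "real CC ^ 3 * exp hI * real (card (sq k ` adm k)) \<le> real CC ^ 3 * exp hI * (9 * real (cover_number \<delta> X))"
        by (intro mult_left_mono pk) auto
      then show "(real m ^ k) powr dB \<le> real CC ^ 3 * exp hI * (9 * real (cover_number \<delta> X))"
        using sq_count(2)[of k] by linarith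
    qed simp
    also have "\<dots> = inverse c * real (cover_number \<delta> X)"
      unfolding c_def by (simp only: inverse_inverse_eq ac_simps)
    finally show "c * (1 / \<delta>) powr dB \<le> real (cover_number \<delta> X)"
      using \<open>0 < c\<close> by (simp add: field_simps)
    have "(real n + 1) / real m ^ (k + Suc q) \<le> real m ^ q / real m ^ (k + Suc q)"
      by (intro divide_right_mono q) simp
    also have "\<dots> = 1 / real m ^ Suc k" using m_pos by (simp add: power_add)
    also have "\<dots> \<le> \<delta>" using k(2) m_pos by (simp add: field_simps)
    finally have "cover_number \<delta> X \<le> card (sq (k + Suc q) ` adm (k + Suc q))"
      by (intro cover_number_le_sq) auto
    then have "real (cover_number \<delta> X) \<le> (real CC)\<^sup>2 * exp hy * (real m ^ (k + Suc q)) powr dB"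
      using sq_count(1)[of "k + Suc q"] by linarith
    also have "(real m ^ (k + Suc q)) powr dB = (real m ^ k) powr dB * (real m ^ Suc q) powr dB"
      by (subst power_add, subst powr_mult) auto
    also have "(real CC)\<^sup>2 * exp hy * ((real m ^ k) powr dB * (real m ^ Suc q) powr dB)
        \<le> (real CC)\<^sup>2 * exp hy * ((1 / \<delta>) powr dB * (real m ^ Suc q) powr dB)"
      using k(1) \<delta> dB_nonneg by (intro mult_left_mono mult_right_mono powr_mono2) (auto simp: field_simps)
    also have "\<dots> = C * (1 / \<delta>) powr dB" unfolding C_def by simp
    finally show "real (cover_number \<delta> X) \<le> C * (1 / \<delta>) powr dB" .
  qed
  ultimately have "((\<lambda>\<delta>. ln (real (cover_number \<delta> X)) / (- ln \<delta>)) \<longlongrightarrow> dB) (at_right 0)"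
    by (rule tendsto_power_law_exponent)
  then show ?thesis unfolding box_dim_def by (intro tendsto_Lim) auto
qed

section \<open>Assouad dimension\<close>

text \<open>Inside a given square of level \<open>k\<close>, a square of level \<open>k + j\<close>
  is determined by \<open>j\<close> further \<open>y\<close>-digits and by the
  \<open>x\<close>-digits from position \<open>lev k\<close> to \<open>lev (k + j)\<close>. The
  latter lie above \<open>y\<close>-digits that are already fixed, which leaves at most
  \<open>max_fib\<close> of the block length many choices.\<close>

lemma subsquare_count:
  assumes "T \<subseteq> adm (k + j)"
  shows "card (sq (k + j) ` T) \<le> card (sq k ` take k ` T) * (cnt yd j * max_fib (lev (k + j) - lev k))"
proof -
  define l l' where "l = lev k" and "l' = lev (k + j)"
  have ll': "l \<le> l'" "l' \<le> k + j" "l \<le> k" unfolding l_def l'_def using lev_mono lev_le by auto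
  define base where "base w = (sq k (take k w), map yd (drop k w))" for w :: "'e list"
  define mid where "mid w = take (l' - l) (drop l w)" for w :: "'e list"
  \<comment> \<open>The new block of \<open>x\<close>-digits may lie above \<open>y\<close>-digits
    of the large square, above new ones, or across both; hence the concatenation.\<close>
  define fibre where "fibre z = map xd ` {v \<in> adm (l' - l). map yd v = take (l' - l) (drop l (snd (fst z) @ snd z))}"
    for z :: "(nat list \<times> nat list) \<times> nat list"
  have finT: "finite T" by (rule finite_subset[OF assms finite_adm])
  have "card (sq (k + j) ` T) \<le> card ((\<lambda>w. (base w, map xd (mid w))) ` T)"
  proof (rule card_image_le_determined[OF finT])
    fix w w' assume w: "w \<in> T" "w' \<in> T" "(base w, map xd (mid w)) = (base w', map xd (mid w'))"
    have "map yd (take k w) @ map yd (drop k w) = map yd (take k w') @ map yd (drop k w')"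
      using w(3) unfolding base_def sq_def by simp
    then have y: "map yd w = map yd w'" unfolding map_append[symmetric] by simp
    have "take l (map xd (take k w)) @ map xd (mid w) = take l (map xd (take k w')) @ map xd (mid w')"
      using w(3) unfolding base_def sq_def l_def by simp
    moreover have "take l (map xd (take k w)) @ map xd (mid w) = take l' (map xd w)" for w
      using ll' take_add[of l "l' - l" "map xd w"] unfolding mid_def
      by (simp add: take_map drop_map min_def)
    ultimately show "sq (k + j) w = sq (k + j) w'" using y unfolding sq_def l'_def by simp
  qed
  also have "\<dots> \<le> card (Sigma ((sq k ` take k ` T) \<times> (map yd ` adm j)) fibre)"
  proof (rule card_mono)
    show "finite (Sigma ((sq k ` take k ` T) \<times> (map yd ` adm j)) fibre)"
      using finT by (intro finite_SigmaI) (auto simp: fibre_def)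
    show "(\<lambda>w. (base w, map xd (mid w))) ` T \<subseteq> Sigma ((sq k ` take k ` T) \<times> (map yd ` adm j)) fibre"
    proof
      fix z assume "z \<in> (\<lambda>w. (base w, map xd (mid w))) ` T"
      then obtain w where w: "w \<in> T" "z = (base w, map xd (mid w))" by blast
      then have wa: "w \<in> adm (k + j)" using assms by blast
      have "drop l w \<in> adm ((l' - l) + (k + j - l'))"
        using adm_take_drop(2)[of w l "(l' - l) + (k + j - l')"] wa ll' by simp
      then have "mid w \<in> adm (l' - l)" unfolding mid_def by (rule adm_take_drop)
      moreover have "map yd (mid w) = take (l' - l) (drop l (snd (fst (base w)) @ snd (base w)))"
        unfolding mid_def base_def sq_def by (simp add: take_map drop_map flip: map_append)
      ultimately have "map xd (mid w) \<in> fibre (base w)" unfolding fibre_def by blast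
      moreover have "base w \<in> (sq k ` take k ` T) \<times> (map yd ` adm j)"
        unfolding base_def using w(1) adm_take_drop(2)[OF wa] by blast
      ultimately show "z \<in> Sigma ((sq k ` take k ` T) \<times> (map yd ` adm j)) fibre" unfolding w(2) by blast
    qed
  qed
  also have "\<dots> = (\<Sum>z\<in>(sq k ` take k ` T) \<times> (map yd ` adm j). card (fibre z))"
    using finT by (intro card_SigmaI) (auto simp: fibre_def)
  also have "\<dots> \<le> (\<Sum>z\<in>(sq k ` take k ` T) \<times> (map yd ` adm j). max_fib (l' - l))"
  proof (rule sum_mono)
    fix z assume "z \<in> (sq k ` take k ` T) \<times> (map yd ` adm j)"
    then have "length (snd (fst z)) = k" "length (snd z) = j"
      using assms adm_length by (fastforce simp: sq_def)+
    then have len: "length (take (l' - l) (drop l (snd (fst z) @ snd z))) = l' - l" using ll' by simp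
    then have "card (fibre z) = fib (take (l' - l) (drop l (snd (fst z) @ snd z)))"
      by (simp only: fibre_def fib_def len)
    then show "card (fibre z) \<le> max_fib (l' - l)" using fib_le_max_fib[OF len] by simp
  qed
  also have "\<dots> = card (sq k ` take k ` T) * (cnt yd j * max_fib (l' - l))"
    by (simp add: card_cartesian_product cnt_def)
  finally show ?thesis unfolding l_def l'_def .
qed

lemma dA_ln_m: "dA * ln (real m) = hy + \<alpha> * hF"
  unfolding dA_def using ln_m_pos by simp

lemma lev_diff: "real (lev (k + j) - lev k) \<le> \<alpha> * real j + 1" "\<alpha> * real j \<le> real (lev (k + j) - lev k) + 1"
proof -
  have "real (lev (k + j) - lev k) = real (lev (k + j)) - real (lev k)"
    using lev_mono[of k "k + j"] by (simp add: of_nat_diff)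
  then show "real (lev (k + j) - lev k) \<le> \<alpha> * real j + 1" "\<alpha> * real j \<le> real (lev (k + j) - lev k) + 1"
    using lev_bounds[of k] lev_bounds[of "k + j"] by (simp_all add: algebra_simps)
qed

lemma subsquare_growth:
  "real (cnt yd j * max_fib (lev (k + j) - lev k)) \<le> (real CC)\<^sup>2 * exp hF * (real m ^ j) powr dA"
proof -
  define q where "q = lev (k + j) - lev k"
  have "real (cnt yd j * max_fib q) \<le> (real CC * exp (real j * hy)) * (real CC * exp (real q * hF))"
    unfolding of_nat_mult by (intro mult_mono hy_growth(3) hF_growth(3)) auto
  also have "\<dots> = (real CC)\<^sup>2 * exp (real j * hy + real q * hF)"
    by (simp add: exp_add power2_eq_square)
  also have "\<dots> \<le> (real CC)\<^sup>2 * exp (hF + real j * (dA * ln (real m)))"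
  proof -
    have "real q * hF \<le> (\<alpha> * real j + 1) * hF"
      unfolding q_def by (intro mult_right_mono lev_diff hF_growth(1))
    then have "real j * hy + real q * hF \<le> hF + real j * (dA * ln (real m))"
      unfolding dA_ln_m by (simp add: algebra_simps)
    then show ?thesis by (intro mult_left_mono) auto
  qed
  finally show ?thesis unfolding q_def m_power_powr by (simp add: exp_add)
qed

text \<open>Two points of the ball are at most \<open>2 * R\<close> apart, so
  \<open>grid_count\<close> with \<open>J = 2\<close> gives 16 at the level matching
  \<open>R\<close>. For \<open>R > 1\<close> level \<open>0\<close> is taken, which has a single
  square.\<close>

lemma squares_near_point:
  assumes "0 < R"
  obtains k where "card (sq k ` {w \<in> adm k. \<exists>p\<in>cball x R \<inter> X. in_cell n (fst p) (map xd w) \<and> in_cell m (snd p) (map yd w)}) \<le> 16"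
    "1 \<le> R * real m ^ Suc k"
proof (cases "R \<le> 1")
  case True
  obtain k where k: "R * real m ^ k \<le> 1" "1 < R * real m ^ Suc k" using level_of_scale[OF assms True] .
  let ?A = "{w \<in> adm k. \<exists>p\<in>cball x R \<inter> X. in_cell n (fst p) (map xd w) \<and> in_cell m (snd p) (map yd w)}"
  define p where "p w = (SOME p. p \<in> cball x R \<inter> X \<and> in_cell n (fst p) (map xd w) \<and> in_cell m (snd p) (map yd w))" for w
  have p: "p w \<in> cball x R \<inter> X \<and> in_cell n (fst (p w)) (map xd w) \<and> in_cell m (snd (p w)) (map yd w)"
    if "w \<in> ?A" for w
    unfolding p_def by (rule someI_ex) (use that in blast)
  have "card ((\<lambda>w. (take (lev k) (map xd w), map yd w)) ` ?A) \<le> (2 + 2)\<^sup>2"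
  proof (rule grid_count[where p = p and n = n and m = m and l = "lev k" and k = k and r = "2 * R"])
    fix w assume w: "w \<in> ?A"
    then have wa: "w \<in> adm k" by blast
    have "lev k \<le> length w" using adm_length[OF wa] lev_le by simp
    moreover have "\<forall>d\<in>set (take (lev k) (map xd w)). d < n"
      using adm_digits(1)[OF wa] set_take_subset[of "lev k" "map xd w"] by blast
    ultimately show "in_cell n (fst (p w)) (take (lev k) (map xd w)) \<and> length (take (lev k) (map xd w)) = lev k
        \<and> (\<forall>d\<in>set (take (lev k) (map xd w)). d < n)"
      using in_cell_take[OF conjunct1[OF conjunct2[OF p[OF w]]] adm_digits(1)[OF wa] n_pos] by simp
    show "in_cell m (snd (p w)) (map yd w) \<and> length (map yd w) = k \<and> (\<forall>d\<in>set (map yd w). d < m)"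
      using p[OF w] adm_digits(2)[OF wa] adm_length[OF wa] by simp
  next
    fix w w' assume "w \<in> ?A" "w' \<in> ?A"
    then have "dist x (p w) \<le> R" "dist x (p w') \<le> R" using p by auto
    then show "dist (p w) (p w') \<le> 2 * R" using dist_triangle3[of "p w" "p w'" x] by linarith
  next
    have "R * real n ^ lev k \<le> R * real m ^ k" using n_power_lev(1) assms by (intro mult_left_mono) auto
    then show "2 * R * real n ^ lev k \<le> real 2" using k(1) by simp
  qed (use k in auto)
  then have "card (sq k ` ?A) \<le> 16" unfolding sq_def[abs_def] by simp
  with k(2) that show thesis by auto
next
  case False
  let ?A = "{w \<in> adm 0. \<exists>p\<in>cball x R \<inter> X. in_cell n (fst p) (map xd w) \<and> in_cell m (snd p) (map yd w)}"
  have "sq 0 ` ?A \<subseteq> {sq 0 []}" by (auto simp: adm_words_def)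
  then have "card (sq 0 ` ?A) \<le> card {sq 0 []}" by (intro card_mono) auto
  moreover have "1 \<le> R * real m ^ Suc 0"
    using mult_mono[of 1 R 1 "real m"] False m_ge_2 by simp
  ultimately show thesis using that[of 0] by simp
qed

lemma assouad_upper:
  assumes r: "0 < r" "r < R"
  shows "real (cover_number r (cball x R \<inter> X))
    \<le> 16 * (real CC)\<^sup>2 * exp hF * ((real m)\<^sup>2 * (real n + 1)) powr dA * (R / r) powr dA"
proof -
  have "0 < R" using r by simp
  then obtain k where k: "card (sq k ` {w \<in> adm k. \<exists>p\<in>cball x R \<inter> X. in_cell n (fst p) (map xd w) \<and> in_cell m (snd p) (map yd w)}) \<le> 16"
    "1 \<le> R * real m ^ Suc k" using squares_near_point by blast
  let ?A = "\<lambda>k. {w \<in> adm k. \<exists>p\<in>cball x R \<inter> X. in_cell n (fst p) (map xd w) \<and> in_cell m (snd p) (map yd w)}"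
  \<comment> \<open>\<open>P j\<close> says that the diameter bound for squares of level
    \<open>k + j\<close> is at most \<open>r\<close>; minimality of \<open>j\<close> bounds
    \<open>m ^ j\<close> from above by a multiple of \<open>R / r\<close>.\<close>
  define P where "P j \<longleftrightarrow> real n + 1 \<le> r * real m ^ (k + j)" for j
  have "\<exists>j. P j"
  proof -
    have "0 < r * real m ^ k" using r m_pos by simp
    then obtain j where "(real n + 1) / real m ^ j \<le> r * real m ^ k" using exists_small_level by blast
    then have "P j" unfolding P_def power_add using m_pos by (simp add: field_simps)
    then show ?thesis by blast
  qed
  define j where "j = (LEAST j. P j)"
  have Pj: "P j" and less: "\<And>i. i < j \<Longrightarrow> \<not> P i"
    unfolding j_def using LeastI_ex[OF \<open>\<exists>j. P j\<close>] not_less_Least by blast+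
  have mj: "real m ^ j \<le> (real m)\<^sup>2 * (real n + 1) * (R / r)"
  proof (cases j)
    case 0
    have "1 \<le> (real m)\<^sup>2 * (real n + 1)"
      using mult_mono[of 1 "(real m)\<^sup>2" 1 "real n + 1"] m_ge_2 by simp
    moreover have "1 \<le> R / r" using r by simp
    ultimately show ?thesis using mult_mono[of 1 "(real m)\<^sup>2 * (real n + 1)" 1 "R / r"] 0 by simp
  next
    case (Suc i)
    have "r * real m ^ (k + i) < real n + 1" using less[of i] Suc unfolding P_def by simp
    moreover have "r * real m ^ i \<le> (r * real m ^ i) * (R * real m ^ Suc k)"
      using mult_left_mono[OF k(2), of "r * real m ^ i"] r by simp
    moreover have "(r * real m ^ i) * (R * real m ^ Suc k) = R * real m * (r * real m ^ (k + i))"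
      by (simp add: power_add)
    moreover have "R * real m * (r * real m ^ (k + i)) \<le> R * real m * (real n + 1)"
      using calculation(1) \<open>0 < R\<close> by (intro mult_left_mono) auto
    ultimately have "r * real m ^ i \<le> R * real m * (real n + 1)" by linarith
    then have "real m * (r * real m ^ i) \<le> real m * (R * real m * (real n + 1))" by (rule mult_left_mono) simp
    then have "r * real m ^ j \<le> (real m)\<^sup>2 * (real n + 1) * R"
      unfolding Suc by (simp add: power2_eq_square ac_simps)
    then show ?thesis using r by (simp add: field_simps)
  qed
  have "cover_number r (cball x R \<inter> X) \<le> card (sq (k + j) ` ?A (k + j))"
  proof (rule cover_number_le_sq)
    show "(real n + 1) / real m ^ (k + j) \<le> r" using Pj m_pos unfolding P_def by (simp add: field_simps)
  qed auto
  also have "\<dots> \<le> card (sq k ` take k ` ?A (k + j)) * (cnt yd j * max_fib (lev (k + j) - lev k))"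
    by (rule subsquare_count) blast
  also have "\<dots> \<le> 16 * (cnt yd j * max_fib (lev (k + j) - lev k))"
  proof (rule mult_right_mono)
    have "take k ` ?A (k + j) \<subseteq> ?A k"
    proof
      fix v assume "v \<in> take k ` ?A (k + j)"
      then obtain w p where w: "w \<in> adm (k + j)" "v = take k w" "p \<in> cball x R \<inter> X"
        "in_cell n (fst p) (map xd w)" "in_cell m (snd p) (map yd w)" by blast
      have "in_cell n (fst p) (map xd v)" "in_cell m (snd p) (map yd v)"
        using in_cell_take[OF w(4) adm_digits(1)[OF w(1)] n_pos, of k]
          in_cell_take[OF w(5) adm_digits(2)[OF w(1)] m_pos, of k] unfolding w(2) by (simp_all add: take_map)
      with w adm_take_drop(1)[OF w(1)] show "v \<in> ?A k" by blast
    qed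
    then have "card (sq k ` take k ` ?A (k + j)) \<le> card (sq k ` ?A k)"
      by (intro card_mono image_mono) auto
    with k(1) show "card (sq k ` take k ` ?A (k + j)) \<le> 16" by simp
  qed simp
  finally have "real (cover_number r (cball x R \<inter> X)) \<le> 16 * real (cnt yd j * max_fib (lev (k + j) - lev k))"
    by linarith
  also have "\<dots> \<le> 16 * ((real CC)\<^sup>2 * exp hF * (real m ^ j) powr dA)"
    by (intro mult_left_mono subsquare_growth) simp
  also have "\<dots> \<le> 16 * ((real CC)\<^sup>2 * exp hF * ((real m)\<^sup>2 * (real n + 1) * (R / r)) powr dA)"
    by (intro mult_left_mono powr_mono2 dA_nonneg mj) auto
  also have "((real m)\<^sup>2 * (real n + 1) * (R / r)) powr dA = ((real m)\<^sup>2 * (real n + 1)) powr dA * (R / r) powr dA"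
    using r by (intro powr_mult)
  finally show ?thesis by (simp add: mult.assoc)
qed

text \<open>Lower bound: inside one approximate square with prescribed \<open>y\<close>-digits there are about
  \<open>max_fib q\<close> columns of width \<open>n\<^sup>-\<^sup>q\<close> relative to the square, and above each of them all
  admissible \<open>y\<close>-words of length about \<open>q / \<alpha>\<close> occur.\<close>

lemma assouad_packing:
  assumes "1 \<le> q"
  obtains r R x j where "0 < r" "r < R" "x \<in> X" "R / r = (real n + 1) * real m ^ j"
    "q \<le> j" "real j \<le> real q / \<alpha> + 1" "real q \<le> \<alpha> * real j"
    "real (max_fib q) * real (cnt yd j) \<le> 9 * (real CC)\<^sup>2 * real (cover_number r (cball x R \<inter> X))"
proof -
  obtain u where u: "u \<in> map yd ` adm q" "fib u = max_fib q" "length u = q" using max_fib_attained[of q] .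
  define P0 where "P0 = {w \<in> adm q. map yd w = u}"
  obtain v v' where v: "v \<in> V" "v' \<in> V"
    "card (map pair ` P0) \<le> (card V)\<^sup>2 * card (map pair ` {w \<in> P0. walk v w v'})"
    using two_ended[of P0 q pair] unfolding P0_def by blast
  define A where "A = {w \<in> P0. walk v w v'}"
  have A: "max_fib q \<le> (card V)\<^sup>2 * card (map pair ` A)"
    using v(3) u(2,3) unfolding A_def fib_pair P0_def by simp
  \<comment> \<open>The least \<open>k\<close> with \<open>q \<le> (1 - \<alpha>) * k\<close>. It
    ensures \<open>lev k + q \<le> k\<close>: the \<open>y\<close>-digits under the \<open>q\<close>
    new \<open>x\<close>-digits already belong to the large square.\<close>
  define k where "k = nat \<lceil>real q / (1 - \<alpha>)\<rceil>"
  define l where "l = lev k"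
  \<comment> \<open>The least \<open>j\<close> with \<open>q \<le> \<alpha> * j\<close>, so that
    squares of level \<open>k + j\<close> still show the \<open>x\<close>-digits up to position
    \<open>l + q\<close>.\<close>
  define j where "j = nat \<lceil>real q / \<alpha>\<rceil>"
  have lq: "l + q \<le> k"
  proof -
    have "real q / (1 - \<alpha>) \<le> real k" unfolding k_def by linarith
    then have "real q \<le> (1 - \<alpha>) * real k" using \<alpha>_bounds by (simp add: field_simps)
    then have "real l + real q \<le> real k" using lev_bounds(1)[of k] unfolding l_def by (simp add: algebra_simps)
    then show ?thesis by linarith
  qed
  have j: "real q \<le> \<alpha> * real j" "real j \<le> real q / \<alpha> + 1" "q \<le> j"
  proof -
    have "real q / \<alpha> \<le> real j" unfolding j_def by linarith
    then show a: "real q \<le> \<alpha> * real j" using \<alpha>_bounds by (simp add: field_simps)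
    have "0 \<le> real q / \<alpha>" using \<alpha>_bounds by simp
    then show "real j \<le> real q / \<alpha> + 1" unfolding j_def by linarith
    have "\<alpha> * real j \<le> 1 * real j" using \<alpha>_bounds by (intro mult_right_mono) auto
    then show "q \<le> j" using a by simp
  qed
  have lj: "l + q \<le> lev (k + j)"
  proof -
    have "real (l + q) < real (lev (k + j)) + 1"
      using lev_bounds(1)[of k] lev_bounds(2)[of "k + j"] j(1) unfolding l_def by (simp add: algebra_simps)
    then show ?thesis by linarith
  qed
  \<comment> \<open>Padding moves the fibre words to the positions from \<open>l\<close> to
    \<open>l + q\<close> of words of length \<open>k\<close>. Both padding words are fixed, so only
    the digits of the fibre vary.\<close>
  obtain p0 v0 where p0: "walk v0 p0 v" "length p0 = l" "v0 \<in> V" using walk_backward[OF v(1)] .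
  obtain p1 v1 where p1: "walk v' p1 v1" "length p1 = k - l - q" "v1 \<in> V" using walk_forward[OF v(2)] .
  define P where "P = (\<lambda>w. p0 @ w @ p1) ` A"
  have lenA: "length w = q" "map yd w = u" "walk v w v'" if "w \<in> A" for w
    using that adm_length unfolding A_def P0_def by auto
  have P_adm: "P \<subseteq> adm k"
  proof
    fix z assume "z \<in> P"
    then obtain w where w: "w \<in> A" "z = p0 @ w @ p1" unfolding P_def by blast
    have "walk v0 z v1" unfolding w(2) using p0 p1 lenA(3)[OF w(1)] by (auto simp: walk_append)
    moreover have "length z = k" using w p0 p1 lenA(1)[OF w(1)] lq by simp
    ultimately show "z \<in> adm k" using p0(3) by (intro admI)
  qed
  have "card (map pair ` P) = card ((\<lambda>s. map pair p0 @ s @ map pair p1) ` map pair ` A)"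
    unfolding P_def image_image by simp
  also have "\<dots> = card (map pair ` A)" by (intro card_image) (auto simp: inj_on_def)
  finally have cP: "card (map pair ` P) = card (map pair ` A)" .
  define T where "T = {w \<in> adm (k + j). take k w \<in> P}"
  have T_adm: "T \<subseteq> adm (k + j)" unfolding T_def by blast
  have T: "\<exists>a b. a \<in> A \<and> w = p0 @ a @ p1 @ b" if wT: "w \<in> T" for w
  proof -
    obtain a where "a \<in> A" "take k w = p0 @ a @ p1" using wT unfolding T_def P_def by blast
    then show ?thesis using append_take_drop_id[of k w] by (metis append.assoc)
  qed
  define y0 where "y0 = map yd p0 @ u @ map yd p1"
  have len_y0: "length y0 = k" unfolding y0_def using p0 p1 u lq by simp
  have prefix: "map xd w = map xd p0 @ drop l (map xd w)" "map yd w = y0 @ drop k (map yd w)" if wT: "w \<in> T" for w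
  proof -
    obtain a b where ab: "a \<in> A" "w = p0 @ a @ p1 @ b" using T[OF wT] by blast
    have "length (p0 @ a @ p1) = k" using p0 p1 lenA(1)[OF ab(1)] lq by simp
    then have b: "drop k w = b" unfolding ab(2) using drop_append[of k "p0 @ a @ p1" b] by simp
    show "map yd w = y0 @ drop k (map yd w)"
      unfolding y0_def drop_map b using lenA(2)[OF ab(1)] by (simp add: ab(2))
    show "map xd w = map xd p0 @ drop l (map xd w)" unfolding ab(2) using p0(2) by simp
  qed
  define r R where "r = 1 / real m ^ (k + j)" and "R = (real n + 1) / real m ^ k"
  have "0 < r" unfolding r_def using m_pos by simp
  have Rr: "R / r = (real n + 1) * real m ^ j" unfolding R_def r_def using m_pos by (simp add: power_add)
  have "r < R"
  proof -
    have "1 < (real n + 1) * real m ^ j"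
    proof -
      have "1 \<le> real m ^ j" using m_ge_2 by simp
      then have "(real n + 1) * 1 \<le> (real n + 1) * real m ^ j" by (intro mult_left_mono) auto
      moreover have "1 < (real n + 1) * 1" using n_pos by simp
      ultimately show ?thesis by linarith
    qed
    then show ?thesis using \<open>0 < r\<close> unfolding Rr[symmetric] by (simp add: field_simps)
  qed
  have ext: "card (map pair ` P) * cnt yd j \<le> CC * card (sq (k + j) ` T)"
  proof -
    have "card (map pair ` P) * cnt yd j \<le> card V * card E ^ gap * card ((\<lambda>w. (map pair (take k w), map yd (drop k w))) ` T)"
      unfolding T_def by (rule extension_count[OF P_adm])
    also have "\<dots> \<le> CC * card (sq (k + j) ` T)"
    proof (intro mult_mono CC_ge card_image_le_determined)
      show "finite T" by (rule finite_subset[OF T_adm finite_adm])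
      fix w w' assume w: "w \<in> T" "w' \<in> T" "sq (k + j) w = sq (k + j) w'"
      obtain a b where ab: "a \<in> A" "w = p0 @ a @ p1 @ b" using T[OF w(1)] by blast
      obtain a' b' where ab': "a' \<in> A" "w' = p0 @ a' @ p1 @ b'" using T[OF w(2)] by blast
      have la: "length (p0 @ a @ p1) = k" "length (p0 @ a' @ p1) = k"
        using p0 p1 lenA(1)[OF ab(1)] lenA(1)[OF ab'(1)] lq by auto
      have tk: "take k w = p0 @ a @ p1" "take k w' = p0 @ a' @ p1"
        unfolding ab(2) ab'(2) using la take_append[of k "p0 @ a @ p1" b] take_append[of k "p0 @ a' @ p1" b'] by simp_all
      have "take (l + q) (take (lev (k + j)) (map xd w)) = take (l + q) (take (lev (k + j)) (map xd w'))"
        using w(3) unfolding sq_def by simp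
      then have "take (l + q) (map xd w) = take (l + q) (map xd w')" using lj by (simp add: min_absorb1)
      then have xa: "map xd a = map xd a'"
        unfolding ab(2) ab'(2) using p0(2) lenA(1)[OF ab(1)] lenA(1)[OF ab'(1)] by simp
      have "map yd a = map yd a'" using lenA(2)[OF ab(1)] lenA(2)[OF ab'(1)] by simp
      with xa have "map pair a = map pair a'" unfolding map_pair_eq_iff by blast
      then have 1: "map pair (take k w) = map pair (take k w')" unfolding tk by simp
      have "map yd w = map yd w'" using w(3) unfolding sq_def by simp
      then have "map yd (drop k w) = map yd (drop k w')" by (metis drop_map)
      with 1 show "(map pair (take k w), map yd (drop k w)) = (map pair (take k w'), map yd (drop k w'))" by simp
    qed auto
    finally show ?thesis .
  qed
  have "A \<noteq> {}" using A max_fib_ge_1[of q] by auto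
  then have "0 < card (map pair ` P)" unfolding cP using P_adm
    by (simp add: A_def P0_def card_gt_0_iff)
  then have "0 < card (map pair ` P) * cnt yd j" using cnt_ge_1[of yd j] by simp
  then have "0 < card (sq (k + j) ` T)" using ext by (cases "card (sq (k + j) ` T)") auto
  then have "T \<noteq> {}" by auto
  then obtain w0 where w0: "w0 \<in> T" by blast
  have cellT: "pt w \<in> cell n m (map xd p0) y0" if wT: "w \<in> T" for w
  proof -
    have wa: "w \<in> adm (k + j)" using wT T_adm by blast
    have "\<forall>d\<in>set (drop l (map xd w)). d < n" "\<forall>d\<in>set (drop k (map yd w)). d < m"
      using adm_digits[OF wa] set_drop_subset[of l "map xd w"] set_drop_subset[of k "map yd w"] by blast+
    then have "in_cell n (fst (pt w)) (map xd p0)" "in_cell m (snd (pt w)) y0"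
      using in_cell_append[of n "fst (pt w)" "map xd p0" "drop l (map xd w)"] pt(2)[OF wa] prefix(1)[OF wT] n_pos
        in_cell_append[of m "snd (pt w)" y0 "drop k (map yd w)"] pt(3)[OF wa] prefix(2)[OF wT] m_pos
      by (metis (no_types))+
    then show ?thesis unfolding cell_def by simp
  qed
  \<comment> \<open>All marked points lie in one closed cell of level \<open>k\<close>, and
    \<open>R\<close> is the bound for its diameter.\<close>
  have ball: "pt w \<in> cball (pt w0) R \<inter> X" if wT: "w \<in> T" for w
  proof -
    have "dist (pt w0) (pt w) \<le> 1 / real n ^ length (map xd p0) + 1 / real m ^ length y0"
      by (rule cell_dist[OF cellT[OF w0] cellT[OF wT] n_pos m_pos])
    also have "\<dots> \<le> R" using side_sum_le[of k] p0(2) len_y0 unfolding R_def l_def by simp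
    finally show ?thesis using pt(1)[of w "k + j"] wT T_adm by auto
  qed
  have "card (sq (k + j) ` T) \<le> 9 * cover_number r (cball (pt w0) R \<inter> X)"
    by (rule sq_packing) (use \<open>0 < r\<close> T_adm ball m_pos in \<open>auto simp: r_def\<close>)
  then have "CC * card (sq (k + j) ` T) \<le> CC * (9 * cover_number r (cball (pt w0) R \<inter> X))" by (rule mult_le_mono2)
  with ext have "card (map pair ` A) * cnt yd j \<le> CC * (9 * cover_number r (cball (pt w0) R \<inter> X))" unfolding cP by linarith
  then have "CC * (card (map pair ` A) * cnt yd j) \<le> CC * (CC * (9 * cover_number r (cball (pt w0) R \<inter> X)))" by (rule mult_le_mono2)
  moreover have "max_fib q * cnt yd j \<le> CC * card (map pair ` A) * cnt yd j"
    by (rule mult_right_mono[OF order_trans[OF A mult_right_mono[OF CC_ge(5)]]]) auto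
  ultimately have "max_fib q * cnt yd j \<le> CC * (CC * (9 * cover_number r (cball (pt w0) R \<inter> X)))"
    by (simp only: mult.assoc)
  then have "real (max_fib q * cnt yd j) \<le> real (CC * (CC * (9 * cover_number r (cball (pt w0) R \<inter> X))))"
    by (simp only: of_nat_le_iff)
  then have "real (max_fib q) * real (cnt yd j) \<le> 9 * (real CC)\<^sup>2 * real (cover_number r (cball (pt w0) R \<inter> X))"
    by (simp add: power2_eq_square)
  moreover have "pt w0 \<in> X" using pt(1) w0 T_adm by blast
  ultimately show thesis using that[OF \<open>0 < r\<close> \<open>r < R\<close> _ Rr j(3) j(2) j(1)] by blast
qed

text \<open>In \<open>assouad_packing\<close> the ratio \<open>R / r\<close> is comparable to
  \<open>m ^ j\<close> with \<open>j \<ge> q\<close>, and the covering number is at least of order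
  \<open>m ^ j\<close> to the power \<open>dA\<close>. As \<open>q\<close> is arbitrary, no constant
  \<open>C\<close> makes up for \<open>s < dA\<close>.\<close>

lemma assouad_lower:
  assumes "0 \<le> s" "0 < C"
    and bound: "\<And>r R x. 0 < r \<Longrightarrow> r < R \<Longrightarrow> x \<in> X \<Longrightarrow> real (cover_number r (cball x R \<inter> X)) \<le> C * (R / r) powr s"
  shows "dA \<le> s"
proof (rule ccontr)
  assume "\<not> dA \<le> s"
  then have gap_pos: "0 < (dA - s) * ln (real m)" using ln_m_pos by simp
  define B where "B = exp hF * (real CC)\<^sup>2 * (9 * (real CC)\<^sup>2 * (C * (real n + 1) powr s))"
  have "real q * ((dA - s) * ln (real m)) \<le> ln B" if q: "1 \<le> q" for q
  proof -
    obtain r R x j where *: "0 < r" "r < R" "x \<in> X" "R / r = (real n + 1) * real m ^ j"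
      "q \<le> j" "real j \<le> real q / \<alpha> + 1" "real q \<le> \<alpha> * real j"
      "real (max_fib q) * real (cnt yd j) \<le> 9 * (real CC)\<^sup>2 * real (cover_number r (cball x R \<inter> X))"
      using assouad_packing[OF q] by blast
    have "\<alpha> * real j \<le> real q + \<alpha>"
      using *(6) \<alpha>_bounds by (simp add: field_simps)
    then have aj: "\<alpha> * real j \<le> real q + 1" using \<alpha>_bounds by linarith
    have "exp (real j * (dA * ln (real m))) \<le> exp (hF + (real q * hF + real j * hy))"
      using mult_right_mono[OF aj hF_growth(1)] unfolding dA_ln_m by (simp add: algebra_simps)
    also have "\<dots> = exp hF * (exp (real q * hF) * exp (real j * hy))" by (simp add: exp_add)
    also have "\<dots> \<le> exp hF * ((real CC * real (max_fib q)) * (real CC * real (cnt yd j)))"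
      by (intro mult_left_mono mult_mono hF_growth(2) hy_growth(2)) auto
    also have "\<dots> = exp hF * (real CC)\<^sup>2 * (real (max_fib q) * real (cnt yd j))" by (simp add: power2_eq_square)
    also have "\<dots> \<le> exp hF * (real CC)\<^sup>2 * (9 * (real CC)\<^sup>2 * (C * (R / r) powr s))"
    proof (rule mult_left_mono)
      have "9 * (real CC)\<^sup>2 * real (cover_number r (cball x R \<inter> X)) \<le> 9 * (real CC)\<^sup>2 * (C * (R / r) powr s)"
        by (intro mult_left_mono bound *) auto
      with *(8) show "real (max_fib q) * real (cnt yd j) \<le> 9 * (real CC)\<^sup>2 * (C * (R / r) powr s)" by linarith
    qed simp
    also have "\<dots> = B * exp (real j * (s * ln (real m)))"
    proof -
      have "(R / r) powr s = (real n + 1) powr s * (real m ^ j) powr s"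
        unfolding *(4) by (rule powr_mult)
      then show ?thesis unfolding B_def m_power_powr by simp
    qed
    finally have "exp (real j * (dA * ln (real m))) \<le> B * exp (real j * (s * ln (real m)))" .
    then have "exp (real j * (dA * ln (real m))) / exp (real j * (s * ln (real m))) \<le> B"
      by (simp add: field_simps)
    then have e: "exp (real j * ((dA - s) * ln (real m))) \<le> B"
      unfolding exp_diff[symmetric] by (simp add: algebra_simps)
    have "real q * ((dA - s) * ln (real m)) \<le> real j * ((dA - s) * ln (real m))"
      using *(5) gap_pos by (intro mult_right_mono) auto
    then have "exp (real q * ((dA - s) * ln (real m))) \<le> B" using e by (smt (verit) exp_le_cancel_iff)
    moreover have "0 < B" using e by (smt (verit) exp_gt_zero)
    ultimately show ?thesis by (simp add: ln_ge_iff)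
  qed
  note bound' = this
  obtain q where "ln B / ((dA - s) * ln (real m)) < real q" using reals_Archimedean2 by blast
  then have "ln B < real q * ((dA - s) * ln (real m))" using gap_pos by (simp only: pos_divide_less_eq)
  also have "\<dots> \<le> real (Suc q) * ((dA - s) * ln (real m))" using gap_pos by (intro mult_right_mono) auto
  also have "\<dots> \<le> ln B" by (rule bound') simp
  finally show False by simp
qed

theorem assouad_dim_X: "assouad_dim X = dA"
proof -
  let ?S = "{s. 0 \<le> s \<and> (\<exists>C>0. \<forall>r R x. 0 < r \<longrightarrow> r < R \<longrightarrow> x \<in> X \<longrightarrow>
        real (cover_number r (cball x R \<inter> X)) \<le> C * (R / r) powr s)}"
  define C where "C = 16 * (real CC)\<^sup>2 * exp hF * ((real m)\<^sup>2 * (real n + 1)) powr dA"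
  have "0 < C" unfolding C_def using CC_real m_pos n_pos by simp
  then have "dA \<in> ?S" using dA_nonneg assouad_upper unfolding C_def by blast
  moreover have "dA \<le> s" if "s \<in> ?S" for s using assouad_lower that by blast
  ultimately show ?thesis unfolding assouad_dim_def by (intro cInf_eq_minimum) auto
qed

section \<open>Hausdorff dimension: the bound of McMullen\<close>

definition fib_pressure :: "nat \<Rightarrow> real" where
  "fib_pressure L = (\<Sum>u\<in>map yd ` adm L. real (fib u) powr \<alpha>)"

lemma fib_Y_ge_1: "u \<in> map yd ` adm L \<Longrightarrow> 1 \<le> real (fib u)"
  using fib_ge_1 by fastforce

lemma fib_pressure_ge_1: "1 \<le> fib_pressure L"
proof -
  obtain w where w: "w \<in> adm L" using adm_nonempty by blast
  have "1 \<le> real (fib (map yd w)) powr \<alpha>"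
    using fib_Y_ge_1[of "map yd w" L] w \<alpha>_bounds by (intro ge_one_powr_ge_zero) auto
  also have "\<dots> \<le> fib_pressure L"
    unfolding fib_pressure_def by (rule member_le_sum) (use w in auto)
  finally show ?thesis .
qed

text \<open>Since \<open>\<alpha> < 1\<close>, rounding \<open>k / \<alpha>\<close> up overshoots by
  less than one after multiplication by \<open>\<alpha>\<close>. So \<open>lev\<close> takes every
  positive value, and levels can be chained upwards.\<close>

lemma lev_chain:
  assumes "1 \<le> k"
  obtains k' where "lev k' = k" "k \<le> k'" "1 \<le> k'"
proof -
  define k' where "k' = nat \<lceil>real k / \<alpha>\<rceil>"
  have "0 \<le> real k / \<alpha>" using \<alpha>_bounds by simp
  then have "real k / \<alpha> \<le> real k'" "real k' < real k / \<alpha> + 1" unfolding k'_def by linarith+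
  then have *: "real k \<le> \<alpha> * real k'" "\<alpha> * real k' < real k + \<alpha>"
    using \<alpha>_bounds by (simp_all add: field_simps)
  then have "lev k' = k" using lev_bounds[of k'] \<alpha>_bounds by linarith
  moreover have "k \<le> k'" using lev_le[of k'] calculation by simp
  ultimately show thesis using that assms by auto
qed

text \<open>McMullen's averaging argument: along a chain of levels with \<open>lev (\<kappa> (j + 1)) = \<kappa> j\<close>
  the averages \<open>S k / k\<close> cannot keep decreasing by a fixed amount.\<close>

lemma averaging:
  fixes S :: "nat \<Rightarrow> real"
  assumes "\<And>j. lev (\<kappa> (Suc j)) = \<kappa> j" "\<And>j. 1 \<le> \<kappa> j" "\<And>k. 0 \<le> S k" "S (\<kappa> 0) \<le> B * real (\<kappa> 0)"
    and "B < real J * (\<epsilon> / \<alpha>)"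
  shows "\<exists>j<J. - (\<epsilon> * real (\<kappa> (Suc j))) \<le> \<alpha> * S (\<kappa> (Suc j)) - S (\<kappa> j)"
proof (rule ccontr)
  assume "\<not> ?thesis"
  then have neg: "\<alpha> * S (\<kappa> (Suc j)) - S (\<kappa> j) < - (\<epsilon> * real (\<kappa> (Suc j)))" if "j < J" for j
    using that by (auto simp: not_le)
  \<comment> \<open>If every step failed, each passage from \<open>\<kappa> j\<close> to
    \<open>\<kappa> (Suc j)\<close> would lower the average by at least
    \<open>\<epsilon> / \<alpha>\<close>, because
    \<open>\<kappa> j \<le> \<alpha> * \<kappa> (Suc j)\<close>; after \<open>J\<close> steps it
    would be negative.\<close>
  have "j \<le> J \<Longrightarrow> S (\<kappa> j) / real (\<kappa> j) \<le> B - real j * (\<epsilon> / \<alpha>)" for j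
  proof (induction j)
    case 0
    have "0 < real (\<kappa> 0)" using assms(2)[of 0] by linarith
    then show ?case using assms(4) by (simp add: pos_divide_le_eq)
  next
    case (Suc j)
    define k k' where "k = real (\<kappa> j)" and "k' = real (\<kappa> (Suc j))"
    have pos: "0 < k" "0 < k'" using assms(2)[of j] assms(2)[of "Suc j"] unfolding k_def k'_def by linarith+
    have kk': "k \<le> \<alpha> * k'" using lev_bounds(1)[of "\<kappa> (Suc j)"] unfolding assms(1) k_def k'_def .
    have "S (\<kappa> (Suc j)) / k' \<le> S (\<kappa> j) / (\<alpha> * k') - \<epsilon> / \<alpha>"
    proof -
      have "\<alpha> * S (\<kappa> (Suc j)) \<le> S (\<kappa> j) - \<epsilon> * k'" using neg[of j] Suc.prems unfolding k'_def by linarith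
      then have "\<alpha> * S (\<kappa> (Suc j)) / (\<alpha> * k') \<le> (S (\<kappa> j) - \<epsilon> * k') / (\<alpha> * k')"
        using pos \<alpha>_bounds by (intro divide_right_mono) auto
      moreover have "\<alpha> * S (\<kappa> (Suc j)) / (\<alpha> * k') = S (\<kappa> (Suc j)) / k'" using \<alpha>_bounds by simp
      moreover have "(S (\<kappa> j) - \<epsilon> * k') / (\<alpha> * k') = S (\<kappa> j) / (\<alpha> * k') - \<epsilon> / \<alpha>"
        using pos \<alpha>_bounds by (simp add: diff_divide_distrib)
      ultimately show ?thesis by simp
    qed
    also have "S (\<kappa> j) / (\<alpha> * k') \<le> S (\<kappa> j) / k"
      using kk' pos assms(3)[of "\<kappa> j"] \<alpha>_bounds by (intro divide_left_mono mult_pos_pos) auto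
    also have "S (\<kappa> j) / k \<le> B - real j * (\<epsilon> / \<alpha>)" using Suc unfolding k_def by simp
    finally have "S (\<kappa> (Suc j)) / k' \<le> B - real j * (\<epsilon> / \<alpha>) - \<epsilon> / \<alpha>" by simp
    moreover have "real (Suc j) * (\<epsilon> / \<alpha>) = real j * (\<epsilon> / \<alpha>) + \<epsilon> / \<alpha>" by (simp add: distrib_right add_divide_distrib)
    ultimately show ?case unfolding k'_def by linarith
  qed
  from this[of J] have "S (\<kappa> J) / real (\<kappa> J) < 0" using assms(5) by simp
  moreover have "0 \<le> S (\<kappa> J) / real (\<kappa> J)" using assms(3) by simp
  ultimately show False by linarith
qed

section \<open>Block codes of approximate squares and a product measure on them\<close>

definition digit_blocks :: "nat \<Rightarrow> nat \<Rightarrow> nat \<Rightarrow> (nat list \<times> nat list) set" where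
  "digit_blocks L k j = (\<lambda>w. (if j < lev k then map xd w else [], map yd w)) ` adm L"

lemma finite_digit_blocks: "finite (digit_blocks L k j)"
  unfolding digit_blocks_def by simp

text \<open>The weights of McMullen's Bernoulli measure on a code of an approximate square: the first
  \<open>lev k\<close> blocks record both digits, the remaining ones (with empty \<open>x\<close>-word) only \<open>y\<close>.\<close>

definition block_weight :: "nat \<Rightarrow> nat \<Rightarrow> nat \<Rightarrow> nat list \<times> nat list \<Rightarrow> real" where
  "block_weight L k j z = real (fib (snd z)) powr (if j < lev k then \<alpha> - 1 else \<alpha>) / fib_pressure L"

text \<open>Above a \<open>y\<close>-word \<open>u\<close> there are either \<open>fib u\<close>
  blocks with exponent \<open>\<alpha> - 1\<close> or a single block with exponent
  \<open>\<alpha>\<close>. Either way they add up to the summand of \<open>fib_pressure\<close> for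
  \<open>u\<close>.\<close>

lemma sum_block_weight: "(\<Sum>z\<in>digit_blocks L k j. block_weight L k j z) = 1"
proof -
  define D where "D = digit_blocks L k j"
  define h where "h u = real (fib u) powr (if j < lev k then \<alpha> - 1 else \<alpha>)" for u
  have fin: "finite D" unfolding D_def digit_blocks_def by simp
  have sndD: "snd ` D = map yd ` adm L" unfolding D_def digit_blocks_def by force
  have "(\<Sum>z\<in>D. h (snd z)) = (\<Sum>u\<in>snd ` D. \<Sum>z\<in>{z. z \<in> D \<and> snd z = u}. h (snd z))"
    by (rule sum.image_gen[OF fin])
  also have "\<dots> = (\<Sum>u\<in>map yd ` adm L. real (fib u) powr \<alpha>)"
    unfolding sndD
  proof (rule sum.cong[OF refl])
    fix u assume u: "u \<in> map yd ` adm L"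
    have lu: "length u = L" using u by (auto dest: adm_length)
    have "(\<Sum>z\<in>{z. z \<in> D \<and> snd z = u}. h (snd z)) = (\<Sum>z\<in>{z. z \<in> D \<and> snd z = u}. h u)"
      by (intro sum.cong) auto
    also have "\<dots> = real (card {z. z \<in> D \<and> snd z = u}) * h u" by simp
    also have "\<dots> = real (fib u) powr \<alpha>"
    proof (cases "j < lev k")
      case True
      have "{z. z \<in> D \<and> snd z = u} = (\<lambda>s. (s, u)) ` map xd ` {w \<in> adm (length u). map yd w = u}"
        unfolding D_def digit_blocks_def lu using True by auto
      then have "card {z. z \<in> D \<and> snd z = u} = fib u"
        unfolding fib_def by (simp add: card_image inj_on_def)
      moreover have "0 < real (fib u)" using fib_Y_ge_1[OF u] by linarith
      ultimately show ?thesis unfolding h_def using True by (simp add: powr_diff)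
    next
      case False
      have "{z. z \<in> D \<and> snd z = u} = {([], u)}"
        unfolding D_def digit_blocks_def using False u by auto
      then show ?thesis unfolding h_def using False by simp
    qed
    finally show "(\<Sum>z\<in>{z. z \<in> D \<and> snd z = u}. h (snd z)) = real (fib u) powr \<alpha>" .
  qed
  finally have "(\<Sum>z\<in>D. h (snd z)) = fib_pressure L" unfolding fib_pressure_def .
  then show ?thesis
    unfolding block_weight_def h_def D_def sum_divide_distrib[symmetric] using fib_pressure_ge_1[of L] by simp
qed

definition block_codes :: "nat \<Rightarrow> nat \<Rightarrow> (nat \<Rightarrow> nat list \<times> nat list) set" where
  "block_codes L k = PiE {..<k} (digit_blocks L k)"

definition code_weight :: "nat \<Rightarrow> nat \<Rightarrow> (nat \<Rightarrow> nat list \<times> nat list) \<Rightarrow> real" where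
  "code_weight L k g = (\<Prod>j<k. block_weight L k j (g j))"

definition code_cell :: "nat \<Rightarrow> (nat \<Rightarrow> nat list \<times> nat list) \<Rightarrow> (real \<times> real) set" where
  "code_cell k g = cell n m (concat (map (\<lambda>j. fst (g j)) [0..<k])) (concat (map (\<lambda>j. snd (g j)) [0..<k]))"

lemma finite_block_codes: "finite (block_codes L k)"
  unfolding block_codes_def by (intro finite_PiE) (auto simp: digit_blocks_def)

lemma sum_code_weight: "(\<Sum>g\<in>block_codes L k. code_weight L k g) = 1"
  unfolding block_codes_def code_weight_def
  by (subst prod_sum_PiE[symmetric]) (simp_all add: sum_block_weight finite_digit_blocks)

lemma code_weight_nonneg: "0 \<le> code_weight L k g"
  unfolding code_weight_def block_weight_def using fib_pressure_ge_1[of L]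
  by (intro prod_nonneg) auto

text \<open>Markov's inequality for a measure of total mass one.\<close>

lemma card_heavy_codes:
  assumes "0 < a"
  shows "real (card {g \<in> block_codes L k. a \<le> code_weight L k g}) \<le> 1 / a"
proof -
  have "real (card {g \<in> block_codes L k. a \<le> code_weight L k g}) * a
      = (\<Sum>g\<in>{g \<in> block_codes L k. a \<le> code_weight L k g}. a)" by simp
  also have "\<dots> \<le> (\<Sum>g\<in>{g \<in> block_codes L k. a \<le> code_weight L k g}. code_weight L k g)"
    by (intro sum_mono) auto
  also have "\<dots> \<le> (\<Sum>g\<in>block_codes L k. code_weight L k g)"
    by (intro sum_mono2 finite_block_codes code_weight_nonneg) auto
  finally show ?thesis using assms unfolding sum_code_weight by (simp add: field_simps)
qed

text \<open>The rounding in \<open>lev\<close> now concerns whole blocks of length \<open>L\<close>,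
  so the two side lengths agree only up to the factor \<open>n ^ L\<close>.\<close>

lemma code_cell_small:
  assumes "g \<in> block_codes L k"
  shows "bounded (code_cell k g)" "diameter (code_cell k g) \<le> (real n ^ L + 1) / real m ^ (k * L)"
proof -
  have g: "g j \<in> digit_blocks L k j" if "j < k" for j
    using assms that unfolding block_codes_def by auto
  have ly: "length (concat (map (\<lambda>j. snd (g j)) [0..<k])) = k * L"
    by (rule length_concat_const) (use g in \<open>fastforce simp: digit_blocks_def adm_words_def\<close>)
  have "[0..<k] = [0..<lev k] @ [lev k..<k]" using lev_le[of k] upt_add_eq_append[of 0 "lev k" "k - lev k"] by simp
  moreover have "length (concat (map (\<lambda>j. fst (g j)) [0..<lev k])) = lev k * L"
  proof (rule length_concat_const)
    fix j assume "j < lev k"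
    then show "length (fst (g j)) = L" using g[of j] lev_le[of k] by (auto simp: digit_blocks_def adm_words_def)
  qed
  moreover have "concat (map (\<lambda>j. fst (g j)) [lev k..<k]) = []"
    using g by (fastforce simp: digit_blocks_def)
  ultimately have lx: "length (concat (map (\<lambda>j. fst (g j)) [0..<k])) = lev k * L" by simp
  have "1 / real n ^ (lev k * L) \<le> real n ^ L / real m ^ (k * L)"
  proof -
    have "(real m ^ k) ^ L \<le> (real n * real n ^ lev k) ^ L" by (intro power_mono n_power_lev) simp
    then have "real m ^ (k * L) \<le> real n ^ L * real n ^ (lev k * L)"
      by (simp add: power_mult power_mult_distrib)
    then show ?thesis using n_pos m_pos by (simp add: field_simps)
  qed
  then show "diameter (code_cell k g) \<le> (real n ^ L + 1) / real m ^ (k * L)"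
    using cell_bounded_diameter(2)[OF n_pos m_pos, of "concat (map (\<lambda>j. fst (g j)) [0..<k])" "concat (map (\<lambda>j. snd (g j)) [0..<k])"]
    unfolding code_cell_def lx ly by (simp add: add_divide_distrib)
  show "bounded (code_cell k g)" unfolding code_cell_def by (rule cell_bounded_diameter(1)[OF n_pos m_pos])
qed

lemma concat_blocks:
  "length w = k * L \<Longrightarrow> concat (map (\<lambda>j. take L (drop (j * L) w)) [0..<k]) = w"
proof (induction k arbitrary: w)
  case (Suc k)
  have "concat (map (\<lambda>j. take L (drop (j * L) w)) [0..<k]) = concat (map (\<lambda>j. take L (drop (j * L) (take (k * L) w))) [0..<k])"
  proof (intro arg_cong[of _ _ concat] map_cong refl)
    fix j assume "j \<in> set [0..<k]"
    then have "Suc j * L \<le> k * L" by (intro mult_right_mono) auto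
    then show "take L (drop (j * L) w) = take L (drop (j * L) (take (k * L) w))"
      by (simp add: drop_take min_absorb1)
  qed
  also have "\<dots> = take (k * L) w" using Suc.prems by (intro Suc.IH) simp
  finally show ?case using Suc.prems append_take_drop_id[of "k * L" w] by simp
qed simp

text \<open>The first \<open>lev k\<close> blocks carry the exponent \<open>\<alpha> - 1\<close> and
  the others \<open>\<alpha>\<close>, so up to normalisation the logarithm of the weight is
  \<open>\<alpha> * S k - S (lev k)\<close>, the quantity controlled by
  \<open>averaging\<close>.\<close>

lemma point_code:
  assumes w: "w \<in> adm (k * L)" "in_cell n (fst p) (map xd w)" "in_cell m (snd p) (map yd w)"
  defines "S \<equiv> \<lambda>k. \<Sum>j<k. ln (real (fib (map yd (take L (drop (j * L) w)))))"
  obtains g where "g \<in> block_codes L k" "p \<in> code_cell k g"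
    "code_weight L k g = exp (\<alpha> * S k - S (lev k)) / fib_pressure L ^ k"
proof -
  define b where "b j = take L (drop (j * L) w)" for j
  have b: "b j \<in> adm L" if "j < k" for j
  proof -
    have "Suc j * L \<le> k * L" using that by (intro mult_right_mono) auto
    then have e: "k * L = j * L + (L + (k * L - Suc j * L))" by simp
    have "drop (j * L) w \<in> adm (L + (k * L - Suc j * L))" 
      by (rule adm_take_drop(2)) (unfold e[symmetric], rule w(1))
    then show ?thesis unfolding b_def by (rule adm_take_drop)
  qed
  define g where "g = restrict (\<lambda>j. (if j < lev k then map xd (b j) else [], map yd (b j))) {..<k}"
  have gb: "g \<in> block_codes L k"
    unfolding block_codes_def g_def digit_blocks_def using b by auto
  have lw: "length w = k * L" using adm_length[OF w(1)] .
  have "concat (map (\<lambda>j. snd (g j)) [0..<k]) = concat (map (\<lambda>j. map yd (b j)) [0..<k])"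
    by (intro arg_cong[of _ _ concat] map_cong) (auto simp: g_def)
  also have "\<dots> = map yd (concat (map b [0..<k]))" by (simp add: map_concat o_def)
  also have "concat (map b [0..<k]) = w" unfolding b_def by (rule concat_blocks[OF lw])
  finally have y: "concat (map (\<lambda>j. snd (g j)) [0..<k]) = map yd w" .
  have split: "[0..<k] = [0..<lev k] @ [lev k..<k]"
    using lev_le[of k] upt_add_eq_append[of 0 "lev k" "k - lev k"] by simp
  have "concat (map (\<lambda>j. fst (g j)) [0..<k]) = concat (map (\<lambda>j. fst (g j)) [0..<lev k]) @ concat (map (\<lambda>j. fst (g j)) [lev k..<k])"
    unfolding split by simp
  also have "concat (map (\<lambda>j. fst (g j)) [lev k..<k]) = []" by (auto simp: g_def)
  also have "concat (map (\<lambda>j. fst (g j)) [0..<lev k]) = concat (map (\<lambda>j. map xd (b j)) [0..<lev k])"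
    using lev_le[of k] by (intro arg_cong[of _ _ concat] map_cong) (auto simp: g_def)
  also have "\<dots> = map xd (concat (map b [0..<lev k]))" by (simp add: map_concat o_def)
  finally have x: "concat (map (\<lambda>j. fst (g j)) [0..<k]) = map xd (concat (map b [0..<lev k]))" by simp
  have "w = concat (map b [0..<lev k]) @ concat (map b [lev k..<k])"
    using \<open>concat (map b [0..<k]) = w\<close> unfolding split by simp
  then have xw: "map xd w = map xd (concat (map b [0..<lev k])) @ map xd (concat (map b [lev k..<k]))"
    by (metis map_append)
  have "in_cell n (fst p) (map xd (concat (map b [0..<lev k])))"
  proof (rule in_cell_append[OF _ _ n_pos])
    show "in_cell n (fst p) (map xd (concat (map b [0..<lev k])) @ map xd (concat (map b [lev k..<k])))"
      using w(2) unfolding xw .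
    show "\<forall>d\<in>set (map xd (concat (map b [lev k..<k]))). d < n"
      using adm_digits(1)[OF w(1)] unfolding xw set_append by blast
  qed
  then have "p \<in> code_cell k g" unfolding code_cell_def x y cell_def using w(3) by simp
  moreover have "code_weight L k g = exp (\<alpha> * S k - S (lev k)) / fib_pressure L ^ k"
  proof -
    define F where "F j = ln (real (fib (map yd (b j))))" for j
    have Fexp: "real (fib (map yd (b j))) powr a = exp (a * F j)" if "j < k" for a j
      using fib_Y_ge_1[of "map yd (b j)" L] b[OF that] unfolding F_def powr_def by auto
    have "code_weight L k g = (\<Prod>j<k. exp ((if j < lev k then \<alpha> - 1 else \<alpha>) * F j) / fib_pressure L)"
      unfolding code_weight_def block_weight_def
    proof (intro prod.cong refl)
      fix j assume "j \<in> {..<k}"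
      then have j: "j < k" by simp
      then have "snd (g j) = map yd (b j)" by (simp add: g_def)
      then show "real (fib (snd (g j))) powr (if j < lev k then \<alpha> - 1 else \<alpha>) / fib_pressure L
          = exp ((if j < lev k then \<alpha> - 1 else \<alpha>) * F j) / fib_pressure L"
        using Fexp[OF j] by simp
    qed
    also have "\<dots> = exp (\<Sum>j<k. (if j < lev k then \<alpha> - 1 else \<alpha>) * F j) / fib_pressure L ^ k"
      by (simp add: prod_dividef exp_sum)
    also have "(\<Sum>j<k. (if j < lev k then \<alpha> - 1 else \<alpha>) * F j) = (\<Sum>j<k. \<alpha> * F j - (if j < lev k then F j else 0))"
      by (intro sum.cong) (auto simp: algebra_simps)
    also have "\<dots> = \<alpha> * (\<Sum>j<k. F j) - (\<Sum>j<k. if j < lev k then F j else 0)"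
      by (simp add: sum_subtractf sum_distrib_left)
    also have "(\<Sum>j<k. if j < lev k then F j else 0) = (\<Sum>j<lev k. F j)"
      using lev_le[of k] by (intro sum.mono_neutral_cong_right) auto
    finally show ?thesis unfolding S_def F_def b_def .
  qed
  ultimately show thesis using gb that by blast
qed

text \<open>By \<open>averaging\<close>, each point has at one of \<open>J\<close> chained levels a
  code of weight at least \<open>exp (- \<epsilon> * k) / Z ^ k\<close>. There are at most
  \<open>exp (\<epsilon> * k) * Z ^ k\<close> such codes, and their cells have diameter of order
  \<open>m ^ (k * L)\<close> inverted, so each level contributes a geometrically small amount to the
  \<open>s\<close>-dimensional sum.\<close>

lemma hausdorff_measure_zero:
  assumes "0 < s" "1 \<le> L" "ln (fib_pressure L) < s * (real L * ln (real m))"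
  shows "hausdorff_measure s X = 0"
proof -
  define Z where "Z = fib_pressure L"
  have Z: "1 \<le> Z" unfolding Z_def by (rule fib_pressure_ge_1)
  \<comment> \<open>Half of the margin in the assumption: one \<open>\<epsilon>\<close> pays for the
    defect allowed by \<open>averaging\<close>, the other one remains as decay.\<close>
  define \<epsilon> where "\<epsilon> = (s * (real L * ln (real m)) - ln Z) / 2"
  have \<epsilon>: "0 < \<epsilon>" using assms(3) unfolding \<epsilon>_def Z_def by simp
  define B where "B = ln (real (max_fib L))"
  \<comment> \<open>The number \<open>J\<close> of levels does not depend on the starting level
    \<open>k0\<close>, so the sum over these levels tends to zero as \<open>k0\<close>
    grows.\<close>
  obtain J where J: "B * \<alpha> / \<epsilon> < real J" using reals_Archimedean2 by blast
  then have JB: "B < real J * (\<epsilon> / \<alpha>)" using \<epsilon> \<alpha>_bounds by (simp add: field_simps)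
  define c0 where "c0 = (real n ^ L + 1) powr s"
  have c0: "0 \<le> c0" unfolding c0_def by simp
  have "\<forall>k. \<exists>k'. 1 \<le> k \<longrightarrow> lev k' = k \<and> k \<le> k' \<and> 1 \<le> k'" using lev_chain by metis
  then obtain nx where nx: "\<And>k. 1 \<le> k \<Longrightarrow> lev (nx k) = k \<and> k \<le> nx k \<and> 1 \<le> nx k" by metis
  have bound: "hausdorff_content s \<delta> X \<le> ennreal (real J * (c0 * exp (- \<epsilon>) ^ k0))"
    if k0: "1 \<le> k0" and small: "(real n ^ L + 1) / real m ^ (k0 * L) \<le> \<delta>" for k0 \<delta>
  proof -
    define \<kappa> where "\<kappa> j = (nx ^^ j) k0" for j
    have \<kappa>1: "1 \<le> \<kappa> j" for j
    proof (induction j)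
      case 0
      show ?case using k0 by (simp add: \<kappa>_def)
    next
      case (Suc j)
      then show ?case using nx[of "\<kappa> j"] by (simp add: \<kappa>_def)
    qed
    have \<kappa>S: "lev (\<kappa> (Suc j)) = \<kappa> j" "\<kappa> j \<le> \<kappa> (Suc j)" for j
      using nx[OF \<kappa>1[of j]] by (auto simp: \<kappa>_def)
    have \<kappa>_mono: "\<kappa> i \<le> \<kappa> j" if "i \<le> j" for i j using lift_Suc_mono_le[of \<kappa>, OF \<kappa>S(2) that] .
    define a where "a k = exp (- (\<epsilon> * real k)) / Z ^ k" for k
    have a: "0 < a k" for k unfolding a_def using Z by simp
    define G where "G k = {g \<in> block_codes L k. a k \<le> code_weight L k g}" for k
    define I where "I = Sigma {..<J} (\<lambda>j. G (\<kappa> (Suc j)))"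
    have finG: "finite (G k)" for k unfolding G_def using finite_block_codes by simp
    have finI: "finite I" unfolding I_def using finG by auto
    define U where "U z = code_cell (\<kappa> (Suc (fst z))) (snd z)" for z
    have diam: "bounded (U z) \<and> diameter (U z) \<le> (real n ^ L + 1) / real m ^ (\<kappa> (Suc (fst z)) * L)"
      if "z \<in> I" for z
      using that code_cell_small unfolding I_def U_def G_def by fastforce
    have X_cover: "X \<subseteq> (\<Union>z\<in>I. U z)"
    proof
      fix p assume p: "p \<in> X"
      \<comment> \<open>One word of length \<open>\<kappa> J * L\<close> serves all levels; the code
        at a level is read off a prefix.\<close>
      obtain w where w: "w \<in> adm (\<kappa> J * L)" "in_cell n (fst p) (map xd w)" "in_cell m (snd p) (map yd w)"
        using word[OF p] by blast
      define S where "S k = (\<Sum>j<k. ln (real (fib (map yd (take L (drop (j * L) w))))))" for k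
      have ln_nonneg: "0 \<le> ln (real j)" for j :: nat by (cases j) auto
      have "S k \<le> B * real k" if "k \<le> \<kappa> J" for k
      proof -
        have "ln (real (fib (map yd (take L (drop (j * L) w))))) \<le> B" if "j < k" for j
        proof -
          have "Suc j * L \<le> \<kappa> J * L" using that \<open>k \<le> \<kappa> J\<close> by (intro mult_right_mono) auto
          then have "length (map yd (take L (drop (j * L) w))) = L" using adm_length[OF w(1)] by simp
          then have "fib (map yd (take L (drop (j * L) w))) \<le> max_fib L" by (rule fib_le_max_fib)
          then show ?thesis unfolding B_def using max_fib_ge_1[of L] ln_nonneg
            by (cases "fib (map yd (take L (drop (j * L) w))) = 0") auto
        qed
        then have "S k \<le> (\<Sum>j<k. B)" unfolding S_def by (intro sum_mono) auto
        then show ?thesis by (simp add: mult.commute)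
      qed
      then have "S (\<kappa> 0) \<le> B * real (\<kappa> 0)" using \<kappa>_mono by simp
      moreover have "0 \<le> S k" for k unfolding S_def by (intro sum_nonneg ln_nonneg)
      ultimately obtain j where j: "j < J" "- (\<epsilon> * real (\<kappa> (Suc j))) \<le> \<alpha> * S (\<kappa> (Suc j)) - S (\<kappa> j)"
        using averaging[of \<kappa> S B J \<epsilon>] \<kappa>S(1) \<kappa>1 JB by blast
      define k where "k = \<kappa> (Suc j)"
      have kJ: "k \<le> \<kappa> J" unfolding k_def using j(1) by (intro \<kappa>_mono) simp
      then have "k * L \<le> \<kappa> J * L" by (rule mult_right_mono) simp
      then have e: "\<kappa> J * L = k * L + (\<kappa> J * L - k * L)" by simp
      define v where "v = take (k * L) w"
      have v: "v \<in> adm (k * L)" unfolding v_def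
        by (rule adm_take_drop(1)[where l = "\<kappa> J * L - k * L"]) (unfold e[symmetric], rule w(1))
      have vc: "in_cell n (fst p) (map xd v)" "in_cell m (snd p) (map yd v)"
        using in_cell_take[OF w(2) adm_digits(1)[OF w(1)] n_pos] in_cell_take[OF w(3) adm_digits(2)[OF w(1)] m_pos]
        unfolding v_def by (simp_all add: take_map)
      obtain g where g: "g \<in> block_codes L k" "p \<in> code_cell k g"
        "code_weight L k g = exp (\<alpha> * (\<Sum>j<k. ln (real (fib (map yd (take L (drop (j * L) v))))))
          - (\<Sum>j<lev k. ln (real (fib (map yd (take L (drop (j * L) v))))))) / fib_pressure L ^ k"
        using point_code[OF v vc] by blast
      have Sv: "(\<Sum>j<k'. ln (real (fib (map yd (take L (drop (j * L) v)))))) = S k'" if "k' \<le> k" for k'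
        unfolding S_def
      proof (intro sum.cong refl)
        fix i assume "i \<in> {..<k'}"
        then have "Suc i * L \<le> k * L" using that by (intro mult_right_mono) auto
        then have "take L (drop (i * L) v) = take L (drop (i * L) w)"
          unfolding v_def by (simp add: drop_take min_absorb1)
        then show "ln (real (fib (map yd (take L (drop (i * L) v))))) = ln (real (fib (map yd (take L (drop (i * L) w)))))" by simp
      qed
      have "code_weight L k g = exp (\<alpha> * S k - S (lev k)) / Z ^ k"
        using g(3) Sv[OF order_refl] Sv[OF lev_le] unfolding Z_def by simp
      moreover have "lev k = \<kappa> j" unfolding k_def by (rule \<kappa>S(1))
      ultimately have "a k \<le> code_weight L k g"
        unfolding a_def using j(2) Z unfolding k_def[symmetric] by (simp add: divide_right_mono)
      then have "(j, g) \<in> I" unfolding I_def G_def using g(1) j(1) k_def by simp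
      moreover have "p \<in> U (j, g)" unfolding U_def using g(2) k_def by simp
      ultimately show "p \<in> (\<Union>z\<in>I. U z)" by blast
    qed
    have diam\<delta>: "(real n ^ L + 1) / real m ^ (\<kappa> (Suc j) * L) \<le> \<delta>" for j
    proof -
      have "k0 * L \<le> \<kappa> (Suc j) * L" using \<kappa>_mono[of 0 "Suc j"] by (simp add: \<kappa>_def)
      then have "real m ^ (k0 * L) \<le> real m ^ (\<kappa> (Suc j) * L)" using m_pos by (intro power_increasing) auto
      then have "(real n ^ L + 1) / real m ^ (\<kappa> (Suc j) * L) \<le> (real n ^ L + 1) / real m ^ (k0 * L)"
        using m_pos by (intro divide_left_mono mult_pos_pos) auto
      then show ?thesis using small by linarith
    qed
    have "0 \<le> (real n ^ L + 1) / real m ^ (k0 * L)" by simp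
    then have "0 \<le> \<delta>" using small by linarith
    then have "hausdorff_content s \<delta> X \<le> (\<Sum>z\<in>I. diam_pow s (U z))"
      by (intro hausdorff_content_le_finite finI X_cover) (use diam diam\<delta> order_trans in blast)+
    also have "\<dots> \<le> (\<Sum>z\<in>I. ennreal (((real n ^ L + 1) / real m ^ (\<kappa> (Suc (fst z)) * L)) powr s))"
    proof (rule sum_mono)
      fix z assume z: "z \<in> I"
      have "0 \<le> diameter (U z)" using diam[OF z] by (intro diameter_ge_0) simp
      then show "diam_pow s (U z) \<le> ennreal (((real n ^ L + 1) / real m ^ (\<kappa> (Suc (fst z)) * L)) powr s)"
        unfolding diam_pow_def using diam[OF z] assms(1) by (auto intro!: ennreal_leI powr_mono2)
    qed
    also have "\<dots> = ennreal (\<Sum>z\<in>I. ((real n ^ L + 1) / real m ^ (\<kappa> (Suc (fst z)) * L)) powr s)"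
      by (rule sum_ennreal) simp
    also have "(\<Sum>z\<in>I. ((real n ^ L + 1) / real m ^ (\<kappa> (Suc (fst z)) * L)) powr s)
        = (\<Sum>j<J. real (card (G (\<kappa> (Suc j)))) * ((real n ^ L + 1) / real m ^ (\<kappa> (Suc j) * L)) powr s)"
    proof -
      have "(\<Sum>z\<in>I. h (fst z)) = (\<Sum>j<J. real (card (G (\<kappa> (Suc j)))) * h j)" for h :: "nat \<Rightarrow> real"
      proof -
        have "(\<Sum>z\<in>I. h (fst z)) = (\<Sum>(j, g)\<in>I. h j)" by (simp add: case_prod_beta)
        also have "\<dots> = (\<Sum>j<J. \<Sum>g\<in>G (\<kappa> (Suc j)). h j)"
          unfolding I_def by (rule sum.Sigma[symmetric]) (use finG in auto)
        finally show ?thesis by simp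
      qed
      then show ?thesis .
    qed
    also have "ennreal \<dots> \<le> ennreal (\<Sum>j<J. c0 * exp (- \<epsilon>) ^ k0)"
    proof (intro ennreal_leI sum_mono)
      fix j
      define k where "k = \<kappa> (Suc j)"
      have Deq: "((real n ^ L + 1) / real m ^ (k * L)) powr s = c0 * exp (- (real k * (s * (real L * ln (real m)))))"
      proof -
        have "((real n ^ L + 1) / real m ^ (k * L)) powr s = c0 / (real m ^ (k * L)) powr s"
          unfolding c0_def by (rule powr_divide)
        also have "(real m ^ (k * L)) powr s = exp (real k * (s * (real L * ln (real m))))"
          unfolding m_power_powr by (simp add: ac_simps)
        finally show ?thesis by (simp add: exp_minus divide_inverse)
      qed
      have ak: "1 / a k = exp (\<epsilon> * real k + real k * ln Z)"
        unfolding a_def using Z by (simp add: exp_add exp_minus exp_of_nat_mult divide_inverse mult.commute)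
      have "real (card (G k)) * ((real n ^ L + 1) / real m ^ (k * L)) powr s
          \<le> (1 / a k) * ((real n ^ L + 1) / real m ^ (k * L)) powr s"
        using card_heavy_codes[OF a[of k], of L k] unfolding G_def by (intro mult_right_mono) auto
      also have "(1 / a k) * ((real n ^ L + 1) / real m ^ (k * L)) powr s
          = exp (\<epsilon> * real k + real k * ln Z) * (c0 * exp (- (real k * (s * (real L * ln (real m))))))"
        unfolding Deq ak ..
      also have "exp (\<epsilon> * real k + real k * ln Z) * (c0 * exp (- (real k * (s * (real L * ln (real m))))))
          = c0 * exp (\<epsilon> * real k + real k * ln Z - real k * (s * (real L * ln (real m))))"
        by (simp add: exp_diff exp_minus divide_inverse)
      also have "\<epsilon> * real k + real k * ln Z - real k * (s * (real L * ln (real m))) = real k * (- \<epsilon>)"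
        unfolding \<epsilon>_def by (simp add: field_simps)
      also have "c0 * exp (real k * (- \<epsilon>)) \<le> c0 * exp (real k0 * (- \<epsilon>))"
      proof -
        have "k0 \<le> k" unfolding k_def using \<kappa>_mono[of 0 "Suc j"] by (simp add: \<kappa>_def)
        then have "real k0 * \<epsilon> \<le> real k * \<epsilon>" using \<epsilon> by (intro mult_right_mono) auto
        then show ?thesis using c0 by (intro mult_left_mono) auto
      qed
      finally show "real (card (G (\<kappa> (Suc j)))) * ((real n ^ L + 1) / real m ^ (\<kappa> (Suc j) * L)) powr s \<le> c0 * exp (- \<epsilon>) ^ k0"
        unfolding k_def exp_of_nat_mult .
    qed
    finally show ?thesis by simp
  qed
  have "hausdorff_content s \<delta> X = 0" if \<delta>: "0 < \<delta>" for \<delta>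
  proof -
    have eps: "hausdorff_content s \<delta> X \<le> 0 + ennreal \<eta>" if \<eta>: "0 < \<eta>" for \<eta>
    proof -
      have "(\<lambda>k. real J * (c0 * exp (- \<epsilon>) ^ k)) \<longlonglongrightarrow> real J * (c0 * 0)"
        using \<epsilon> by (intro tendsto_intros LIMSEQ_power_zero) auto
      then have "eventually (\<lambda>k. real J * (c0 * exp (- \<epsilon>) ^ k) < \<eta>) sequentially"
        using \<eta> by (intro order_tendstoD(2)[of _ "real J * (c0 * 0)"]) auto
      moreover have "(\<lambda>k. (real n ^ L + 1) * (1 / real m ^ L) ^ k) \<longlonglongrightarrow> (real n ^ L + 1) * 0"
      proof (intro tendsto_intros LIMSEQ_power_zero)
        have "1 < real m ^ L" using m_ge_2 assms(2) by (intro one_less_power) auto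
        then have "1 / real m ^ L < 1" by (subst divide_less_eq_1_pos) linarith+
        then show "norm (1 / real m ^ L) < 1" by simp
      qed
      then have "eventually (\<lambda>k. (real n ^ L + 1) * (1 / real m ^ L) ^ k < \<delta>) sequentially"
        using \<delta> by (intro order_tendstoD(2)[of _ "(real n ^ L + 1) * 0"]) auto
      ultimately have "eventually (\<lambda>k. real J * (c0 * exp (- \<epsilon>) ^ k) < \<eta> \<and> (real n ^ L + 1) * (1 / real m ^ L) ^ k < \<delta> \<and> 1 \<le> k) sequentially"
        using eventually_ge_at_top[of 1] by (intro eventually_conj)
      then obtain k where k: "real J * (c0 * exp (- \<epsilon>) ^ k) < \<eta>" "(real n ^ L + 1) * (1 / real m ^ L) ^ k < \<delta>" "1 \<le> k"
        using eventually_happens'[OF sequentially_bot] by blast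
      have "(real n ^ L + 1) / real m ^ (k * L) \<le> \<delta>"
      proof -
        have "(1 / real m ^ L) ^ k = 1 / real m ^ (k * L)"
          unfolding power_one_over power_mult[symmetric] by (simp only: mult.commute)
        then show ?thesis using k(2) by simp
      qed
      from bound[OF k(3) this] have "hausdorff_content s \<delta> X \<le> ennreal (real J * (c0 * exp (- \<epsilon>) ^ k))" .
      also have "\<dots> \<le> ennreal \<eta>" using k(1) by (intro ennreal_leI) simp
      finally show ?thesis by simp
    qed
    have "hausdorff_content s \<delta> X \<le> 0" by (rule ennreal_le_epsilon) (rule eps)
    then show ?thesis by simp
  qed
  then show ?thesis unfolding hausdorff_measure_def by (auto intro!: SUP_eqI)
qed

lemma hausdorff_dim_le_pressure:
  assumes "1 \<le> L"
  shows "hausdorff_dim X \<le> ln (fib_pressure L) / (real L * ln (real m))"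
proof (rule dense_ge)
  fix s assume s: "ln (fib_pressure L) / (real L * ln (real m)) < s"
  have Lm: "0 < real L * ln (real m)" using assms ln_m_pos by simp
  have "0 \<le> ln (fib_pressure L) / (real L * ln (real m))"
    using fib_pressure_ge_1[of L] Lm by simp
  then have "0 < s" using s by linarith
  moreover have "ln (fib_pressure L) < s * (real L * ln (real m))"
    using s Lm by (simp only: pos_divide_less_eq)
  ultimately have "hausdorff_measure s X = 0" using assms by (intro hausdorff_measure_zero)
  with \<open>0 < s\<close> show "hausdorff_dim X \<le> s"
    unfolding hausdorff_dim_def by (intro cInf_lower bdd_belowI[of _ 0]) auto
qed

section \<open>Hausdorff dimension: strict inequality\<close>

lemma dB_ln_m: "dB * ln (real m) = \<alpha> * hI + (1 - \<alpha>) * hy"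
  unfolding dB_def using ln_m_pos by simp

lemma Hoelder_growth:
  "real (cnt pair L) powr \<alpha> * real (cnt yd L) powr (1 - \<alpha>) \<le> real CC * exp (real L * (dB * ln (real m)))"
proof -
  have "real (cnt pair L) powr \<alpha> * real (cnt yd L) powr (1 - \<alpha>)
      \<le> (real CC * exp (real L * hI)) powr \<alpha> * (real CC * exp (real L * hy)) powr (1 - \<alpha>)"
    using \<alpha>_bounds by (intro mult_mono powr_mono2 hI_growth(3) hy_growth(3)) auto
  also have "\<dots> = (real CC powr \<alpha> * real CC powr (1 - \<alpha>)) * (exp (real L * hI) powr \<alpha> * exp (real L * hy) powr (1 - \<alpha>))"
    by (simp add: powr_mult)
  also have "real CC powr \<alpha> * real CC powr (1 - \<alpha>) = real CC" using CC_real by (simp flip: powr_add)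
  also have "exp (real L * hI) powr \<alpha> * exp (real L * hy) powr (1 - \<alpha>) = exp (real L * (dB * ln (real m)))"
    unfolding dB_ln_m by (simp add: powr_def algebra_simps flip: exp_add)
  finally show ?thesis .
qed

lemma fib_pressure_le: "fib_pressure L \<le> real CC * exp (real L * (dB * ln (real m)))"
proof -
  have "fib_pressure L = (\<Sum>u\<in>map yd ` adm L. real (fib u) powr \<alpha> * 1 powr (1 - \<alpha>))"
    unfolding fib_pressure_def by simp
  also have "\<dots> \<le> (\<Sum>u\<in>map yd ` adm L. real (fib u)) powr \<alpha> * (\<Sum>u\<in>map yd ` adm L. 1) powr (1 - \<alpha>)"
    using \<alpha>_bounds by (intro powr_Hoelder_sum) auto
  also have "\<dots> = real (cnt pair L) powr \<alpha> * real (cnt yd L) powr (1 - \<alpha>)"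
    unfolding cnt_pair_eq_sum_fib by (simp add: cnt_def)
  also have "\<dots> \<le> real CC * exp (real L * (dB * ln (real m)))" by (rule Hoelder_growth)
  finally show ?thesis .
qed

lemma hausdorff_dim_le_dB: "hausdorff_dim X \<le> dB"
proof -
  define c where "c = ln (real CC) / ln (real m)"
  have "hausdorff_dim X \<le> dB + c / real L" if "1 \<le> L" for L
  proof -
    have "0 < fib_pressure L" using fib_pressure_ge_1[of L] by linarith
    then have "ln (fib_pressure L) \<le> ln (real CC * exp (real L * (dB * ln (real m))))"
      using fib_pressure_le[of L] by simp
    also have "\<dots> = ln (real CC) + real L * (dB * ln (real m))" using CC_real by (simp add: ln_mult)
    finally have "ln (fib_pressure L) / (real L * ln (real m)) \<le> (ln (real CC) + real L * (dB * ln (real m))) / (real L * ln (real m))"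
      using ln_m_pos by (intro divide_right_mono) auto
    also have "\<dots> = dB + c / real L" unfolding c_def using that ln_m_pos by (simp add: field_simps)
    finally show ?thesis using hausdorff_dim_le_pressure[OF that] by linarith
  qed
  moreover have "(\<lambda>L. dB + c / real L) \<longlonglongrightarrow> dB + 0" by (intro tendsto_intros lim_const_over_n)
  ultimately show ?thesis by (intro LIMSEQ_le_const[of "\<lambda>L. dB + c / real L" dB]) auto
qed

section \<open>Two weightings of words with a given prefix\<close>

lemma length_Y: "u \<in> map yd ` adm a \<Longrightarrow> length u = a"
  by (auto simp: adm_words_def)

text \<open>For \<open>g = pair\<close> and \<open>g = yd\<close> this is the unnormalised mass of
  the prefix \<open>u\<close> when \<open>y\<close>-words of length \<open>N\<close> are weighted by
  \<open>fib\<close> and merely counted, respectively. Fixing the total length \<open>N\<close>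
  makes both exactly additive over extensions by one block.\<close>

definition ext :: "('e \<Rightarrow> 'c) \<Rightarrow> nat \<Rightarrow> nat list \<Rightarrow> nat" where
  "ext g N u = card (map g ` {w \<in> adm N. take (length u) (map yd w) = u})"

lemma ext_split:
  assumes det: "\<And>w w'. map g w = map g w' \<Longrightarrow> map yd w = map yd w'" and N: "length u + b \<le> N"
  shows "ext g N u = (\<Sum>v\<in>map yd ` adm b. ext g N (u @ v))"
proof -
  define W where "W u = {w \<in> adm N. take (length u) (map yd w) = u}" for u
  have "W u = (\<Union>v\<in>map yd ` adm b. W (u @ v))"
  proof (intro set_eqI iffI)
    fix w assume w: "w \<in> W u"
    have "drop (length u) w \<in> adm (b + (N - length u - b))"
      by (rule adm_take_drop(2)) (use w N in \<open>simp add: W_def\<close>)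
    then have "take b (drop (length u) w) \<in> adm b" by (rule adm_take_drop)
    moreover have "w \<in> W (u @ map yd (take b (drop (length u) w)))"
    proof -
      have "length (take b (drop (length u) w)) = b" using \<open>take b (drop (length u) w) \<in> adm b\<close> by (rule adm_length)
      then show ?thesis using w unfolding W_def by (simp add: take_add take_map drop_map)
    qed
    ultimately show "w \<in> (\<Union>v\<in>map yd ` adm b. W (u @ v))" by blast
  next
    fix w assume "w \<in> (\<Union>v\<in>map yd ` adm b. W (u @ v))"
    then obtain v where v: "take (length (u @ v)) (map yd w) = u @ v" "w \<in> adm N" unfolding W_def by blast
    have "take (length u) (map yd w) = take (length u) (take (length (u @ v)) (map yd w))" by simp
    also have "\<dots> = u" unfolding v(1) by simp
    finally show "w \<in> W u" unfolding W_def using v(2) by simp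
  qed
  then have "ext g N u = card (\<Union>v\<in>map yd ` adm b. map g ` W (u @ v))"
    unfolding ext_def W_def[symmetric] by (simp add: image_UN)
  also have "\<dots> = (\<Sum>v\<in>map yd ` adm b. card (map g ` W (u @ v)))"
  proof (rule card_UN_disjoint)
    show "\<forall>v\<in>map yd ` adm b. \<forall>v'\<in>map yd ` adm b. v \<noteq> v' \<longrightarrow> map g ` W (u @ v) \<inter> map g ` W (u @ v') = {}"
    proof (intro ballI impI)
      fix v v' assume v: "v \<in> map yd ` adm b" "v' \<in> map yd ` adm b" "v \<noteq> v'"
      show "map g ` W (u @ v) \<inter> map g ` W (u @ v') = {}"
      proof (rule ccontr)
        assume "\<not> ?thesis"
        then obtain w w' where w: "w \<in> W (u @ v)" "w' \<in> W (u @ v')" "map g w = map g w'" by force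
        have "length v = length v'" using v(1,2) length_Y by metis
        then have "u @ v = u @ v'" using w(1,2) det[OF w(3)] unfolding W_def by (metis (mono_tags, lifting) length_append mem_Collect_eq)
        then show False using v(3) by simp
      qed
    qed
  qed (auto simp: W_def)
  finally show ?thesis unfolding ext_def W_def .
qed

lemma ext_pair_le:
  assumes "length u \<le> N"
  shows "ext pair N u \<le> fib u * cnt pair (N - length u)"
proof -
  let ?P = "map pair ` {w \<in> adm (length u). map yd w = u}" and ?Q = "map pair ` adm (N - length u)"
  have "map pair ` {w \<in> adm N. take (length u) (map yd w) = u} \<subseteq> (\<lambda>(x, y). x @ y) ` (?P \<times> ?Q)"
  proof
    fix s assume "s \<in> map pair ` {w \<in> adm N. take (length u) (map yd w) = u}"
    then obtain w where w: "w \<in> adm N" "take (length u) (map yd w) = u" "s = map pair w" by blast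
    have "w \<in> adm (length u + (N - length u))" using w(1) assms by simp
    note td = adm_take_drop[OF this]
    have "s = map pair (take (length u) w) @ map pair (drop (length u) w)"
      unfolding w(3) map_append[symmetric] by simp
    moreover have "map pair (take (length u) w) \<in> ?P" using td(1) w(2) by (auto simp: take_map)
    ultimately show "s \<in> (\<lambda>(x, y). x @ y) ` (?P \<times> ?Q)" using td(2) by blast
  qed
  then have "ext pair N u \<le> card ((\<lambda>(x, y). x @ y) ` (?P \<times> ?Q))"
    unfolding ext_def by (intro card_mono) auto
  also have "\<dots> = card ?P * card ?Q"
    by (rule card_append_product[where k = "length u"]) (auto dest: adm_length)
  finally show ?thesis unfolding fib_pair cnt_def .
qed

lemma ext_yd_le:
  assumes "length u \<le> N"
  shows "ext yd N u \<le> cnt yd (N - length u)"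
proof -
  have "map yd ` {w \<in> adm N. take (length u) (map yd w) = u} \<subseteq> (\<lambda>z. u @ z) ` map yd ` adm (N - length u)"
  proof
    fix s assume "s \<in> map yd ` {w \<in> adm N. take (length u) (map yd w) = u}"
    then obtain w where w: "w \<in> adm N" "take (length u) (map yd w) = u" "s = map yd w" by blast
    have "w \<in> adm (length u + (N - length u))" using w(1) assms by simp
    then have "drop (length u) w \<in> adm (N - length u)" by (rule adm_take_drop)
    moreover have "s = u @ map yd (drop (length u) w)"
      using append_take_drop_id[of "length u" "map yd w"] unfolding w(2,3) by (simp add: drop_map)
    ultimately show "s \<in> (\<lambda>z. u @ z) ` map yd ` adm (N - length u)" by blast
  qed
  then have "ext yd N u \<le> card ((\<lambda>z. u @ z) ` map yd ` adm (N - length u))"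
    unfolding ext_def by (intro card_mono) auto
  also have "\<dots> \<le> cnt yd (N - length u)" unfolding cnt_def by (intro card_image_le) simp
  finally show ?thesis .
qed

lemma extension_count':
  assumes "P \<subseteq> adm a"
  shows "card (map g ` P) * cnt g j \<le> card V * card E ^ gap * card (map g ` {w \<in> adm (a + j). take a w \<in> P})"
proof -
  have "card ((\<lambda>w. (map g (take a w), map g (drop a w))) ` {w \<in> adm (a + j). take a w \<in> P})
      \<le> card (map g ` {w \<in> adm (a + j). take a w \<in> P})"
    by (rule card_image_le_determined) (auto, (metis take_map drop_map)+)
  from mult_le_mono2[OF this, of "card V * card E ^ gap"] extension_count[OF assms, of g g j]
  show ?thesis by linarith
qed

lemma ext_yd_ge:
  assumes u: "u \<in> map yd ` adm a" and "a \<le> N"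
  shows "cnt yd (N - a) \<le> CC * ext yd N u"
proof -
  define P where "P = {w \<in> adm a. map yd w = u}"
  have lu: "length u = a" by (rule length_Y[OF u])
  have P: "P \<subseteq> adm a" "map yd ` P = {u}" using u unfolding P_def by auto
  have "{w \<in> adm (a + (N - a)). take a w \<in> P} \<subseteq> {w \<in> adm N. take (length u) (map yd w) = u}"
    using \<open>a \<le> N\<close> unfolding P_def lu by (auto simp: take_map)
  then have "card (map yd ` {w \<in> adm (a + (N - a)). take a w \<in> P}) \<le> ext yd N u"
    unfolding ext_def by (intro card_mono image_mono) auto
  then have "card V * card E ^ gap * card (map yd ` {w \<in> adm (a + (N - a)). take a w \<in> P}) \<le> CC * ext yd N u"
    by (intro mult_le_mono CC_ge)
  with extension_count'[OF P(1), of yd "N - a"] show ?thesis unfolding P(2) by simp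
qed

lemma det_pair: "map pair w = map pair w' \<Longrightarrow> map yd w = map yd w'"
  by (simp add: map_pair_eq_iff)

text \<open>The event separating the two weightings of \<open>y\<close>-words (by fibre size and by counting): the
  next block of length \<open>k + gap\<close> contains the fixed word \<open>u0\<close> after at most \<open>gap\<close> letters.\<close>

definition hits :: "nat list \<Rightarrow> nat list set" where
  "hits u0 = {v \<in> map yd ` adm (length u0 + gap). \<exists>d\<le>gap. take (length u0) (drop d v) = u0}"

text \<open>Once the offset \<open>d\<close> is chosen, \<open>u0\<close> fixes all but
  \<open>gap\<close> letters of the block. The bound does not depend on \<open>u0\<close>, which may
  thus be taken long.\<close>

lemma card_hits: "card (hits u0) \<le> Suc gap * card E ^ gap"
proof -
  define k where "k = length u0"
  define H where "H d = (\<lambda>(x, y). x @ y) ` (map yd ` adm d \<times> (\<lambda>z. u0 @ z) ` map yd ` adm (gap - d))" for d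
  have finH: "finite (H d)" for d unfolding H_def by simp
  have "hits u0 \<subseteq> (\<Union>d\<in>{..gap}. H d)"
  proof
    fix v assume "v \<in> hits u0"
    then obtain w d where w: "w \<in> adm (k + gap)" "v = map yd w" "d \<le> gap" "take k (drop d v) = u0"
      unfolding hits_def k_def by blast
    have "w \<in> adm (d + (k + (gap - d)))" using w(1,3) by (simp add: ac_simps)
    note td = adm_take_drop[OF this]
    note td2 = adm_take_drop[OF td(2)]
    have "v = map yd (take d w) @ take k (drop d v) @ map yd (drop k (drop d w))"
      unfolding w(2) by (simp only: take_map drop_map map_append[symmetric] append_take_drop_id)
    then have "v = map yd (take d w) @ (u0 @ map yd (drop k (drop d w)))" unfolding w(4) .
    then have "v \<in> H d" unfolding H_def using td(1) td2(2)
      by (intro image_eqI[of _ _ "(map yd (take d w), u0 @ map yd (drop k (drop d w)))"]) auto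
    then show "v \<in> (\<Union>d\<in>{..gap}. H d)" using w(3) by blast
  qed
  then have "card (hits u0) \<le> card (\<Union>d\<in>{..gap}. H d)" using finH by (intro card_mono) auto
  also have "\<dots> \<le> (\<Sum>d\<le>gap. card (H d))" by (rule card_UN_le) simp
  also have "\<dots> \<le> (\<Sum>d\<le>gap. card E ^ gap)"
  proof (rule sum_mono)
    fix d assume "d \<in> {..gap}"
    then have d: "d \<le> gap" by simp
    have "card (H d) = card (map yd ` adm d) * card ((\<lambda>z. u0 @ z) ` map yd ` adm (gap - d))"
      unfolding H_def by (rule card_append_product[where k = d]) (auto dest: adm_length)
    also have "\<dots> \<le> cnt yd d * cnt yd (gap - d)"
      unfolding cnt_def by (intro mult_left_mono card_image_le) auto
    also have "\<dots> \<le> card E ^ d * card E ^ (gap - d)" by (intro mult_le_mono cnt_le_power)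
    also have "\<dots> = card E ^ gap" using d by (simp flip: power_add)
    finally show "card (H d) \<le> card E ^ gap" .
  qed
  finally show ?thesis by simp
qed

lemma hits_factor_pos: "0 < real (Suc gap * card E ^ gap)"
  using card_E_pos by (simp only: of_nat_0_less_iff) simp

text \<open>Words above \<open>u\<close> are glued to words above \<open>u0\<close> and then
  extended to length \<open>N\<close>. The connecting word has at most \<open>gap\<close> letters,
  so the block following \<open>u\<close> hits \<open>u0\<close>. As its exact length is unknown,
  the event has to allow all offsets up to \<open>gap\<close>.\<close>

lemma hits_lower:
  assumes u: "u \<in> map yd ` adm a" and u0: "length u0 = k" and N: "a + (k + gap) \<le> N"
  shows "exp (real (N - a - (k + gap)) * hI) * real (fib u) * real (fib u0)
    \<le> (real CC)\<^sup>2 * (\<Sum>v\<in>hits u0. real (ext pair N (u @ v)))"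
proof -
  define P1 where "P1 = {w \<in> adm a. map yd w = u}"
  define P2 where "P2 = {w \<in> adm k. map yd w = u0}"
  have lu: "length u = a" by (rule length_Y[OF u])
  have P: "P1 \<subseteq> adm a" "P2 \<subseteq> adm k" unfolding P1_def P2_def by auto
  obtain c Q where Q: "length c \<le> gap" "Q \<subseteq> adm (a + length c + k)"
    "\<And>w. w \<in> Q \<Longrightarrow> \<exists>w1\<in>P1. \<exists>w2\<in>P2. w = w1 @ c @ w2"
    "card (map pair ` P1) * card (map pair ` P2) \<le> (card V)\<^sup>2 * card (map pair ` Q)"
    using gluing[OF P, where g = pair] by blast
  define a' j where "a' = a + length c + k" and "j = N - a'"
  have a': "a' + j = N" "N - a - (k + gap) \<le> j" unfolding j_def a'_def using N Q(1) by auto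
  define T where "T = {w \<in> adm (a' + j). take a' w \<in> Q}"
  have T_sub: "map pair ` T \<subseteq> (\<Union>v\<in>hits u0. map pair ` {w \<in> adm N. take (length (u @ v)) (map yd w) = u @ v})"
  proof
    fix s assume "s \<in> map pair ` T"
    then obtain w where w: "w \<in> adm N" "take a' w \<in> Q" "s = map pair w" unfolding T_def a' by blast
    obtain w1 w2 where w12: "w1 \<in> P1" "w2 \<in> P2" "take a' w = w1 @ c @ w2" using Q(3)[OF w(2)] by blast
    have l12: "length w1 = a" "length w2 = k" using w12(1,2) P adm_length by blast+
    define r where "r = drop a' w"
    have w_eq: "w = w1 @ c @ w2 @ r" unfolding r_def using append_take_drop_id[of a' w] unfolding w12(3) by simp
    have y12: "map yd w1 = u" "map yd w2 = u0" using w12(1,2) unfolding P1_def P2_def by auto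
    define z where "z = map yd (c @ w2 @ r)"
    define v where "v = take (k + gap) z"
    have "w \<in> adm (a + ((k + gap) + (N - a - (k + gap))))" using w(1) N by simp
    then have "drop a w \<in> adm ((k + gap) + (N - a - (k + gap)))" by (rule adm_take_drop)
    then have "take (k + gap) (drop a w) \<in> adm (k + gap)" by (rule adm_take_drop)
    moreover have "v = map yd (take (k + gap) (drop a w))"
      unfolding v_def z_def w_eq take_map[symmetric] using l12 by simp
    ultimately have v_in: "v \<in> map yd ` adm (k + gap)" by blast
    have "take k (drop (length c) v) = u0"
    proof -
      have "min k (k + gap - length c) = k" using Q(1) by simp
      then have "take k (drop (length c) v) = take k (drop (length c) z)"
        unfolding v_def drop_take take_take by (simp only:)
      also have "\<dots> = u0" unfolding z_def using y12 u0 by simp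
      finally show ?thesis .
    qed
    then have "v \<in> hits u0" unfolding hits_def u0 using v_in Q(1) by blast
    moreover have "take (length (u @ v)) (map yd w) = u @ v"
    proof -
      have "length v = k + gap" by (rule length_Y[OF v_in])
      moreover have "map yd w = u @ z" unfolding w_eq z_def using y12 by simp
      ultimately show ?thesis unfolding v_def by simp
    qed
    ultimately show "s \<in> (\<Union>v\<in>hits u0. map pair ` {w \<in> adm N. take (length (u @ v)) (map yd w) = u @ v})"
      using w by blast
  qed
  have finh: "finite (hits u0)" unfolding hits_def by simp
  have "card (map pair ` T) \<le> card (\<Union>v\<in>hits u0. map pair ` {w \<in> adm N. take (length (u @ v)) (map yd w) = u @ v})"
    by (rule card_mono[OF _ T_sub]) (use finh in auto)
  also have "\<dots> \<le> (\<Sum>v\<in>hits u0. ext pair N (u @ v))"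
    unfolding ext_def by (rule card_UN_le[OF finh])
  finally have cT: "card (map pair ` T) \<le> (\<Sum>v\<in>hits u0. ext pair N (u @ v))" .
  have "card (map pair ` Q) * cnt pair j \<le> card V * card E ^ gap * card (map pair ` T)"
    unfolding T_def by (rule extension_count') (use Q(2) a'_def in simp)
  from mult_le_mono2[OF this, of "(card V)\<^sup>2"]
  have "(card V)\<^sup>2 * card (map pair ` Q) * cnt pair j \<le> (card V)\<^sup>2 * card V * card E ^ gap * card (map pair ` T)"
    by (simp only: ac_simps)
  also have "\<dots> \<le> CC * (\<Sum>v\<in>hits u0. ext pair N (u @ v))"
    by (intro mult_le_mono CC_ge cT)
  finally have "fib u * fib u0 * cnt pair j \<le> CC * (\<Sum>v\<in>hits u0. ext pair N (u @ v))"
    using mult_right_mono[OF Q(4), of "cnt pair j"] unfolding fib_pair lu u0 P1_def P2_def by linarith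
  then have "real (fib u * fib u0 * cnt pair j) \<le> real (CC * (\<Sum>v\<in>hits u0. ext pair N (u @ v)))"
    by (simp only: of_nat_le_iff)
  then have f: "real (fib u) * real (fib u0) * real (cnt pair j) \<le> real CC * (\<Sum>v\<in>hits u0. real (ext pair N (u @ v)))"
    by simp
  have "exp (real (N - a - (k + gap)) * hI) \<le> exp (real j * hI)"
    using a'(2) hI_growth(1) by (simp add: mult_right_mono)
  also have "\<dots> \<le> real CC * real (cnt pair j)" by (rule hI_growth)
  finally have "exp (real (N - a - (k + gap)) * hI) * (real (fib u) * real (fib u0)) \<le> real CC * real (cnt pair j) * (real (fib u) * real (fib u0))"
    by (intro mult_right_mono) auto
  also have "\<dots> = real CC * (real (fib u) * real (fib u0) * real (cnt pair j))" by simp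
  also have "\<dots> \<le> real CC * (real CC * (\<Sum>v\<in>hits u0. real (ext pair N (u @ v))))" by (intro mult_left_mono f) simp
  finally show ?thesis by (simp add: power2_eq_square ac_simps)
qed

text \<open>This is \<open>powr_Hoelder_gap\<close> for the set \<open>hits u0\<close>. The number
  \<open>p0\<close> bounds its fibre-weighted share from below, and the first condition on
  \<open>\<tau>\<close> makes its counting share at most \<open>\<tau>\<close> times the
  fibre-weighted one. Neither depends on the prefix \<open>u\<close>, so the same loss recurs in
  every block.\<close>

lemma pressure_step:
  assumes u: "u \<in> map yd ` adm a" and u0: "length u0 = k" and N: "a + (k + gap) \<le> N"
    and t: "real (Suc gap * card E ^ gap) * real CC ^ 6 * exp (real gap * hI) * exp (real k * (hI - hy)) \<le> \<tau> * real (fib u0)"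
      "0 \<le> \<tau>" "\<tau> powr (1 - \<alpha>) \<le> \<alpha> / 2"
  defines "p0 \<equiv> real (fib u0) * exp (- (real (k + gap) * hI)) / real CC ^ 3"
  shows "(\<Sum>v\<in>map yd ` adm (k + gap). real (ext pair N (u @ v)) powr \<alpha> * real (ext yd N (u @ v)) powr (1 - \<alpha>))
    \<le> (1 - p0 * \<alpha> / 2) * (real (ext pair N u) powr \<alpha> * real (ext yd N u) powr (1 - \<alpha>))"
proof -
  define l where "l = N - a - (k + gap)"
  define S where "S = map yd ` adm (k + gap)"
  have lu: "length u = a" by (rule length_Y[OF u])
  have Na: "N - a = (k + gap) + l" unfolding l_def using N by simp
  have hitsS: "hits u0 \<subseteq> S" unfolding hits_def S_def u0 by blast
  have len_hits: "length v = k + gap" if "v \<in> hits u0" for v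
    using that hitsS unfolding S_def by (intro length_Y) blast
  have sumA: "(\<Sum>v\<in>S. real (ext pair N (u @ v))) = real (ext pair N u)"
    unfolding S_def using ext_split[of pair u "k + gap" N, OF det_pair] N lu by simp
  have sumB: "(\<Sum>v\<in>S. real (ext yd N (u @ v))) = real (ext yd N u)"
    unfolding S_def using ext_split[of yd u "k + gap" N] N lu by simp
  have u_pos: "0 < fib u" using u fib_ge_1 by fastforce
  have A_le: "real (ext pair N u) \<le> real (fib u) * (real CC * exp (real (k + gap + l) * hI))"
  proof -
    have "ext pair N u \<le> fib u * cnt pair (k + gap + l)" using ext_pair_le[of u N] N lu Na by simp
    then have "real (ext pair N u) \<le> real (fib u) * real (cnt pair (k + gap + l))" by (simp only: of_nat_mult[symmetric] of_nat_le_iff)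
    also have "\<dots> \<le> real (fib u) * (real CC * exp (real (k + gap + l) * hI))" by (intro mult_left_mono hI_growth) simp
    finally show ?thesis .
  qed
  define hA where "hA = (\<Sum>v\<in>hits u0. real (ext pair N (u @ v)))"
  define hB where "hB = (\<Sum>v\<in>hits u0. real (ext yd N (u @ v)))"
  have hA: "exp (real l * hI) * real (fib u) * real (fib u0) \<le> (real CC)\<^sup>2 * hA"
    unfolding hA_def l_def by (rule hits_lower[OF u u0 N])
  have hB: "hB \<le> real (Suc gap * card E ^ gap) * (real CC * exp (real l * hy))"
  proof -
    have "hB \<le> (\<Sum>v\<in>hits u0. real CC * exp (real l * hy))"
      unfolding hB_def
    proof (rule sum_mono)
      fix v assume v: "v \<in> hits u0"
      have "ext yd N (u @ v) \<le> cnt yd l"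
        using ext_yd_le[of "u @ v" N] N lu len_hits[OF v] unfolding l_def by simp
      then have "real (ext yd N (u @ v)) \<le> real (cnt yd l)" by simp
      with hy_growth(3)[of l] show "real (ext yd N (u @ v)) \<le> real CC * exp (real l * hy)" by linarith
    qed
    also have "\<dots> = real (card (hits u0)) * (real CC * exp (real l * hy))" by simp
    also have "\<dots> \<le> real (Suc gap * card E ^ gap) * (real CC * exp (real l * hy))"
    proof (rule mult_right_mono)
      show "real (card (hits u0)) \<le> real (Suc gap * card E ^ gap)"
        using card_hits[of u0] by (simp only: of_nat_le_iff)
    qed simp
    finally show ?thesis .
  qed
  have B_ge: "exp (real (k + l) * hy) \<le> (real CC)\<^sup>2 * real (ext yd N u)"
  proof -
    have "exp (real (k + l) * hy) \<le> exp (real (k + gap + l) * hy)" using hy_growth(1) by (simp add: mult_right_mono)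
    also have "\<dots> \<le> real CC * real (cnt yd (k + gap + l))" by (rule hy_growth)
    also have "\<dots> \<le> real CC * (real CC * real (ext yd N u))"
    proof (rule mult_left_mono)
      have "cnt yd (k + gap + l) \<le> CC * ext yd N u" using ext_yd_ge[OF u, of N] N Na by simp
      then show "real (cnt yd (k + gap + l)) \<le> real CC * real (ext yd N u)" by (simp only: of_nat_mult[symmetric] of_nat_le_iff)
    qed simp
    finally show ?thesis by (simp add: power2_eq_square)
  qed
  have pos: "0 < hA" "0 < real (ext pair N u)" "0 < real (ext yd N u)" if "0 < fib u0"
  proof -
    have "0 < exp (real l * hI) * real (fib u) * real (fib u0)" using u_pos that by simp
    then have "0 < (real CC)\<^sup>2 * hA" using hA by linarith
    then show "0 < hA" using CC_real by (simp add: zero_less_mult_iff)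
    have "hA \<le> (\<Sum>v\<in>S. real (ext pair N (u @ v)))"
      unfolding hA_def by (rule sum_mono2[OF _ hitsS]) (auto simp: S_def)
    then show "0 < real (ext pair N u)" unfolding sumA using \<open>0 < hA\<close> by linarith
    have "0 < (real CC)\<^sup>2 * real (ext yd N u)" using B_ge by (smt (verit) exp_gt_zero)
    then show "0 < real (ext yd N u)" using CC_real by (simp add: zero_less_mult_iff)
  qed
  have u0_pos: "0 < fib u0"
  proof (rule ccontr)
    assume "\<not> 0 < fib u0"
    then have "real (Suc gap * card E ^ gap) * real CC ^ 6 * exp (real gap * hI) * exp (real k * (hI - hy)) \<le> 0" using t(1) by simp
    moreover have "0 < real (Suc gap * card E ^ gap) * real CC ^ 6 * exp (real gap * hI) * exp (real k * (hI - hy))"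
      using CC_real by (intro mult_pos_pos zero_less_power hits_factor_pos) auto
    ultimately show False by linarith
  qed
  note pos = pos[OF u0_pos]
  have p: "p0 * real (ext pair N u) \<le> hA"
  proof -
    have "p0 * real (ext pair N u) \<le> p0 * (real (fib u) * (real CC * exp (real (k + gap + l) * hI)))"
      unfolding p0_def by (intro mult_left_mono A_le) auto
    also have "\<dots> = exp (real l * hI) * real (fib u) * real (fib u0) / (real CC)\<^sup>2"
    proof -
      define P where "P = exp (real (k + gap) * hI)"
      have "0 < P" unfolding P_def by simp
      have "p0 = real (fib u0) / (P * real CC ^ 3)"
        unfolding p0_def exp_minus P_def[symmetric] by (simp add: field_simps)
      moreover have "exp (real (k + gap + l) * hI) = P * exp (real l * hI)"
        unfolding P_def by (simp add: exp_add[symmetric] algebra_simps)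
      ultimately show ?thesis using CC_real \<open>0 < P\<close>
        by (simp add: power2_eq_square power3_eq_cube field_simps)
    qed
    also have "\<dots> \<le> hA" using hA CC_real by (simp add: field_simps)
    finally show ?thesis .
  qed
  \<comment> \<open>Of the six factors \<open>CC\<close>, two come from \<open>hB\<close> and
    \<open>A_le\<close>, two from \<open>B_ge\<close> and two from \<open>hA\<close>.\<close>
  have q: "hB * real (ext pair N u) \<le> \<tau> * hA * real (ext yd N u)"
  proof -
    define \<beta> where "\<beta> = real (Suc gap * card E ^ gap)"
    have "hB * real (ext pair N u) \<le> (\<beta> * (real CC * exp (real l * hy))) * (real (fib u) * (real CC * exp (real (k + gap + l) * hI)))"
      unfolding \<beta>_def by (intro mult_mono hB A_le) auto
    also have "\<dots> = (\<beta> * exp (real gap * hI) * exp (real k * (hI - hy)) * (real CC)\<^sup>2) * (exp (real l * hI) * real (fib u)) * exp (real (k + l) * hy)"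
    proof -
      have "exp (real l * hy) * exp (real (k + gap + l) * hI)
          = exp (real gap * hI) * exp (real k * (hI - hy)) * exp (real l * hI) * exp (real (k + l) * hy)"
        by (simp add: exp_add[symmetric] algebra_simps)
      then show ?thesis by (simp add: power2_eq_square ac_simps)
    qed
    also have "\<dots> \<le> (\<beta> * exp (real gap * hI) * exp (real k * (hI - hy)) * (real CC)\<^sup>2) * (exp (real l * hI) * real (fib u)) * ((real CC)\<^sup>2 * real (ext yd N u))"
      unfolding \<beta>_def by (intro mult_left_mono B_ge) auto
    also have "\<dots> = (\<beta> * real CC ^ 6 * exp (real gap * hI) * exp (real k * (hI - hy))) * (exp (real l * hI) * real (fib u)) * real (ext yd N u) / (real CC)\<^sup>2"
      using CC_real by (simp add: field_simps power2_eq_square eval_nat_numeral)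
    also have "\<dots> \<le> (\<tau> * real (fib u0)) * (exp (real l * hI) * real (fib u)) * real (ext yd N u) / (real CC)\<^sup>2"
      using t(1) unfolding \<beta>_def by (intro divide_right_mono mult_right_mono) auto
    also have "\<dots> = \<tau> * (exp (real l * hI) * real (fib u) * real (fib u0)) * real (ext yd N u) / (real CC)\<^sup>2" by simp
    also have "\<dots> \<le> \<tau> * ((real CC)\<^sup>2 * hA) * real (ext yd N u) / (real CC)\<^sup>2"
      by (intro divide_right_mono mult_right_mono mult_left_mono hA t(2)) auto
    also have "\<dots> = \<tau> * hA * real (ext yd N u)" using CC_real by simp
    finally show ?thesis .
  qed
  have "(\<Sum>v\<in>S. real (ext pair N (u @ v)) powr \<alpha> * real (ext yd N (u @ v)) powr (1 - \<alpha>))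
    \<le> (1 - p0 * \<alpha> / 2) * ((\<Sum>v\<in>S. real (ext pair N (u @ v))) powr \<alpha> * (\<Sum>v\<in>S. real (ext yd N (u @ v))) powr (1 - \<alpha>))"
    by (rule powr_Hoelder_gap[where B = "hits u0" and t = \<tau>])
      (use \<alpha>_bounds hitsS pos p q t(2,3) in \<open>simp_all add: sumA sumB S_def[symmetric] hA_def[symmetric] hB_def[symmetric], simp add: S_def\<close>)
  then show ?thesis unfolding sumA sumB unfolding S_def .
qed


text \<open>At the empty prefix the Hoelder product is the one bounded by
  \<open>Hoelder_growth\<close>. At prefixes of full length it is \<open>fib u\<close> to the power
  \<open>\<alpha>\<close>, because there \<open>ext pair N u = fib u\<close> and
  \<open>ext yd N u = 1\<close>. In between, each of the \<open>M\<close> blocks loses a factor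
  \<open>\<theta>\<close>.\<close>

lemma fib_pressure_decay:
  assumes u0: "length u0 = k" and M: "N = M * (k + gap)"
    and \<tau>: "real (Suc gap * card E ^ gap) * real CC ^ 6 * exp (real gap * hI) * exp (real k * (hI - hy)) \<le> \<tau> * real (fib u0)"
      "0 \<le> \<tau>" "\<tau> powr (1 - \<alpha>) \<le> \<alpha> / 2"
    and \<theta>: "1 - real (fib u0) * exp (- (real (k + gap) * hI)) / real CC ^ 3 * \<alpha> / 2 \<le> \<theta>" "0 \<le> \<theta>"
  shows "fib_pressure N \<le> \<theta> ^ M * (real CC * exp (real N * (dB * ln (real m))))"
proof -
  define b where "b = k + gap"
  define f where "f u = real (ext pair N u) powr \<alpha> * real (ext yd N u) powr (1 - \<alpha>)" for u
  have f0: "0 \<le> f u" for u unfolding f_def by simp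
  have step: "(\<Sum>v\<in>map yd ` adm b. f (u @ v)) \<le> \<theta> * f u" if "u \<in> map yd ` adm (j * b)" "j < M" for u j
  proof -
    have "Suc j * b \<le> M * b" using that(2) by (intro mult_right_mono) auto
    then have "j * b + (k + gap) \<le> N" unfolding M b_def by simp
    from pressure_step[OF that(1) u0 this \<tau>]
    have "(\<Sum>v\<in>map yd ` adm b. f (u @ v)) \<le> (1 - real (fib u0) * exp (- (real (k + gap) * hI)) / real CC ^ 3 * \<alpha> / 2) * f u"
      unfolding f_def b_def .
    also have "\<dots> \<le> \<theta> * f u" by (intro mult_right_mono \<theta> f0)
    finally show ?thesis .
  qed
  have iter: "j \<le> M \<Longrightarrow> (\<Sum>u\<in>map yd ` adm (j * b). f u) \<le> \<theta> ^ j * f []" for j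
  proof (induction j)
    case 0
    have "map yd ` adm 0 = {[]}" by (auto simp: adm_words_def)
    then show ?case by simp
  next
    case (Suc j)
    define Y Y' where "Y = map yd ` adm (j * b)" and "Y' = map yd ` adm b"
    have inj: "inj_on (\<lambda>(x, y). x @ y) (Y \<times> Y')"
    proof (rule inj_onI, clarify)
      fix x y x' y' assume "x \<in> Y" "x' \<in> Y" "x @ y = x' @ y'"
      moreover from this have "length x = length x'" unfolding Y_def by (metis length_Y)
      ultimately show "x = x' \<and> y = y'" by simp
    qed
    have sub: "map yd ` adm (Suc j * b) \<subseteq> (\<lambda>(x, y). x @ y) ` (Y \<times> Y')"
    proof
      fix u assume "u \<in> map yd ` adm (Suc j * b)"
      then obtain w where w: "w \<in> adm (j * b + b)" "u = map yd w" by (auto simp: add.commute)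
      have "u = map yd (take (j * b) w) @ map yd (drop (j * b) w)"
        unfolding w(2) map_append[symmetric] by simp
      then show "u \<in> (\<lambda>(x, y). x @ y) ` (Y \<times> Y')"
        unfolding Y_def Y'_def using adm_take_drop[OF w(1)] by blast
    qed
    have "(\<Sum>u\<in>map yd ` adm (Suc j * b). f u) \<le> (\<Sum>u\<in>(\<lambda>(x, y). x @ y) ` (Y \<times> Y'). f u)"
      by (rule sum_mono2[OF _ sub f0]) (simp add: Y_def Y'_def)
    also have "\<dots> = (\<Sum>(u, v)\<in>Y \<times> Y'. f (u @ v))"
      unfolding sum.reindex[OF inj] by (simp add: case_prod_beta o_def)
    also have "\<dots> = (\<Sum>u\<in>Y. \<Sum>v\<in>Y'. f (u @ v))" by (rule sum.cartesian_product[symmetric])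
    also have "\<dots> \<le> (\<Sum>u\<in>Y. \<theta> * f u)"
      unfolding Y_def Y'_def using Suc.prems by (intro sum_mono step) auto
    also have "\<dots> = \<theta> * (\<Sum>u\<in>Y. f u)" by (rule sum_distrib_left[symmetric])
    also have "\<dots> \<le> \<theta> * (\<theta> ^ j * f [])"
      unfolding Y_def using Suc by (intro mult_left_mono \<theta>(2)) auto
    finally show ?case by simp
  qed
  have "f u = real (fib u) powr \<alpha>" if u: "u \<in> map yd ` adm N" for u
  proof -
    obtain w where w: "w \<in> adm N" "u = map yd w" using u by blast
    have lu: "length u = N" by (rule length_Y[OF u])
    have "take N (map yd w') = map yd w'" if "w' \<in> adm N" for w' using adm_length[OF that] by simp
    then have "{w \<in> adm N. take (length u) (map yd w) = u} = {w \<in> adm (length u). map yd w = u}"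
      unfolding lu by auto
    moreover have "map yd ` {w \<in> adm (length u). map yd w = u} = {u}"
      unfolding lu using w by blast
    ultimately have "ext pair N u = fib u" "ext yd N u = 1" unfolding ext_def fib_pair by simp_all
    then show ?thesis unfolding f_def by simp
  qed
  then have "fib_pressure N = (\<Sum>u\<in>map yd ` adm (M * b). f u)"
    unfolding fib_pressure_def b_def M[symmetric] by (intro sum.cong) auto
  also have "\<dots> \<le> \<theta> ^ M * f []" by (rule iter) simp
  also have "f [] = real (cnt pair N) powr \<alpha> * real (cnt yd N) powr (1 - \<alpha>)"
    unfolding f_def ext_def cnt_def by simp
  also have "\<theta> ^ M * (real (cnt pair N) powr \<alpha> * real (cnt yd N) powr (1 - \<alpha>)) \<le> \<theta> ^ M * (real CC * exp (real N * (dB * ln (real m))))"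
    using \<theta>(2) by (intro mult_left_mono Hoelder_growth) simp
  finally show ?thesis .
qed

lemma hausdorff_dim_less_dB:
  assumes strict: "hI < hy + hF"
  shows "hausdorff_dim X < dB"
proof -
  \<comment> \<open>The seventh \<open>CC\<close> is spent on replacing \<open>exp (k * hF)\<close>
    by \<open>max_fib k\<close>.\<close>
  define \<beta> where "\<beta> = real (Suc gap * card E ^ gap) * real CC ^ 7 * exp (real gap * hI)"
  define \<gamma> where "\<gamma> = hy + hF - hI"
  have \<beta>: "0 < \<beta>" unfolding \<beta>_def using CC_real by (intro mult_pos_pos zero_less_power hits_factor_pos) auto
  have \<gamma>: "0 < \<gamma>" using strict unfolding \<gamma>_def by simp
  define \<tau> where "\<tau> = (\<alpha> / 2) powr (1 / (1 - \<alpha>))"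
  have \<tau>: "0 < \<tau>" unfolding \<tau>_def using \<alpha>_bounds by simp
  have \<tau>2: "\<tau> powr (1 - \<alpha>) \<le> \<alpha> / 2" unfolding \<tau>_def powr_powr using \<alpha>_bounds by simp
  \<comment> \<open>The ratio of the fibre-weighted to the counting frequency of an optimal word of
    length \<open>k\<close> grows like \<open>exp (k * \<gamma>)\<close>, up to constants;
    \<open>k\<close> is taken so large that this exceeds \<open>\<beta> / \<tau>\<close>.\<close>
  obtain k0 where k0: "ln (\<beta> / \<tau>) / \<gamma> < real k0" using reals_Archimedean2 by blast
  define k where "k = Suc k0"
  have "ln (\<beta> / \<tau>) < real k0 * \<gamma>" using k0 \<gamma> by (simp only: pos_divide_less_eq)
  also have "\<dots> \<le> real k * \<gamma>" unfolding k_def using \<gamma> by (intro mult_right_mono) auto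
  finally have "exp (ln (\<beta> / \<tau>)) \<le> exp (real k * \<gamma>)" by simp
  then have "\<beta> / \<tau> \<le> exp (real k * \<gamma>)" using \<beta> \<tau> by simp
  then have \<beta>\<tau>: "\<beta> \<le> \<tau> * exp (real k * \<gamma>)" using \<tau> by (simp add: field_simps)
  obtain u0 where u0: "fib u0 = max_fib k" "length u0 = k" using max_fib_attained[of k] by metis
  have key: "real (Suc gap * card E ^ gap) * real CC ^ 6 * exp (real gap * hI) * exp (real k * (hI - hy)) \<le> \<tau> * real (fib u0)"
  proof -
    define c where "c = real (Suc gap * card E ^ gap) * real CC ^ 6 * exp (real gap * hI)"
    have "\<beta> = real CC * c" unfolding \<beta>_def c_def by (simp add: eval_nat_numeral)
    then have "real CC * c * exp (real k * (hI - hy)) \<le> \<tau> * exp (real k * \<gamma>) * exp (real k * (hI - hy))"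
      using \<beta>\<tau> by (intro mult_right_mono) auto
    also have "\<dots> = \<tau> * exp (real k * hF)"
      unfolding \<gamma>_def by (simp add: exp_add[symmetric] algebra_simps)
    also have "\<dots> \<le> \<tau> * (real CC * real (fib u0))"
      unfolding u0(1) using \<tau> hF_growth(2) by (intro mult_left_mono) auto
    finally have "real CC * (c * exp (real k * (hI - hy))) \<le> real CC * (\<tau> * real (fib u0))" by (simp add: ac_simps)
    then show ?thesis unfolding c_def using CC_real by simp
  qed
  \<comment> \<open>\<open>\<theta>\<close> depends on the word \<open>u0\<close>, which is now
    fixed, but not on the number \<open>M\<close> of blocks, so its powers eventually beat
    \<open>CC\<close>. The maximum with \<open>0\<close> only keeps it nonnegative.\<close>
  define \<theta> where "\<theta> = max 0 (1 - real (fib u0) * exp (- (real (k + gap) * hI)) / real CC ^ 3 * \<alpha> / 2)"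
  have \<theta>: "0 \<le> \<theta>" "\<theta> < 1"
  proof -
    have "0 < real (fib u0)" unfolding u0(1) using max_fib_ge_1[of k] by linarith
    then have "0 < real (fib u0) * exp (- (real (k + gap) * hI)) / real CC ^ 3 * \<alpha> / 2"
      using CC_real \<alpha>_bounds by simp
    then show "0 \<le> \<theta>" "\<theta> < 1" unfolding \<theta>_def by auto
  qed
  have "(\<lambda>M. \<theta> ^ M * real CC) \<longlonglongrightarrow> 0 * real CC"
    using \<theta> by (intro tendsto_intros LIMSEQ_power_zero) auto
  then have "eventually (\<lambda>M. \<theta> ^ M * real CC < 1) sequentially" by (intro order_tendstoD(2)[of _ "0 * real CC"]) auto
  then have "eventually (\<lambda>M. \<theta> ^ M * real CC < 1 \<and> 1 \<le> M) sequentially"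
    using eventually_ge_at_top[of 1] by (rule eventually_conj)
  then obtain M where M: "\<theta> ^ M * real CC < 1" "1 \<le> M"
    using eventually_happens'[OF sequentially_bot] by blast
  define N where "N = M * (k + gap)"
  have N: "1 \<le> N" unfolding N_def k_def using M(2) by (simp add: Suc_le_eq)
  have "fib_pressure N \<le> \<theta> ^ M * (real CC * exp (real N * (dB * ln (real m))))"
    by (rule fib_pressure_decay[OF u0(2) N_def key]) (use \<tau> \<tau>2 \<theta> in \<open>auto simp: \<theta>_def\<close>)
  also have "\<dots> = (\<theta> ^ M * real CC) * exp (real N * (dB * ln (real m)))" by simp
  also have "\<dots> < 1 * exp (real N * (dB * ln (real m)))" by (intro mult_strict_right_mono M) simp
  finally have "fib_pressure N < exp (real N * (dB * ln (real m)))" by simp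
  moreover have "0 < fib_pressure N" using fib_pressure_ge_1[of N] by linarith
  ultimately have "ln (fib_pressure N) < real N * (dB * ln (real m))" by (metis exp_ln exp_less_cancel_iff)
  then have "ln (fib_pressure N) < dB * (real N * ln (real m))" by (simp add: ac_simps)
  then have "ln (fib_pressure N) / (real N * ln (real m)) < dB"
    using N ln_m_pos by (subst pos_divide_less_eq) auto
  with hausdorff_dim_le_pressure[OF N] show ?thesis by linarith
qed

section \<open>Hausdorff dimension: lower bound\<close>

text \<open>The points counted are coded by concatenations of the loops: these generate a self-affine
  set with uniform fibres inside \<open>X\<close>.\<close>

lemma uniform_loops_mass:
  assumes W: "\<And>w. w \<in> W \<Longrightarrow> walk v w v \<and> length w = L" "inj_on (map pair) W" "v \<in> V" and L: "1 \<le> L"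
    and a: "card (map yd ` W) = a" "1 \<le> a"
    and b: "\<And>u. u \<in> map yd ` W \<Longrightarrow> card {w \<in> W. map yd w = u} = b" "1 \<le> b"
  defines "d \<equiv> (ln (real a) + \<alpha> * ln (real b)) / (real L * ln (real m))"
  shows "\<exists>C>0. \<forall>r0>0. \<exists>(T :: (nat \<Rightarrow> 'e list) set) p. finite T \<and> T \<noteq> {} \<and> p ` T \<subseteq> X \<and>
      (\<forall>r U. r0 \<le> r \<longrightarrow> r \<le> 1 \<longrightarrow> bounded U \<longrightarrow> diameter U \<le> r \<longrightarrow>
        real (card {\<tau> \<in> T. p \<tau> \<in> U}) \<le> C * r powr d * real (card T))"
proof -
  have W_adm: "W \<subseteq> adm L" using W(1,3) by (auto intro: admI)
  have finW: "finite W" by (rule finite_subset[OF W_adm finite_adm])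
  have neW: "W \<noteq> {}" using a by auto
  have cardW: "card W = a * b"
  proof -
    have "card W = (\<Sum>w\<in>W. 1)" by simp
    also have "\<dots> = (\<Sum>u\<in>map yd ` W. \<Sum>w\<in>{w. w \<in> W \<and> map yd w = u}. 1)" by (rule sum.image_gen[OF finW])
    also have "\<dots> = (\<Sum>u\<in>map yd ` W. b)" by (intro sum.cong refl) (simp add: b(1))
    finally show ?thesis using a(1) by simp
  qed
  have d: "d * (real L * ln (real m)) = ln (real a) + \<alpha> * ln (real b)"
    unfolding d_def using L ln_m_pos by simp
  have d0: "0 \<le> d"
    unfolding d_def using L ln_m_pos a(2) b(2) \<alpha>_bounds by (intro divide_nonneg_nonneg add_nonneg_nonneg mult_nonneg_nonneg) auto
  \<comment> \<open>Here \<open>9\<close> is the grid count, \<open>b\<close> pays for the rounding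
    in \<open>lev\<close>, and the last factor for rounding the scale \<open>r\<close> to a multiple
    of \<open>L\<close> levels.\<close>
  define C where "C = 9 * real b * (real m ^ L) powr d"
  have C: "0 < C" unfolding C_def using b(2) m_pos by simp
  have "\<exists>(T :: (nat \<Rightarrow> 'e list) set) p. finite T \<and> T \<noteq> {} \<and> p ` T \<subseteq> X \<and>
      (\<forall>r U. r0 \<le> r \<longrightarrow> r \<le> 1 \<longrightarrow> bounded U \<longrightarrow> diameter U \<le> r \<longrightarrow>
        real (card {\<tau> \<in> T. p \<tau> \<in> U}) \<le> C * r powr d * real (card T))" if r0: "0 < r0" for r0 :: real
  proof -
    have "1 < real m ^ L" using m_ge_2 L by (intro one_less_power) auto
    \<comment> \<open>Sequences of \<open>N\<close> loops resolve all scales down to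
      \<open>r0\<close>: the level \<open>k\<close> belonging to a scale \<open>r \<ge> r0\<close>
      will be at most \<open>N\<close>.\<close>
    from real_arch_pow[OF this, of "1 / r0"] obtain N where "1 / r0 < (real m ^ L) ^ N" by blast
    then have N: "1 < r0 * real m ^ (N * L)" using r0 by (simp add: field_simps power_mult[symmetric])
    define T where "T = PiE {..<N} (\<lambda>_. W)"
    define cw where "cw \<tau> = concat (map \<tau> [0..<N])" for \<tau> :: "nat \<Rightarrow> 'e list"
    have finT: "finite T" unfolding T_def using finW by (intro finite_PiE) auto
    have neT: "T \<noteq> {}" unfolding T_def using neW by (simp add: PiE_eq_empty_iff)
    have cardT: "card T = (a * b) ^ N" unfolding T_def by (simp add: card_PiE cardW)
    have \<tau>W: "\<tau> j \<in> W" if "\<tau> \<in> T" "j < N" for \<tau> j using that unfolding T_def by auto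
    have \<tau>len: "length (\<tau> j) = L" if "\<tau> \<in> T" "j < N" for \<tau> j using W(1)[OF \<tau>W[OF that]] by simp
    have cw_adm: "cw \<tau> \<in> adm (N * L)" if \<tau>: "\<tau> \<in> T" for \<tau>
    proof -
      have "walk v (concat (map \<tau> [0..<k])) v" if "k \<le> N" for k
        using that
      proof (induction k)
        case (Suc k)
        then have "walk v (\<tau> k) v" using W(1)[OF \<tau>W[OF \<tau>, of k]] by simp
        with Suc show ?case by (auto simp: walk_append)
      qed simp
      moreover have "length (cw \<tau>) = N * L"
        unfolding cw_def by (rule length_concat_const) (use \<tau>len[OF \<tau>] in blast)
      ultimately show ?thesis using W(3) unfolding cw_def by (intro admI) auto
    qed
    have block: "take L (drop (j * L) (cw \<tau>)) = \<tau> j" if "\<tau> \<in> T" "j < N" for \<tau> j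
      unfolding cw_def by (rule block_of_concat) (use \<tau>len that in auto)
    have mass: "real (card {\<tau> \<in> T. pt (cw \<tau>) \<in> U}) \<le> C * r powr d * real (card T)"
      if r: "r0 \<le> r" "r \<le> 1" and U: "bounded U" "diameter U \<le> r" for r U
    proof -
      have r_pos: "0 < r" using r r0 by linarith
      obtain k' where k': "r * real m ^ k' \<le> 1" "1 < r * real m ^ Suc k'" using level_of_scale[OF r_pos r(2)] .
      define k where "k = k' div L"
      have kk': "k * L \<le> k'" "Suc k' \<le> (k + 1) * L"
        unfolding k_def using L dividend_less_div_times[of L k'] by (auto simp: algebra_simps)
      have k1: "r * real m ^ (k * L) \<le> 1"
      proof -
        have "real m ^ (k * L) \<le> real m ^ k'" using kk'(1) m_pos by (intro power_increasing) auto
        then have "r * real m ^ (k * L) \<le> r * real m ^ k'" using r_pos by (intro mult_left_mono) auto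
        with k' show ?thesis by linarith
      qed
      have k2: "1 < r * (real m ^ (k * L) * real m ^ L)"
      proof -
        have "real m ^ Suc k' \<le> real m ^ ((k + 1) * L)" using kk'(2) m_pos by (intro power_increasing) auto
        then have "r * real m ^ Suc k' \<le> r * real m ^ ((k + 1) * L)" using r_pos by (intro mult_left_mono) auto
        with k'(2) show ?thesis by (simp add: power_add mult.commute algebra_simps)
      qed
      have kN: "k \<le> N"
      proof (rule ccontr)
        assume "\<not> k \<le> N"
        then have "N * L \<le> k * L" by (intro mult_right_mono) auto
        then have "real m ^ (N * L) \<le> real m ^ (k * L)" using m_pos by (intro power_increasing) auto
        then have "r0 * real m ^ (N * L) \<le> r * real m ^ (k * L)" using r r0 by (intro mult_mono) auto
        with N k1 show False by linarith
      qed
      define l where "l = lev k"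
      have lk: "l \<le> k" unfolding l_def by (rule lev_le)
      have kL: "k * L \<le> N * L" "l * L \<le> N * L" using kN lk by (auto intro: mult_right_mono)
      define c where "c \<tau> = (take (l * L) (map xd (cw \<tau>)), take (k * L) (map yd (cw \<tau>)))" for \<tau>
      define TU where "TU = {\<tau> \<in> T. pt (cw \<tau>) \<in> U}"
      have finTU: "finite TU" unfolding TU_def using finT by simp
      have few: "card (c ` TU) \<le> 9"
      proof -
        have "card ((\<lambda>\<tau>. (take (l * L) (map xd (cw \<tau>)), take (k * L) (map yd (cw \<tau>)))) ` TU) \<le> (1 + 2)\<^sup>2"
        proof (rule grid_count[where p = "\<lambda>\<tau>. pt (cw \<tau>)" and n = n and m = m and l = "l * L" and k = "k * L" and r = r])
          fix \<tau> assume "\<tau> \<in> TU"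
          then have wa: "cw \<tau> \<in> adm (N * L)" using cw_adm unfolding TU_def by blast
          have lw: "length (cw \<tau>) = N * L" by (rule adm_length[OF wa])
          have "\<forall>d\<in>set (take (l * L) (map xd (cw \<tau>))). d < n" "\<forall>d\<in>set (take (k * L) (map yd (cw \<tau>))). d < m"
            using adm_digits[OF wa] set_take_subset[of "l * L" "map xd (cw \<tau>)"] set_take_subset[of "k * L" "map yd (cw \<tau>)"] by blast+
          then show "in_cell n (fst (pt (cw \<tau>))) (take (l * L) (map xd (cw \<tau>))) \<and> length (take (l * L) (map xd (cw \<tau>))) = l * L
              \<and> (\<forall>d\<in>set (take (l * L) (map xd (cw \<tau>))). d < n)"
            "in_cell m (snd (pt (cw \<tau>))) (take (k * L) (map yd (cw \<tau>))) \<and> length (take (k * L) (map yd (cw \<tau>))) = k * L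
              \<and> (\<forall>d\<in>set (take (k * L) (map yd (cw \<tau>))). d < m)"
            using in_cell_take[OF pt(2)[OF wa] adm_digits(1)[OF wa] n_pos] in_cell_take[OF pt(3)[OF wa] adm_digits(2)[OF wa] m_pos]
              lw kL by simp_all
        next
          fix \<sigma> \<tau> assume "\<sigma> \<in> TU" "\<tau> \<in> TU"
          then have "dist (pt (cw \<sigma>)) (pt (cw \<tau>)) \<le> diameter U" unfolding TU_def using U(1) by (auto intro: diameter_bounded_bound)
          then show "dist (pt (cw \<sigma>)) (pt (cw \<tau>)) \<le> r" using U(2) by linarith
        next
          have "(real n ^ l) ^ L \<le> (real m ^ k) ^ L" unfolding l_def by (intro power_mono n_power_lev) simp
          then have "r * real n ^ (l * L) \<le> r * real m ^ (k * L)" using r_pos by (simp add: power_mult)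
          then show "r * real n ^ (l * L) \<le> real 1" using k1 by simp
          show "r * real m ^ (k * L) \<le> real 1" using k1 by simp
        qed (rule finTU)
        then show ?thesis unfolding c_def[abs_def] by (simp add: power2_eq_square)
      qed
      have class_count: "card {\<tau> \<in> T. c \<tau> = c \<tau>0} * (a ^ k * b ^ l) \<le> (a * b) ^ N" if \<tau>0: "\<tau>0 \<in> T" for \<tau>0
      proof -
        \<comment> \<open>A box containing all sequences with the code of \<open>\<tau>0\<close>:
          the first \<open>l\<close> loops coincide since \<open>map pair\<close> is injective on
          \<open>W\<close>, those from \<open>l\<close> to \<open>k\<close> have a prescribed
          \<open>y\<close>-word and hence \<open>b\<close> choices, and the rest are free.\<close>
        define B where "B j = (if j < l then {\<tau>0 j} else if j < k then {w \<in> W. map yd w = map yd (\<tau>0 j)} else W)" for j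
        have "{\<tau> \<in> T. c \<tau> = c \<tau>0} \<subseteq> PiE {..<N} B"
        proof
          fix \<tau> assume "\<tau> \<in> {\<tau> \<in> T. c \<tau> = c \<tau>0}"
          then have \<tau>: "\<tau> \<in> T" "c \<tau> = c \<tau>0" by auto
          have yb: "map yd (\<tau> j) = map yd (\<tau>0 j)" if j: "j < k" for j
          proof -
            have jN: "j < N" using j kN by simp
            have "Suc j * L \<le> k * L" using j by (intro mult_right_mono) auto
            then have "min (k * L - j * L) L = L" by simp
            then have blk: "map yd (\<sigma> j) = take L (drop (j * L) (take (k * L) (map yd (cw \<sigma>))))" if "\<sigma> \<in> T" for \<sigma>
              unfolding block[OF that jN, symmetric] by (simp add: take_map drop_map drop_take min.commute)
            show ?thesis unfolding blk[OF \<tau>(1)] blk[OF \<tau>0] using \<tau>(2) unfolding c_def by simp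
          qed
          have xb: "\<tau> j = \<tau>0 j" if j: "j < l" for j
          proof -
            have jN: "j < N" "j < k" using j kN lk by auto
            have "Suc j * L \<le> l * L" using j by (intro mult_right_mono) auto
            then have "min (l * L - j * L) L = L" by simp
            then have blk: "map xd (\<sigma> j) = take L (drop (j * L) (take (l * L) (map xd (cw \<sigma>))))" if "\<sigma> \<in> T" for \<sigma>
              unfolding block[OF that jN(1), symmetric] by (simp add: take_map drop_map drop_take min.commute)
            have "map xd (\<tau> j) = map xd (\<tau>0 j)" unfolding blk[OF \<tau>(1)] blk[OF \<tau>0] using \<tau>(2) unfolding c_def by simp
            then have "map pair (\<tau> j) = map pair (\<tau>0 j)" using yb[OF jN(2)] unfolding map_pair_eq_iff by simp
            with W(2) show ?thesis using \<tau>W[OF \<tau>(1) jN(1)] \<tau>W[OF \<tau>0 jN(1)] by (rule inj_onD)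
          qed
          show "\<tau> \<in> PiE {..<N} B"
          proof (rule PiE_I)
            fix j assume "j \<in> {..<N}"
            then have "\<tau> j \<in> W" using \<tau>W[OF \<tau>(1)] by simp
            then show "\<tau> j \<in> B j" unfolding B_def using xb yb by auto
          next
            fix j assume "j \<notin> {..<N}"
            then show "\<tau> j = undefined" using \<tau>(1) unfolding T_def by (auto dest: PiE_arb)
          qed
        qed
        moreover have "finite (PiE {..<N} B)" using finW unfolding B_def by (intro finite_PiE) auto
        ultimately have "card {\<tau> \<in> T. c \<tau> = c \<tau>0} \<le> card (PiE {..<N} B)" by (intro card_mono)
        also have "\<dots> = (\<Prod>j<N. card (B j))" by (rule card_PiE) simp
        finally have le: "card {\<tau> \<in> T. c \<tau> = c \<tau>0} \<le> (\<Prod>j<N. card (B j))" .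
        have Aeq: "a ^ k = (\<Prod>j<N. if j < k then a else 1)"
        proof -
          have "(\<Prod>j<N. if j < k then a else 1) = (\<Prod>j<k. a)"
            using kN by (intro prod.mono_neutral_cong_right) auto
          then show ?thesis by simp
        qed
        have Beq: "b ^ l = (\<Prod>j<N. if j < l then b else 1)"
        proof -
          have "(\<Prod>j<N. if j < l then b else 1) = (\<Prod>j<l. b)"
            using kN lk by (intro prod.mono_neutral_cong_right) auto
          then show ?thesis by simp
        qed
        have "card {\<tau> \<in> T. c \<tau> = c \<tau>0} * (a ^ k * b ^ l) \<le> (\<Prod>j<N. card (B j)) * (a ^ k * b ^ l)"
          by (rule mult_right_mono[OF le]) simp
        also have "\<dots> = (\<Prod>j<N. card (B j)) * ((\<Prod>j<N. if j < k then a else 1) * (\<Prod>j<N. if j < l then b else 1))"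
          unfolding Aeq Beq ..
        also have "\<dots> = (\<Prod>j<N. a * b)"
          unfolding prod.distrib[symmetric]
        proof (rule prod.cong[OF refl])
          fix j assume "j \<in> {..<N}"
          then have "map yd (\<tau>0 j) \<in> map yd ` W" using \<tau>W[OF \<tau>0] by blast
          then show "card (B j) * ((if j < k then a else 1) * (if j < l then b else 1)) = a * b"
            unfolding B_def using lk by (auto simp: b(1) cardW)
        qed
        finally show ?thesis by simp
      qed
      have "TU = (\<Union>z\<in>c ` TU. {\<tau> \<in> TU. c \<tau> = z})" by auto
      then have "card TU \<le> (\<Sum>z\<in>c ` TU. card {\<tau> \<in> TU. c \<tau> = z})"
        using card_UN_le[of "c ` TU" "\<lambda>z. {\<tau> \<in> TU. c \<tau> = z}"] finTU by simp
      then have "card TU * (a ^ k * b ^ l) \<le> (\<Sum>z\<in>c ` TU. card {\<tau> \<in> TU. c \<tau> = z}) * (a ^ k * b ^ l)"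
        by (rule mult_right_mono) simp
      also have "\<dots> = (\<Sum>z\<in>c ` TU. card {\<tau> \<in> TU. c \<tau> = z} * (a ^ k * b ^ l))" by (rule sum_distrib_right)
      also have "\<dots> \<le> (\<Sum>z\<in>c ` TU. (a * b) ^ N)"
      proof (rule sum_mono)
        fix z assume "z \<in> c ` TU"
        then obtain \<tau>0 where \<tau>0: "\<tau>0 \<in> T" "z = c \<tau>0" unfolding TU_def by blast
        have "card {\<tau> \<in> TU. c \<tau> = z} \<le> card {\<tau> \<in> T. c \<tau> = c \<tau>0}"
          using finT unfolding TU_def \<tau>0(2) by (intro card_mono) auto
        then have "card {\<tau> \<in> TU. c \<tau> = z} * (a ^ k * b ^ l) \<le> card {\<tau> \<in> T. c \<tau> = c \<tau>0} * (a ^ k * b ^ l)"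
          by (rule mult_right_mono) simp
        with class_count[OF \<tau>0(1)] show "card {\<tau> \<in> TU. c \<tau> = z} * (a ^ k * b ^ l) \<le> (a * b) ^ N" by linarith
      qed
      also have "\<dots> \<le> 9 * (a * b) ^ N" using few by simp
      finally have "real (card TU * (a ^ k * b ^ l)) \<le> real (9 * card T)" unfolding cardT by (simp only: of_nat_le_iff)
      then have cTU: "real (card TU) * (real a ^ k * real b ^ l) \<le> 9 * real (card T)" by simp
      have ab_pos: "0 < real a ^ k * real b ^ l" using a(2) b(2) by simp
      have "(1 / r) powr d \<le> (real m ^ (k * L) * real m ^ L) powr d"
        using k2 r_pos d0 by (intro powr_mono2) (auto simp: field_simps)
      also have "\<dots> = (real m ^ L) powr d * (real m ^ (k * L)) powr d" by (simp add: powr_mult)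
      also have "(real m ^ (k * L)) powr d = exp (real k * (ln (real a) + \<alpha> * ln (real b)))"
        unfolding m_power_powr d[symmetric] by (simp add: ac_simps)
      also have "(real m ^ L) powr d * exp (real k * (ln (real a) + \<alpha> * ln (real b)))
          \<le> (real m ^ L) powr d * (real b * (real a ^ k * real b ^ l))"
      proof (rule mult_left_mono)
        have "\<alpha> * real k * ln (real b) \<le> (real l + 1) * ln (real b)"
          using lev_bounds(2)[of k] b(2) unfolding l_def by (intro mult_right_mono) auto
        then have "exp (real k * (ln (real a) + \<alpha> * ln (real b))) \<le> exp (ln (real b) + (real k * ln (real a) + real l * ln (real b)))"
          by (simp add: algebra_simps)
        also have "\<dots> = real b * (real a ^ k * real b ^ l)"
          using a(2) b(2) by (simp add: exp_add exp_of_nat_mult)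
        finally show "exp (real k * (ln (real a) + \<alpha> * ln (real b))) \<le> real b * (real a ^ k * real b ^ l)" .
      qed simp
      finally have rd: "(1 / r) powr d \<le> (real m ^ L) powr d * (real b * (real a ^ k * real b ^ l))" .
      have "real (card TU) * (1 / r) powr d \<le> real (card TU) * ((real m ^ L) powr d * (real b * (real a ^ k * real b ^ l)))"
        by (intro mult_left_mono rd) simp
      also have "\<dots> = (real m ^ L) powr d * real b * (real (card TU) * (real a ^ k * real b ^ l))" by simp
      also have "\<dots> \<le> (real m ^ L) powr d * real b * (9 * real (card T))" by (intro mult_left_mono cTU) simp
      also have "\<dots> = C * real (card T)" unfolding C_def by simp
      finally have "real (card TU) * (1 / r) powr d * r powr d \<le> C * real (card T) * r powr d"
        by (rule mult_right_mono) simp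
      moreover have "(1 / r) powr d * r powr d = 1" using r_pos by (simp flip: powr_mult)
      ultimately show ?thesis unfolding TU_def[symmetric] by (simp add: mult.assoc ac_simps)
    qed
    have "(\<lambda>\<tau>. pt (cw \<tau>)) ` T \<subseteq> X" using pt(1) cw_adm by blast
    with finT neT mass show ?thesis by (intro exI[of _ T] exI[of _ "\<lambda>\<tau>. pt (cw \<tau>)"]) blast
  qed
  with C show ?thesis by blast
qed

text \<open>\<open>hausdorff_dim\<close> is an infimum, so some exponent of measure zero must exist;
  \<open>hausdorff_measure_zero\<close> with \<open>L = 1\<close> supplies a large one.\<close>

lemma hausdorff_dim_ge:
  assumes "\<And>s. 0 < s \<Longrightarrow> hausdorff_measure s X = 0 \<Longrightarrow> d \<le> s"
  shows "d \<le> hausdorff_dim X"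
proof -
  define s where "s = max 1 (ln (fib_pressure 1) / ln (real m) + 1)"
  have "ln (fib_pressure 1) / ln (real m) < s" unfolding s_def by linarith
  then have "ln (fib_pressure 1) < s * (real 1 * ln (real m))" using ln_m_pos by (simp add: field_simps)
  then have "hausdorff_measure s X = 0" by (intro hausdorff_measure_zero[of s 1]) (auto simp: s_def)
  then have "s \<in> {s. 0 < s \<and> hausdorff_measure s X = 0}" unfolding s_def by simp
  then show ?thesis unfolding hausdorff_dim_def using assms by (intro cInf_greatest) auto
qed

text \<open>If \<open>hI = hy + hF\<close>, then a fixed proportion of all \<open>y\<close>-words of loops carries fibres of
  almost maximal size, so the fibres may be cut down to a common size.\<close>

lemma uniform_loops_exist:
  assumes eq: "hI = hy + hF"
  obtains \<kappa> where "0 < \<kappa>" "\<And>q. 1 \<le> q \<Longrightarrow> \<exists>W v L a b. v \<in> V \<and> q \<le> L \<and> (\<forall>w\<in>W. walk v w v \<and> length w = L) \<and>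
    inj_on (map pair) W \<and> card (map yd ` W) = a \<and> (\<forall>u\<in>map yd ` W. card {w \<in> W. map yd w = u} = b) \<and>
    \<kappa> * exp (real L * hy) \<le> real a \<and> \<kappa> * exp (real L * hF) \<le> real b"
proof -
  \<comment> \<open>One \<open>CC\<close> comes from the growth bound, one from fixing both end
    vertices, and \<open>exp (gap * hI)\<close> from closing walks up to loops. The further factor
    \<open>2 * CC\<close> in \<open>\<kappa>\<close> lets \<open>y\<close>-words with small fibres
    carry at most half of the loops guaranteed by \<open>\<kappa>1\<close>.\<close>
  define \<kappa>1 where "\<kappa>1 = 1 / ((real CC)\<^sup>2 * exp (real gap * hI))"
  define \<kappa> where "\<kappa> = \<kappa>1 / (2 * real CC)"
  have \<kappa>1: "0 < \<kappa>1" unfolding \<kappa>1_def using CC_real by simp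
  have \<kappa>: "0 < \<kappa>" unfolding \<kappa>_def using \<kappa>1 CC_real by simp
  have "\<exists>W v L a b. v \<in> V \<and> q \<le> L \<and> (\<forall>w\<in>W. walk v w v \<and> length w = L) \<and>
    inj_on (map pair) W \<and> card (map yd ` W) = a \<and> (\<forall>u\<in>map yd ` W. card {w \<in> W. map yd w = u} = b) \<and>
    \<kappa> * exp (real L * hy) \<le> real a \<and> \<kappa> * exp (real L * hF) \<le> real b" for q :: nat
  proof -
    obtain v v' where v: "v \<in> V" "v' \<in> V"
      "card (map pair ` adm q) \<le> (card V)\<^sup>2 * card (map pair ` {w \<in> adm q. walk v w v'})"
      using two_ended[of "adm q" q pair] by blast
    obtain c0 where c0: "walk v' c0 v" "length c0 \<le> gap" using connector[OF v(2,1)] .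
    define L where "L = q + length c0"
    define A where "A = (\<lambda>w. w @ c0) ` {w \<in> adm q. walk v w v'}"
    have A: "walk v w v \<and> length w = L" if "w \<in> A" for w
      using that c0(1) adm_length unfolding A_def L_def by (auto simp: walk_append)
    have "card (map pair ` A) = card ((\<lambda>s. s @ map pair c0) ` map pair ` {w \<in> adm q. walk v w v'})"
      unfolding A_def image_image by simp
    also have "\<dots> = card (map pair ` {w \<in> adm q. walk v w v'})" by (intro card_image) (auto simp: inj_on_def)
    finally have cA0: "cnt pair q \<le> (card V)\<^sup>2 * card (map pair ` A)" using v(3) unfolding cnt_def by simp
    have cA: "\<kappa>1 * exp (real L * hI) \<le> real (card (map pair ` A))"
    proof -
      have "cnt pair q \<le> CC * card (map pair ` A)"
        by (rule order_trans[OF cA0 mult_right_mono[OF CC_ge(5)]]) simp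
      then have c: "real (cnt pair q) \<le> real CC * real (card (map pair ` A))" by (simp only: of_nat_mult[symmetric] of_nat_le_iff)
      have "real L * hI \<le> real gap * hI + real q * hI"
      proof -
        have "real L \<le> real gap + real q" unfolding L_def using c0(2) by simp
        from mult_right_mono[OF this hI_growth(1)] show ?thesis by (simp add: algebra_simps)
      qed
      then have "exp (real L * hI) \<le> exp (real gap * hI) * exp (real q * hI)" by (simp flip: exp_add)
      also have "\<dots> \<le> exp (real gap * hI) * (real CC * (real CC * real (card (map pair ` A))))"
        using hI_growth(2)[of q] mult_left_mono[OF c, of "real CC"] by (intro mult_left_mono) auto
      finally show ?thesis unfolding \<kappa>1_def using CC_real by (simp add: field_simps power2_eq_square)
    qed
    \<comment> \<open>One edge word is kept for each word of digit pairs, so that edge words may be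
      counted from here on.\<close>
    obtain A' where A': "A' \<subseteq> A" "inj_on (map pair) A'" "map pair ` A' = map pair ` A"
      using subset_image_inj[of "map pair ` A" "map pair" A] by auto
    have A'_adm: "A' \<subseteq> adm L" using A A'(1) v(1) by (auto intro: admI)
    have finA': "finite A'" by (rule finite_subset[OF A'_adm finite_adm])
    have cA': "\<kappa>1 * exp (real L * hI) \<le> real (card A')"
      using cA card_image[OF A'(2)] unfolding A'(3) by simp
    define N where "N u = card {w \<in> A'. map yd w = u}" for u
    define Y where "Y = map yd ` A'"
    have finY: "finite Y" unfolding Y_def using finA' by simp
    have N_le: "real (N u) \<le> real CC * exp (real L * hF)" if "u \<in> Y" for u
    proof -
      have lu: "length u = L" using that A'_adm adm_length unfolding Y_def by auto
      have inj: "inj_on (map pair) {w \<in> A'. map yd w = u}" by (rule inj_on_subset[OF A'(2)]) auto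
      have "N u = card (map pair ` {w \<in> A'. map yd w = u})" unfolding N_def by (rule card_image[OF inj, symmetric])
      also have "\<dots> \<le> fib u" unfolding fib_pair lu using A'_adm by (intro card_mono image_mono) auto
      also have "\<dots> \<le> max_fib L" by (rule fib_le_max_fib[OF lu])
      finally have "real (N u) \<le> real (max_fib L)" by simp
      with hF_growth(3)[of L] show ?thesis by linarith
    qed
    have cardY: "real (card Y) \<le> real CC * exp (real L * hy)"
    proof -
      have "card Y \<le> cnt yd L" unfolding Y_def cnt_def using A'_adm by (intro card_mono image_mono) auto
      then have "real (card Y) \<le> real (cnt yd L)" by simp
      with hy_growth(3)[of L] show ?thesis by linarith
    qed
    have sumN: "(\<Sum>u\<in>Y. real (N u)) = real (card A')"
    proof -
      have "card A' = (\<Sum>w\<in>A'. 1)" by simp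
      also have "\<dots> = (\<Sum>u\<in>map yd ` A'. \<Sum>w\<in>{w. w \<in> A' \<and> map yd w = u}. 1)" by (rule sum.image_gen[OF finA'])
      also have "\<dots> = (\<Sum>u\<in>Y. N u)" unfolding Y_def N_def by simp
      finally show ?thesis by simp
    qed
    define th where "th = \<kappa> * exp (real L * hF)"
    have th: "0 < th" unfolding th_def using \<kappa> by simp
    \<comment> \<open>The words outside \<open>G\<close> account for at most half of the lower bound
      in \<open>cA'\<close>. As no fibre exceeds \<open>CC * exp (L * hF)\<close>, the remaining
      half forces \<open>G\<close> to be large.\<close>
    define G where "G = {u \<in> Y. th \<le> real (N u)}"
    have split: "exp (real L * hI) = exp (real L * hy) * exp (real L * hF)"
      unfolding eq by (simp add: exp_add[symmetric] algebra_simps)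
    have "(\<Sum>u\<in>Y. real (N u)) = (\<Sum>u\<in>G. real (N u)) + (\<Sum>u\<in>Y - G. real (N u))"
      using finY by (subst sum.subset_diff[of G Y]) (auto simp: G_def)
    also have "(\<Sum>u\<in>Y - G. real (N u)) \<le> (\<Sum>u\<in>Y - G. th)" by (intro sum_mono) (auto simp: G_def)
    also have "(\<Sum>u\<in>Y - G. th) \<le> (\<Sum>u\<in>Y. th)" using finY th by (intro sum_mono2) auto
    also have "\<dots> = real (card Y) * th" by simp
    also have "\<dots> \<le> (real CC * exp (real L * hy)) * th" using th by (intro mult_right_mono cardY) auto
    also have "\<dots> = \<kappa>1 / 2 * exp (real L * hI)" unfolding th_def \<kappa>_def split using CC_real by simp
    also have "(\<Sum>u\<in>G. real (N u)) \<le> (\<Sum>u\<in>G. real CC * exp (real L * hF))"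
      by (intro sum_mono N_le) (auto simp: G_def)
    also have "\<dots> = real (card G) * (real CC * exp (real L * hF))" by simp
    finally have "\<kappa>1 / 2 * exp (real L * hI) \<le> real (card G) * (real CC * exp (real L * hF))"
      using cA' unfolding sumN by linarith
    then have cG: "\<kappa> * exp (real L * hy) \<le> real (card G)"
      unfolding \<kappa>_def split using CC_real by (simp add: field_simps)
    \<comment> \<open>Rounding up still gives \<open>b \<le> N u\<close> on \<open>G\<close>,
      because \<open>N u\<close> is an integer.\<close>
    define b where "b = nat \<lceil>th\<rceil>"
    have b: "th \<le> real b" unfolding b_def by linarith
    have "b \<le> N u" if "u \<in> G" for u using that unfolding G_def b_def by (simp add: nat_le_iff ceiling_le_iff)
    then have "\<forall>u\<in>G. \<exists>S. S \<subseteq> {w \<in> A'. map yd w = u} \<and> card S = b"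
      unfolding N_def by (meson obtain_subset_with_card_n)
    then obtain S where S: "\<And>u. u \<in> G \<Longrightarrow> S u \<subseteq> {w \<in> A'. map yd w = u} \<and> card (S u) = b" by metis
    define W where "W = (\<Union>u\<in>G. S u)"
    have W_sub: "W \<subseteq> A'" unfolding W_def using S by blast
    have W_fib: "{w \<in> W. map yd w = u} = S u" if "u \<in> G" for u
      unfolding W_def using S that by blast
    have b1: "0 < b" using b th by linarith
    have W_Y: "map yd ` W = G"
    proof
      show "map yd ` W \<subseteq> G" unfolding W_def using S by blast
      show "G \<subseteq> map yd ` W"
      proof
        fix u assume u: "u \<in> G"
        then have "S u \<noteq> {}" using S b1 by fastforce
        then show "u \<in> map yd ` W" unfolding W_def using S[OF u] u by blast
      qed
    qed
    have "inj_on (map pair) W" by (rule inj_on_subset[OF A'(2) W_sub])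
    moreover have "\<forall>w\<in>W. walk v w v \<and> length w = L" using W_sub A'(1) A by blast
    moreover have "\<forall>u\<in>map yd ` W. card {w \<in> W. map yd w = u} = b" unfolding W_Y using W_fib S by simp
    moreover have "q \<le> L" unfolding L_def by simp
    ultimately show ?thesis
      using v(1) cG b unfolding th_def by (intro exI[of _ W] exI[of _ v] exI[of _ L] exI[of _ "card G"] exI[of _ b]) (simp add: W_Y)
  qed
  with \<kappa> that show thesis by blast
qed

lemma hausdorff_dim_ge_dA:
  assumes eq: "hI = hy + hF"
  shows "dA \<le> hausdorff_dim X"
proof (rule hausdorff_dim_ge)
  fix s assume s: "0 < s" "hausdorff_measure s X = 0"
  obtain \<kappa> where \<kappa>: "0 < \<kappa>" "\<And>q. 1 \<le> q \<Longrightarrow> \<exists>W v L a b. v \<in> V \<and> q \<le> L \<and> (\<forall>w\<in>W. walk v w v \<and> length w = L) \<and>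
    inj_on (map pair) W \<and> card (map yd ` W) = a \<and> (\<forall>u\<in>map yd ` W. card {w \<in> W. map yd w = u} = b) \<and>
    \<kappa> * exp (real L * hy) \<le> real a \<and> \<kappa> * exp (real L * hF) \<le> real b"
    using uniform_loops_exist[OF eq] by blast
  \<comment> \<open>\<open>\<kappa>\<close> does not depend on \<open>q\<close>, so its effect on
    the dimension is of order \<open>1 / q\<close> and vanishes in the limit.\<close>
  define c where "c = 2 * \<bar>ln \<kappa>\<bar> / ln (real m)"
  have "dA - c / real q \<le> s" if q: "1 \<le> q" for q
  proof -
    obtain W v L a b where W: "v \<in> V" "q \<le> L" "\<forall>w\<in>W. walk v w v \<and> length w = L"
      "inj_on (map pair) W" "card (map yd ` W) = a" "\<forall>u\<in>map yd ` W. card {w \<in> W. map yd w = u} = b"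
      "\<kappa> * exp (real L * hy) \<le> real a" "\<kappa> * exp (real L * hF) \<le> real b" using \<kappa>(2)[OF q] by blast
    have pos: "0 < \<kappa> * exp (real L * hy)" "0 < \<kappa> * exp (real L * hF)" using \<kappa>(1) by auto
    then have ab: "0 < real a" "0 < real b" using W(7,8) by linarith+
    have L: "1 \<le> L" using q W(2) by simp
    define d where "d = (ln (real a) + \<alpha> * ln (real b)) / (real L * ln (real m))"
    obtain C where C: "0 < C" "\<And>r0. 0 < r0 \<Longrightarrow> \<exists>(T :: (nat \<Rightarrow> 'e list) set) p. finite T \<and> T \<noteq> {} \<and> p ` T \<subseteq> X \<and>
      (\<forall>r U. r0 \<le> r \<longrightarrow> r \<le> 1 \<longrightarrow> bounded U \<longrightarrow> diameter U \<le> r \<longrightarrow>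
        real (card {\<tau> \<in> T. p \<tau> \<in> U}) \<le> C * r powr d * real (card T))"
      using uniform_loops_mass[of W v L a b] W L ab unfolding d_def by auto
    have "d \<le> s" by (rule mass_distribution[OF compact_X s C])
    have "ln (\<kappa> * exp (real L * hy)) \<le> ln (real a)" "ln (\<kappa> * exp (real L * hF)) \<le> ln (real b)"
      using W(7,8) pos ab by simp_all
    then have lab: "ln \<kappa> + real L * hy \<le> ln (real a)" "ln \<kappa> + real L * hF \<le> ln (real b)"
      using \<kappa>(1) by (simp_all add: ln_mult)
    have "real L * (hy + \<alpha> * hF) - 2 * \<bar>ln \<kappa>\<bar> \<le> ln (real a) + \<alpha> * ln (real b)"
    proof -
      have "\<alpha> * (ln \<kappa> + real L * hF) \<le> \<alpha> * ln (real b)" using lab(2) \<alpha>_bounds by (intro mult_left_mono) auto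
      moreover have "- \<bar>ln \<kappa>\<bar> \<le> \<alpha> * ln \<kappa>"
      proof -
        have "\<alpha> * \<bar>ln \<kappa>\<bar> \<le> 1 * \<bar>ln \<kappa>\<bar>" using \<alpha>_bounds by (intro mult_right_mono) auto
        moreover have "- (\<alpha> * \<bar>ln \<kappa>\<bar>) \<le> \<alpha> * ln \<kappa>"
          using mult_left_mono[of "- \<bar>ln \<kappa>\<bar>" "ln \<kappa>" \<alpha>] \<alpha>_bounds by simp
        ultimately show ?thesis by linarith
      qed
      ultimately show ?thesis using lab(1) by (simp add: algebra_simps)
    qed
    then have "(real L * (hy + \<alpha> * hF) - 2 * \<bar>ln \<kappa>\<bar>) / (real L * ln (real m)) \<le> d"
      unfolding d_def using ln_m_pos by (intro divide_right_mono) auto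
    moreover have "(real L * (hy + \<alpha> * hF) - 2 * \<bar>ln \<kappa>\<bar>) / (real L * ln (real m)) = dA - c / real L"
      unfolding dA_def c_def using L ln_m_pos by (simp add: diff_divide_distrib)
    moreover have "c / real L \<le> c / real q"
      using W(2) q ln_m_pos unfolding c_def by (intro divide_left_mono) auto
    ultimately show ?thesis using \<open>d \<le> s\<close> by linarith
  qed
  moreover have "(\<lambda>q. dA - c / real q) \<longlonglongrightarrow> dA - 0" by (intro tendsto_intros lim_const_over_n)
  ultimately show "dA \<le> s" by (intro LIMSEQ_le_const2[of "\<lambda>q. dA - c / real q" dA]) auto
qed

text \<open>No fibre has more than \<open>max_fib k\<close> words, and constants vanish in the
  growth rate. Failure of the entropy identity is therefore always the strict inequality
  \<open>hI < hy + hF\<close>.\<close>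

lemma hI_le: "hI \<le> hy + hF"
proof (rule ccontr)
  assume "\<not> hI \<le> hy + hF"
  then have pos: "0 < hI - (hy + hF)" by simp
  have "real k * (hI - (hy + hF)) \<le> ln (real CC ^ 3)" for k
  proof -
    have "exp (real k * hI) \<le> real CC * real (cnt pair k)" by (rule hI_growth)
    also have "\<dots> \<le> real CC * (real (cnt yd k) * real (max_fib k))"
    proof (rule mult_left_mono)
      show "real (cnt pair k) \<le> real (cnt yd k) * real (max_fib k)"
        using cnt_pair_le[of k] by (simp only: of_nat_mult[symmetric] of_nat_le_iff)
    qed simp
    also have "\<dots> \<le> real CC * ((real CC * exp (real k * hy)) * (real CC * exp (real k * hF)))"
      by (intro mult_left_mono mult_mono hy_growth hF_growth) auto
    also have "\<dots> = real CC ^ 3 * exp (real k * (hy + hF))"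
      by (simp add: exp_add power3_eq_cube algebra_simps)
    finally have "exp (real k * hI) / exp (real k * (hy + hF)) \<le> real CC ^ 3" by (simp add: divide_le_eq)
    then have "exp (real k * (hI - (hy + hF))) \<le> real CC ^ 3"
      unfolding exp_diff[symmetric] by (simp only: right_diff_distrib)
    then show ?thesis using CC_real by (subst ln_ge_iff) auto
  qed
  moreover obtain k where "ln (real CC ^ 3) / (hI - (hy + hF)) < real k" using reals_Archimedean2 by blast
  then have "ln (real CC ^ 3) < real k * (hI - (hy + hF))" using pos by (simp only: pos_divide_less_eq)
  ultimately show False by (metis not_less)
qed

theorem dimensions:
  "assouad_dim X = hy / ln (real m) + hF / ln (real n)"
  "box_dim X = assouad_dim X \<longleftrightarrow> hI = hy + hF"
  "hausdorff_dim X = box_dim X \<longleftrightarrow> hI = hy + hF"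
proof -
  show "assouad_dim X = hy / ln (real m) + hF / ln (real n)"
    unfolding assouad_dim_X dA_def \<alpha>_def using ln_m_pos by (simp add: add_divide_distrib)
  have diff: "dA - dB = \<alpha> * (hy + hF - hI) / ln (real m)"
    unfolding dA_def dB_def by (simp add: diff_divide_distrib[symmetric] algebra_simps)
  show "box_dim X = assouad_dim X \<longleftrightarrow> hI = hy + hF"
  proof -
    have "dA - dB = 0 \<longleftrightarrow> hI = hy + hF" unfolding diff using \<alpha>_bounds ln_m_pos by auto
    then show ?thesis unfolding assouad_dim_X box_dim_X by auto
  qed
  show "hausdorff_dim X = box_dim X \<longleftrightarrow> hI = hy + hF"
  proof
    assume "hausdorff_dim X = box_dim X"
    then have "\<not> hI < hy + hF" using hausdorff_dim_less_dB unfolding box_dim_X by fastforce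
    then show "hI = hy + hF" using hI_le by simp
  next
    assume eq: "hI = hy + hF"
    then have "dA = dB" using diff by simp
    then show "hausdorff_dim X = box_dim X"
      using hausdorff_dim_le_dB hausdorff_dim_ge_dA[OF eq] unfolding box_dim_X by simp
  qed
qed

end

section \<open>Coding the attractor\<close>

context carpet_graph
begin

text \<open>The exact identity keeps the contribution \<open>q\<close> of the unread tail; a tail in
  the unit square then becomes membership in a closed cell. The induction is on the last letter, the
  end at which \<open>radix\<close> grows.\<close>

lemma attractor_point:
  assumes K: "\<forall>v\<in>V. K v = (\<Union>e\<in>{e \<in> E. i e = v}. psi n m (xd e) (yd e) ` K (t e))"
    and "walk v w v'" "v \<in> V" "q \<in> K v'"
  shows "\<exists>p\<in>K v. fst p * real n ^ length w = real (radix n (map xd w)) + fst q \<and>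
    snd p * real m ^ length w = real (radix m (map yd w)) + snd q"
  using assms(2-)
proof (induction w arbitrary: v' q rule: rev_induct)
  case Nil
  then show ?case by auto
next
  case (snoc e w)
  then have w: "walk v w (i e)" "e \<in> E" "t e = v'" by (auto simp: walk_append)
  define q' where "q' = psi n m (xd e) (yd e) q"
  have "q' \<in> K (i e)"
    using bspec[OF K, of "i e"] edge[OF w(2)] w(2,3) snoc.prems(3) unfolding q'_def by auto
  from snoc.IH[OF w(1) snoc.prems(2) this] obtain p where p: "p \<in> K v"
    "fst p * real n ^ length w = real (radix n (map xd w)) + fst q'"
    "snd p * real m ^ length w = real (radix m (map yd w)) + snd q'" by blast
  have q': "fst q' * real n = fst q + real (xd e)" "snd q' * real m = snd q + real (yd e)"
    unfolding q'_def psi_def using m_ge_2 m_less_n by (auto simp: case_prod_beta)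
  have "fst p * real n ^ length (w @ [e]) = (fst p * real n ^ length w) * real n"
    "snd p * real m ^ length (w @ [e]) = (snd p * real m ^ length w) * real m" by simp_all
  then show ?case using p(1) q' unfolding p(2,3) by (intro bexI[of _ p]) (simp_all add: distrib_right)
qed

lemma attractor_word:
  assumes K: "\<forall>v\<in>V. K v = (\<Union>e\<in>{e \<in> E. i e = v}. psi n m (xd e) (yd e) ` K (t e))"
    and "p \<in> K v" "v \<in> V"
  shows "\<exists>w v' q. walk v w v' \<and> length w = k \<and> q \<in> K v' \<and> fst p * real n ^ k = real (radix n (map xd w)) + fst q \<and>
    snd p * real m ^ k = real (radix m (map yd w)) + snd q"
proof (induction k)
  case 0
  show ?case using assms by (intro exI[of _ "[]"] exI[of _ v] exI[of _ p]) auto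
next
  case (Suc k)
  then obtain w v' q where w: "walk v w v'" "length w = k" "q \<in> K v'"
    "fst p * real n ^ k = real (radix n (map xd w)) + fst q"
    "snd p * real m ^ k = real (radix m (map yd w)) + snd q" by blast
  have "v' \<in> V" by (rule walk_in_V[OF w(1) assms(3)])
  then obtain e q' where e: "e \<in> E" "i e = v'" "q' \<in> K (t e)" "q = psi n m (xd e) (yd e) q'"
    using bspec[OF K, of v'] w(3) by auto
  have q: "fst q * real n = fst q' + real (xd e)" "snd q * real m = snd q' + real (yd e)"
    unfolding e(4) psi_def using m_ge_2 m_less_n by (auto simp: case_prod_beta)
  have "walk v (w @ [e]) (t e)" using w(1) e(1,2) by (auto simp: walk_append)
  moreover have "fst p * real n ^ Suc k = real (radix n (map xd (w @ [e]))) + fst q'"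
  proof -
    have "fst p * real n ^ Suc k = (fst p * real n ^ k) * real n" by simp
    then show ?thesis using q(1) unfolding w(4) by (simp add: distrib_right)
  qed
  moreover have "snd p * real m ^ Suc k = real (radix m (map yd (w @ [e]))) + snd q'"
  proof -
    have "snd p * real m ^ Suc k = (snd p * real m ^ k) * real m" by simp
    then show ?thesis using q(2) unfolding w(5) by (simp add: distrib_right)
  qed
  ultimately show ?case using w(2) e(3) by (intro exI[of _ "w @ [e]"] exI[of _ "t e"] exI[of _ q']) simp
qed

lemma attractor_carpet_set:
  assumes K: "\<forall>v\<in>V. K v = (\<Union>e\<in>{e \<in> E. i e = v}. psi n m (xd e) (yd e) ` K (t e))"
    and cpt: "\<And>v. v \<in> V \<Longrightarrow> K v \<noteq> {} \<and> compact (K v) \<and> K v \<subseteq> {0..1} \<times> {0..1}"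
  shows "carpet_set V E i t n m xd yd (\<Union>v\<in>V. K v)"
proof unfold_locales
  show "compact (\<Union>v\<in>V. K v)" using finite_V cpt by (intro compact_UN) auto
next
  fix w k assume w: "w \<in> adm k"
  then obtain v v' where v: "v \<in> V" "v' \<in> V" "walk v w v'" "length w = k" by (auto simp: adm_iff)
  obtain q where q: "q \<in> K v'" using cpt[OF v(2)] by blast
  then have q01: "0 \<le> fst q" "fst q \<le> 1" "0 \<le> snd q" "snd q \<le> 1" using cpt[OF v(2)] by auto
  show "\<exists>p\<in>(\<Union>v\<in>V. K v). in_cell n (fst p) (map xd w) \<and> in_cell m (snd p) (map yd w)"
  proof -
    obtain p where "p \<in> K v" "fst p * real n ^ length w = real (radix n (map xd w)) + fst q"
      "snd p * real m ^ length w = real (radix m (map yd w)) + snd q"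
      using attractor_point[OF K v(3,1) q] by blast
    with v(1) q01 show ?thesis by (intro bexI[of _ p]) (auto simp: in_cell_def)
  qed
next
  fix p k assume "p \<in> (\<Union>v\<in>V. K v)"
  then obtain v where v: "v \<in> V" "p \<in> K v" by blast
  obtain w v' q where w: "walk v w v'" "length w = k" "q \<in> K v'"
    "fst p * real n ^ k = real (radix n (map xd w)) + fst q"
    "snd p * real m ^ k = real (radix m (map yd w)) + snd q" using attractor_word[OF K v(2,1)] by blast
  have "v' \<in> V" by (rule walk_in_V[OF w(1) v(1)])
  then have q01: "0 \<le> fst q" "fst q \<le> 1" "0 \<le> snd q" "snd q \<le> 1" using cpt w(3) by force+
  have "w \<in> adm k" using w v(1) by (auto intro: admI)
  then show "\<exists>w\<in>adm k. in_cell n (fst p) (map xd w) \<and> in_cell m (snd p) (map yd w)"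
    using w(2,4,5) q01 by (intro bexI[of _ w]) (simp_all add: in_cell_def)
qed

end

theorem theorem4:
  fixes V :: "'v set" and E :: "'e set" and i t :: "'e \<Rightarrow> 'v"
    and n m :: nat and xd yd :: "'e \<Rightarrow> nat"
    and K :: "'v \<Rightarrow> (real \<times> real) set"
  assumes "finite V" and "V \<noteq> {}" and "finite E"
    and "\<forall>e\<in>E. i e \<in> V \<and> t e \<in> V"
    and "\<forall>v\<in>V. \<exists>e\<in>E. i e = v"
    and "2 \<le> m" and "m < n"
    and "\<forall>e\<in>E. xd e < n \<and> yd e < m"
    and "\<forall>v\<in>V. K v \<noteq> {} \<and> compact (K v) \<and> K v \<subseteq> {0..1} \<times> {0..1}"
    and "\<forall>v\<in>V. K v = (\<Union>e\<in>{e\<in>E. i e = v}. psi n m (xd e) (yd e) ` K (t e))"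
    and "irreducible_graph V E i t"
  shows "assouad_dim (\<Union>v\<in>V. K v) =
           htop_piI E i t yd / ln (real m)
           + (SUP y\<in>piI E i t yd. htop_fibre E i t xd yd y) / ln (real n)
       \<and> ((box_dim (\<Union>v\<in>V. K v) = assouad_dim (\<Union>v\<in>V. K v)
             \<longleftrightarrow> hausdorff_dim (\<Union>v\<in>V. K v) = box_dim (\<Union>v\<in>V. K v))
          \<and> (hausdorff_dim (\<Union>v\<in>V. K v) = box_dim (\<Union>v\<in>V. K v)
             \<longleftrightarrow> htop_I E i t xd yd = htop_piI E i t yd
                   + (SUP y\<in>piI E i t yd. htop_fibre E i t xd yd y)))"
proof -
  interpret graph: carpet_graph V E i t n m xd yd
    by (rule carpet_graph.intro) (use assms(1-8,11) in blast)+
  interpret carpet_set V E i t n m xd yd "\<Union>v\<in>V. K v"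
    by (rule graph.attractor_carpet_set[OF assms(10)]) (use assms(9) in blast)
  show ?thesis
    unfolding graph.SUP_htop_fibre graph.hI_def[symmetric] graph.hy_def[symmetric] dimensions(2,3)
    using dimensions(1) by blast
qed

end
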